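(* Let $\epsilon>0$. (a) Fix an integer $m\ge 0$. Then there is $K$ such that for every even integer $k\ge K$, the zeros of $f_{k,m}(z)$ interlace with the zeros of $f_{k+12,m}(z)$ on the arc $\mathcal{A}_\epsilon=\{e^{i\theta}: \frac{\pi}{2}<\theta<\frac{2\pi}{3}-\epsilon\}$. (b) Fix an even integer $k$. Then there is $M$ such that for every integer $m\ge M$, the zeros of $f_{k,m}(z)$ interlace with the zeros of $f_{k,m+1}(z)$ on $\mathcal{A}_\epsilon$.
   Context: Write $q=e^{2\pi i z}$ for $z$ in the upper half-plane. For an even integer $k$, write $k=12\ell+k'$ with $k'\in\{0,4,6,8,10,14\}$ and $\ell\in\mathbb{Z}$. For each integer $m\ge -\ell$, $f_{k,m}(z)$ denotes the unique weakly holomorphic modular form of weight $k$ for $\mathrm{SL}_2(\mathbb{Z})$ (holomorphic on the upper half-plane, poles allowed at the cusp) with Fourier expansion $f_{k,m}(z)=q^{-m}+O(q^{\ell+1})$; these form a basis of the space of weakly holomorphic modular forms of weight $k$. Two functions are said to have interlacing zeros on an arc if every zero of one function on the arc is contained in an open subarc whose endpoints are zeros of the other function, and each such subarc contains exactly one zero; i.e., ordering the zeros on the arc by the argument $\theta$, the zeros of the two functions strictly alternate. *)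

theory Defs
  imports "HOL-Complex_Analysis.Complex_Analysis"
begin

definition upper_half_plane :: "complex set" where
  "upper_half_plane = {z. Im z > 0}"

definition nome :: "complex \<Rightarrow> complex" where
  "nome z = exp (2 * of_real pi * \<i> * z)"

text \<open>
  \<open>a n\<close> is the coefficient of \<open>q\<^sup>n\<close>; only finitely many negative powers of \<open>q\<close> may occur,
  so having such an expansion means being meromorphic at the cusp.
\<close>
definition has_q_expansion :: "(complex \<Rightarrow> complex) \<Rightarrow> (int \<Rightarrow> complex) \<Rightarrow> bool" where
  "has_q_expansion f a \<longleftrightarrow>
     (\<exists>N. \<forall>n<N. a n = 0) \<and>
     (\<forall>z\<in>upper_half_plane. ((\<lambda>n. a n * nome z powi n) has_sum f z) UNIV)"

definition weakly_holomorphic_modular_form :: "int \<Rightarrow> (complex \<Rightarrow> complex) \<Rightarrow> bool" where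
  "weakly_holomorphic_modular_form k f \<longleftrightarrow>
     f holomorphic_on upper_half_plane \<and>
     (\<forall>a b c d :: int. a * d - b * c = 1 \<longrightarrow>
        (\<forall>z\<in>upper_half_plane.
           f ((of_int a * z + of_int b) / (of_int c * z + of_int d)) =
             (of_int c * z + of_int d) powi k * f z)) \<and>
     (\<exists>a. has_q_expansion f a)"

text \<open>For even \<open>k\<close>, this is the \<open>\<ell>\<close> in \<open>k = 12\<ell> + k'\<close>.\<close>
definition weight_ell :: "int \<Rightarrow> int" where
  "weight_ell k = (THE l. k - 12 * l \<in> {0, 4, 6, 8, 10, 14})"

text \<open>
  The form \<open>f\<^bsub>k,m\<^esub> = q\<^sup>-\<^sup>m + O(q\<^bsup>\<ell>+1\<^esup>)\<close>, meaningful for even \<open>k\<close> and \<open>m \<ge> -\<ell>\<close>. As functions are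
  total, it is set to \<open>0\<close> outside the upper half-plane in order to be unique.
\<close>
definition basis_form :: "int \<Rightarrow> int \<Rightarrow> complex \<Rightarrow> complex" where
  "basis_form k m = (THE f.
     weakly_holomorphic_modular_form k f \<and>
     (\<exists>a. has_q_expansion f a \<and>
          (\<forall>n\<le>weight_ell k. a n = (if n = -m then 1 else 0))) \<and>
     (\<forall>z. z \<notin> upper_half_plane \<longrightarrow> f z = 0))"

text \<open>Zeros on the open arc of the unit circle from angle \<open>\<alpha>\<close> to angle \<open>\<beta>\<close>, given by their angles.\<close>
definition arc_zeros :: "(complex \<Rightarrow> complex) \<Rightarrow> real \<Rightarrow> real \<Rightarrow> real set" where
  "arc_zeros f \<alpha> \<beta> = {\<theta>. \<alpha> < \<theta> \<and> \<theta> < \<beta> \<and> f (cis \<theta>) = 0}"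

definition consecutive_in :: "real set \<Rightarrow> real \<Rightarrow> real \<Rightarrow> bool" where
  "consecutive_in A a b \<longleftrightarrow> a \<in> A \<and> b \<in> A \<and> a < b \<and> A \<inter> {a<..<b} = {}"

text \<open>
  Strict alternation of the zeros of \<open>f\<close> and \<open>g\<close> on the arc. The first and the last zero on the arc
  may belong to either function and need not be enclosed by zeros of the other one.
\<close>
definition interlacing_zeros_on_arc ::
  "(complex \<Rightarrow> complex) \<Rightarrow> (complex \<Rightarrow> complex) \<Rightarrow> real \<Rightarrow> real \<Rightarrow> bool" where
  "interlacing_zeros_on_arc f g \<alpha> \<beta> \<longleftrightarrow>
     (let A = arc_zeros f \<alpha> \<beta>; B = arc_zeros g \<alpha> \<beta> in
        finite A \<and> finite B \<and> A \<inter> B = {} \<and>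
        (\<forall>a b. consecutive_in A a b \<longrightarrow> (\<exists>!c. c \<in> B \<and> a < c \<and> c < b)) \<and>
        (\<forall>a b. consecutive_in B a b \<longrightarrow> (\<exists>!c. c \<in> A \<and> a < c \<and> c < b)))"

end

theory Submission
  imports Defs
begin

text \<open>
  The generating function of the basis \<open>f_{k,m}\<close> turns \<open>f_{k,m}(z)\<close> into the integral over a circle
  in the \<open>r\<close>-disc of
  \<open>\<Delta>(z)\<^sup>l E_{k'}(z) E_{14-k'}(r) / (\<Delta>(r)\<^sup>l\<^sup>+\<^sup>1 (j(r) - j(z)) r\<^sup>m\<^sup>+\<^sup>1)\<close>. Enlarging the circle beyond the arc picks
  up the poles at \<open>z\<close> and \<open>-1/z\<close>, and possibly at \<open>-1/(z + 1)\<close>. After multiplication by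
  \<open>exp (ik\<theta>/2 - 2\<pi>m sin \<theta>)\<close> the first two poles contribute \<open>2 cos (k\<theta>/2 - 2\<pi>m cos \<theta>)\<close> at \<open>z = cis \<theta>\<close>, and
  everything else is exponentially small in \<open>k\<close> (or \<open>m\<close>) in a complex neighbourhood of any compact
  part of \<open>[\<pi>/2, 2\<pi>/3)\<close>. By Cauchy's estimate the same then holds for the derivative.

  Two real functions whose Wronskian has no zero have interlacing zeros, by Rolle's theorem applied to
  their quotient. For consecutive \<open>k\<close> or \<open>m\<close> the Wronskian of the cosines is bounded away from zero
  except near \<open>\<theta> = \<pi>/2\<close>, where the two phases agree up to a multiple of \<open>\<pi>\<close>. There neither
  function vanishes in the open arc: both cosines are close to \<open>\<plusminus>1\<close>, or both functions vanish at \<open>\<pi>/2\<close>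
  exactly, by modularity under \<open>z \<mapsto> -1/z\<close>, and are monotone nearby.

  The modular input is obtained from the theta product: Liouville's theorem gives the inversion law of
  \<open>\<Delta>\<close>, Ramanujan's differential equations carry it over to \<open>E\<^sub>2\<close>, \<open>E\<^sub>4\<close>, \<open>E\<^sub>6\<close>, and the maximum principle on the
  fundamental domain replaces the valence formula. The poles of the kernel are located by injectivity
  of \<open>j\<close> modulo the modular group.
\<close>

section \<open>Infinite products\<close>

text \<open>The arc stops short of 2\<pi>/3 because there -1/(z + 1) reaches the height of z and
  -1/z, and its residue no longer decays. Before that point z and -1/z lie above sqrt 3 / 2, so a
  contour of height 3/5 or 7/10 passes below both; two heights are on offer because the third pole
  may sit on one of them. Decay in the weight rests on \<Delta> being strictly smaller in modulus on
  the arc than on the contour, decay in m on the gap between the two heights. In (b) the weight is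
  fixed and \<ell> may be negative, which is why the estimates carry two powers \<alpha>^l +
  \<beta>^l instead of one. The Wronskian multiplies the errors by phase speeds of order |k| + |m|,
  so they have to be small even after multiplication by that size. The zero-free piece next to
  \<pi>/2 is governed by the sum of the two phases: up to the point where it equals 2 each phase
  stays below \<pi>/2, and beyond it the sine of the phase difference, times the speeds, outweighs
  the difference of the speeds.\<close>

definition qpoch :: "complex \<Rightarrow> complex \<Rightarrow> complex" where
  "qpoch a q = (\<Prod>n. 1 - a * q ^ n)"

lemma convergent_prod_qpoch:
  fixes a q :: complex
  assumes "norm q < 1"
  shows "convergent_prod (\<lambda>n. 1 - a * q ^ n)"
proof -
  have "summable (\<lambda>n. norm a * norm q ^ n)"
    using assms by (intro summable_mult summable_geometric) auto
  moreover have "norm ((1 - a * q ^ n) - 1) = norm a * norm q ^ n" for n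
    by (simp add: norm_mult norm_power)
  ultimately have "summable (\<lambda>n. norm ((1 - a * q ^ n) - 1))"
    by presburger
  thus ?thesis
    by (intro abs_convergent_prod_imp_convergent_prod summable_imp_abs_convergent_prod)
qed

lemma qpoch_tendsto:
  assumes "norm q < 1"
  shows "(\<lambda>N. \<Prod>n<N. 1 - a * q ^ n) \<longlonglongrightarrow> qpoch a q"
proof -
  have "(\<lambda>N. \<Prod>n\<le>N. 1 - a * q ^ n) \<longlonglongrightarrow> qpoch a q"
    unfolding qpoch_def by (rule convergent_prod_LIMSEQ[OF convergent_prod_qpoch[OF assms]])
  thus ?thesis
    by (rule LIMSEQ_lessThan_iff_atMost[THEN iffD2])
qed

lemma qpoch_rec:
  assumes "norm q < 1"
  shows "qpoch a q = (1 - a) * qpoch (a * q) q"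
proof -
  have "(\<lambda>N. \<Prod>n<Suc N. 1 - a * q ^ n) \<longlonglongrightarrow> qpoch a q"
    using qpoch_tendsto[OF assms] by (rule LIMSEQ_Suc)
  also have "(\<lambda>N. \<Prod>n<Suc N. 1 - a * q ^ n) = (\<lambda>N. (1 - a) * (\<Prod>n<N. 1 - (a * q) * q ^ n))"
    by (subst prod.lessThan_Suc_shift) (simp add: mult.assoc)
  finally have L: "(\<lambda>N. (1 - a) * (\<Prod>n<N. 1 - (a * q) * q ^ n)) \<longlonglongrightarrow> qpoch a q" .
  have "(\<lambda>N. (1 - a) * (\<Prod>n<N. 1 - (a * q) * q ^ n)) \<longlonglongrightarrow> (1 - a) * qpoch (a * q) q"
    by (intro tendsto_intros qpoch_tendsto assms)
  with L show ?thesis by (rule LIMSEQ_unique)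
qed

lemma qpoch_eq_0_iff:
  assumes "norm q < 1"
  shows "qpoch a q = 0 \<longleftrightarrow> (\<exists>n. a * q ^ n = 1)"
proof -
  have "(\<lambda>n. 1 - a * q ^ n) has_prod qpoch a q"
    unfolding qpoch_def by (rule convergent_prod_has_prod[OF convergent_prod_qpoch[OF assms]])
  from has_prod_eq_0_iff[OF this] show ?thesis by (auto simp: image_iff)
qed

lemma qpoch_self_nonzero:
  assumes "norm q < 1"
  shows "qpoch q q \<noteq> 0"
proof -
  have "q * q ^ n \<noteq> 1" for n
  proof
    assume "q * q ^ n = 1"
    hence "norm q ^ Suc n = 1" by (metis norm_one norm_power power_Suc)
    moreover have "norm q ^ Suc n < 1" using assms by (simp only: power_less_one_iff norm_ge_zero) auto
    ultimately show False by simp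
  qed
  thus ?thesis using qpoch_eq_0_iff[OF assms] by blast
qed

text \<open>The M-test for the terms \<open>f n x - 1\<close> makes the partial products converge
  uniformly on compact sets, so the limit is holomorphic and derivatives pass to the limit. The
  second conclusion serves to read off the derivative of the Euler product at 0.\<close>

lemma holomorphic_on_prodinf:
  fixes f :: "nat \<Rightarrow> complex \<Rightarrow> complex"
  assumes "open S" and hol: "\<And>n. f n holomorphic_on S"
    and bd: "\<And>K. compact K \<Longrightarrow> K \<subseteq> S \<Longrightarrow> \<exists>M. summable M \<and> (\<forall>n. \<forall>x\<in>K. norm (f n x - 1) \<le> M n)"
    and lim: "\<And>x. x \<in> S \<Longrightarrow> (\<lambda>N. \<Prod>n<N. f n x) \<longlonglongrightarrow> g x"
  shows "g holomorphic_on S"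
    and "z \<in> S \<Longrightarrow> (\<lambda>N. deriv (\<lambda>x. \<Prod>n<N. f n x) z) \<longlonglongrightarrow> deriv g z"
proof -
  have ulim: "uniform_limit K (\<lambda>N x. \<Prod>n<N. f n x) g sequentially" if K: "compact K" "K \<subseteq> S" for K
  proof -
    obtain M where M: "summable M" "\<And>n x. x \<in> K \<Longrightarrow> norm (f n x - 1) \<le> M n"
      using bd[OF K] by blast
    have "uniformly_convergent_on K (\<lambda>N x. \<Prod>n<N. f n x)"
    proof (rule uniformly_convergent_on_prod')
      show "uniformly_convergent_on K (\<lambda>N x. \<Sum>n<N. norm (f n x - 1))"
        by (rule Weierstrass_m_test') (use M in auto)
      show "continuous_on K (f n)" for n
        using hol K(2) holomorphic_on_imp_continuous_on holomorphic_on_subset by blast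
    qed (fact K)
    then obtain h where h: "uniform_limit K (\<lambda>N x. \<Prod>n<N. f n x) h sequentially"
      by (auto simp: uniformly_convergent_on_def)
    have "h x = g x" if "x \<in> K" for x
      using tendsto_uniform_limitI[OF h that] lim K that LIMSEQ_unique by blast
    thus ?thesis using h by (subst uniform_limit_cong'[of _ _ _ _ h]) auto
  qed
  show "g holomorphic_on S"
  proof (rule holomorphic_uniform_sequence[OF \<open>open S\<close>])
    show "(\<lambda>x. \<Prod>n<N. f n x) holomorphic_on S" for N
      by (intro holomorphic_intros hol)
    show "\<exists>d>0. cball x d \<subseteq> S \<and> uniform_limit (cball x d) (\<lambda>N x. \<Prod>n<N. f n x) g sequentially"
      if "x \<in> S" for x
      using that \<open>open S\<close> ulim by (meson compact_cball open_contains_cball)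
  qed
  show "(\<lambda>N. deriv (\<lambda>x. \<Prod>n<N. f n x) z) \<longlonglongrightarrow> deriv g z" if "z \<in> S"
  proof -
    obtain d where d: "d > 0" "cball z d \<subseteq> S"
      using \<open>z \<in> S\<close> \<open>open S\<close> by (meson open_contains_cball)
    show ?thesis
    proof (rule deriv_complex_uniform_limit[where A = "ball z d"])
      show "uniform_limit (ball z d) (\<lambda>N x. \<Prod>n<N. f n x) g sequentially"
        using ulim[of "cball z d"] d by (meson ball_subset_cball compact_cball uniform_limit_on_subset)
      show "\<forall>\<^sub>F N in sequentially. (\<lambda>x. \<Prod>n<N. f n x) holomorphic_on ball z d"
        using d hol by (intro always_eventually allI holomorphic_intros)
          (meson ball_subset_cball holomorphic_on_subset subset_trans)
    qed (use d in auto)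
  qed
qed

lemma qpoch_holomorphic:
  assumes "norm q < 1"
  shows "(\<lambda>a. qpoch a q) holomorphic_on S"
proof (rule holomorphic_on_subset)
  show "(\<lambda>a. qpoch a q) holomorphic_on UNIV"
  proof (rule holomorphic_on_prodinf[where f = "\<lambda>n a. 1 - a * q ^ n"])
    fix K :: "complex set" assume "compact K"
    then obtain B where B: "\<And>x. x \<in> K \<Longrightarrow> norm x \<le> B"
      by (meson bounded_iff compact_imp_bounded)
    have "summable (\<lambda>n. B * norm q ^ n)"
      using assms by (intro summable_mult summable_geometric) auto
    moreover have "norm (1 - x * q ^ n - 1) \<le> B * norm q ^ n" if "x \<in> K" for x n
      using B[OF that] by (simp add: norm_mult norm_power mult_right_mono)
    ultimately show "\<exists>M. summable M \<and> (\<forall>n. \<forall>x\<in>K. norm (1 - x * q ^ n - 1) \<le> M n)" by blast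
  next
    show "(\<lambda>N. \<Prod>n<N. 1 - x * q ^ n) \<longlonglongrightarrow> qpoch x q" for x
      by (rule qpoch_tendsto[OF assms])
  qed (auto intro!: holomorphic_intros)
qed auto

lemma qpoch_holomorphic' [holomorphic_intros]:
  assumes "norm q < 1" "f holomorphic_on S"
  shows "(\<lambda>a. qpoch (f a) q) holomorphic_on S"
  using holomorphic_on_compose[OF assms(2) qpoch_holomorphic[OF assms(1)]] by (simp add: o_def)

text \<open>The Euler function, the product of 1 - q^n over n \<ge> 1; its 24th power times q is the
  discriminant.\<close>

definition euler_prod :: "complex \<Rightarrow> complex" where
  "euler_prod q = qpoch q q"

text \<open>The derivative -1 at 0 is the one nontrivial coefficient taken from the product; the
  first coefficients of E2, E4 and E6, and with them the constant 1728, are derived from it.\<close>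

lemma
  shows euler_prod_holomorphic: "euler_prod holomorphic_on ball 0 1"
    and deriv_euler_prod_0: "deriv euler_prod 0 = -1"
proof -
  have bd: "\<exists>M. summable M \<and> (\<forall>n. \<forall>x\<in>K. norm ((1 - x * x ^ n) - 1) \<le> M n)"
    if K: "compact K" "K \<subseteq> ball 0 1" for K :: "complex set"
  proof (cases "K = {}")
    case True
    thus ?thesis by (intro exI[of _ "\<lambda>_. 0"]) auto
  next
    case False
    obtain y where y: "y \<in> K" "\<And>x. x \<in> K \<Longrightarrow> norm x \<le> norm y"
      using continuous_attains_sup[OF K(1) False, of norm] by (auto intro: continuous_intros)
    have "norm y < 1" using y K by auto
    hence "summable (\<lambda>n. norm y ^ Suc n)"
      by (subst summable_Suc_iff) (auto intro: summable_geometric)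
    moreover have "norm ((1 - x * x ^ n) - 1) \<le> norm y ^ Suc n" if "x \<in> K" for x n
    proof -
      have "norm ((1 - x * x ^ n) - 1) = norm x ^ Suc n" by (simp add: norm_mult norm_power)
      also have "\<dots> \<le> norm y ^ Suc n" using y that by (intro power_mono) auto
      finally show ?thesis .
    qed
    ultimately show ?thesis by blast
  qed
  have lim: "(\<lambda>N. \<Prod>n<N. 1 - x * x ^ n) \<longlonglongrightarrow> euler_prod x" if "x \<in> ball 0 1" for x :: complex
    unfolding euler_prod_def using that by (intro qpoch_tendsto) auto
  note * = holomorphic_on_prodinf[where f = "\<lambda>n x. 1 - x * x ^ n" and S = "ball 0 1" and g = euler_prod,
      OF open_ball _ bd lim]
  show "euler_prod holomorphic_on ball 0 1"
    by (rule *(1)) (auto intro!: holomorphic_intros)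
  have "(\<lambda>N. deriv (\<lambda>x. \<Prod>n<N. 1 - x * x ^ n) 0) \<longlonglongrightarrow> deriv euler_prod 0"
    by (rule *(2)) (auto intro!: holomorphic_intros)
  \<comment> \<open>The empty partial product has derivative 0; from one factor on, 1 - x is present
    and the derivative is -1. Hence the shift by \<open>Suc\<close>.\<close>
  hence L: "(\<lambda>N. deriv (\<lambda>x. \<Prod>n<Suc N. 1 - x * x ^ n) 0) \<longlonglongrightarrow> deriv euler_prod 0"
    by (rule LIMSEQ_Suc)
  have D: "deriv (\<lambda>x. \<Prod>n<Suc N. 1 - x * x ^ n) (0::complex) = -1" for N
  proof (rule DERIV_imp_deriv)
    have "((\<lambda>x. \<Prod>n<N. 1 - x * x ^ Suc n) has_field_derivative 0) (at (0::complex))"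
    proof (induction N)
      case (Suc N)
      have "((\<lambda>x::complex. 1 - x * x ^ Suc N) has_field_derivative 0) (at 0)"
        by (auto intro!: derivative_eq_intros)
      from DERIV_mult[OF Suc this] show ?case by simp
    qed simp
    moreover have "((\<lambda>x. 1 - x) has_field_derivative -1) (at (0::complex))"
      by (auto intro!: derivative_eq_intros)
    ultimately have "((\<lambda>x. (1 - x) * (\<Prod>n<N. 1 - x * x ^ Suc n)) has_field_derivative -1) (at (0::complex))"
      by (auto dest: DERIV_mult)
    thus "((\<lambda>x. \<Prod>n<Suc N. 1 - x * x ^ n) has_field_derivative -1) (at (0::complex))"
      by (subst prod.lessThan_Suc_shift) (simp add: o_def)
  qed
  show "deriv euler_prod 0 = -1"
    using L unfolding D by (simp add: LIMSEQ_const_iff)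
qed

lemma euler_prod_nonzero: "norm q < 1 \<Longrightarrow> euler_prod q \<noteq> 0"
  unfolding euler_prod_def by (rule qpoch_self_nonzero)

lemma euler_prod_0 [simp]: "euler_prod 0 = 1"
  unfolding euler_prod_def qpoch_def by simp

lemma qpoch_mult_neg:
  assumes "norm q < 1"
  shows "qpoch a q * qpoch (-a) q = qpoch (a\<^sup>2) (q\<^sup>2)"
proof -
  have q2: "norm (q\<^sup>2) < 1" using assms by (simp add: norm_power power_less_one_iff)
  have "(\<lambda>N. (\<Prod>n<N. 1 - a * q ^ n) * (\<Prod>n<N. 1 - (-a) * q ^ n)) \<longlonglongrightarrow> qpoch a q * qpoch (-a) q"
    by (intro tendsto_intros qpoch_tendsto assms)
  moreover have "(\<Prod>n<N. 1 - a * q ^ n) * (\<Prod>n<N. 1 - (-a) * q ^ n) = (\<Prod>n<N. 1 - a\<^sup>2 * (q\<^sup>2) ^ n)" for N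
    unfolding prod.distrib[symmetric]
    by (intro prod.cong refl) (simp add: algebra_simps power2_eq_square power_mult_distrib)
  ultimately have "(\<lambda>N. \<Prod>n<N. 1 - a\<^sup>2 * (q\<^sup>2) ^ n) \<longlonglongrightarrow> qpoch a q * qpoch (-a) q"
    by simp
  from LIMSEQ_unique[OF this qpoch_tendsto[OF q2, of "a\<^sup>2"]] show ?thesis .
qed

lemma qpoch_even_odd:
  assumes "norm q < 1"
  shows "qpoch a (q\<^sup>2) * qpoch (a * q) (q\<^sup>2) = qpoch a q"
proof -
  have q2: "norm (q\<^sup>2) < 1" using assms by (simp add: norm_power power_less_one_iff)
  have "(\<lambda>N. (\<Prod>n<N. 1 - a * (q\<^sup>2) ^ n) * (\<Prod>n<N. 1 - (a * q) * (q\<^sup>2) ^ n)) \<longlonglongrightarrow> qpoch a (q\<^sup>2) * qpoch (a * q) (q\<^sup>2)"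
    by (intro tendsto_intros qpoch_tendsto q2)
  moreover have "(\<Prod>n<N. 1 - a * (q\<^sup>2) ^ n) * (\<Prod>n<N. 1 - (a * q) * (q\<^sup>2) ^ n) = (\<Prod>n<2*N. 1 - a * q ^ n)" for N
  proof (induction N)
    case (Suc N)
    have "(\<Prod>n<2 * Suc N. 1 - a * q ^ n) = (\<Prod>n<2 * N. 1 - a * q ^ n) * (1 - a * q ^ (2 * N)) * (1 - a * q ^ Suc (2 * N))"
      by simp
    also have "\<dots> = (\<Prod>n<2 * N. 1 - a * q ^ n) * (1 - a * (q\<^sup>2) ^ N) * (1 - a * q * (q\<^sup>2) ^ N)"
      by (simp add: power_mult)
    finally show ?case unfolding Suc.IH[symmetric] by (simp add: mult_ac)
  qed simp
  ultimately have L: "(\<lambda>N. \<Prod>n<2*N. 1 - a * q ^ n) \<longlonglongrightarrow> qpoch a (q\<^sup>2) * qpoch (a * q) (q\<^sup>2)"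
    by simp
  have "(\<lambda>N. \<Prod>n<2*N. 1 - a * q ^ n) \<longlonglongrightarrow> qpoch a q"
    using LIMSEQ_subseq_LIMSEQ[OF qpoch_tendsto[OF assms, of a], of "\<lambda>N. 2 * N"] by (simp add: o_def strict_mono_def)
  with L show ?thesis by (rule LIMSEQ_unique)
qed

text \<open>Euler's identity between odd and distinct parts. With q = h^2, the first two factors
  combine to \<open>qpoch q (q^2)\<close>. Multiplying by \<open>qpoch q q\<close> turns the third
  into \<open>qpoch (q^2) (q^2)\<close>, and odd and even exponents recombine to
  \<open>qpoch q q\<close>, which cancels.\<close>

lemma qpoch_half_identity:
  assumes "norm h < 1"
  shows "qpoch h (h\<^sup>2) * qpoch (-h) (h\<^sup>2) * qpoch (-(h\<^sup>2)) (h\<^sup>2) = 1"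
proof -
  define q where "q = h\<^sup>2"
  have q: "norm q < 1" using assms by (simp add: q_def norm_power power_less_one_iff)
  have "qpoch h q * qpoch (-h) q = qpoch q (q\<^sup>2)"
    unfolding qpoch_mult_neg[OF q] by (simp add: q_def)
  moreover have "qpoch q q * qpoch (-q) q = qpoch (q\<^sup>2) (q\<^sup>2)" by (rule qpoch_mult_neg[OF q])
  moreover have "qpoch q (q\<^sup>2) * qpoch (q\<^sup>2) (q\<^sup>2) = qpoch q q"
    using qpoch_even_odd[OF q, of q] by (simp add: power2_eq_square)
  ultimately have "(qpoch h q * qpoch (-h) q * qpoch (-q) q) * qpoch q q = 1 * qpoch q q"
    by (metis mult.assoc mult.commute mult_1)
  thus ?thesis
    unfolding mult_right_cancel[OF qpoch_self_nonzero[OF q]] by (simp add: q_def)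
qed

section \<open>The theta product\<close>

lemma nome_add: "nome (z + w) = nome z * nome w"
  by (simp add: nome_def ring_distribs exp_add)

lemma nome_diff: "nome (z - w) = nome z / nome w"
  by (simp add: nome_def ring_distribs exp_diff)

lemma nome_minus: "nome (-z) = inverse (nome z)"
  by (simp add: nome_def exp_minus)

lemma nome_0 [simp]: "nome 0 = 1"
  by (simp add: nome_def)

lemma nome_nonzero [simp]: "nome z \<noteq> 0"
  by (simp add: nome_def)

lemma nome_half [simp]: "nome (1 / 2) = -1"
  by (simp add: nome_def exp_pi_i)

lemma nome_of_int [simp]: "nome (of_int n) = 1"
  by (simp add: nome_def exp_eq_1)

lemma nome_1 [simp]: "nome 1 = 1"
  using nome_of_int[of 1] by simp

lemma norm_nome: "norm (nome z) = exp (- 2 * pi * Im z)"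
  by (simp add: nome_def)

lemma norm_nome_less_1: "Im z > 0 \<Longrightarrow> norm (nome z) < 1"
  by (simp add: norm_nome)

lemma nome_power: "nome z ^ n = nome (of_nat n * z)"
  by (simp add: nome_def exp_of_nat_mult[symmetric] mult_ac)

lemma nome_powi: "nome z powi n = nome (of_int n * z)"
  by (auto simp: power_int_def nome_power inverse_eq_divide field_simps nome_minus simp flip: nome_minus)
     (simp add: nome_minus power_inverse[symmetric] nome_power)

lemma nome_eq_iff: "nome z = nome w \<longleftrightarrow> (\<exists>n::int. z = w + of_int n)"
proof
  assume "nome z = nome w"
  then obtain n :: int where "2 * of_real pi * \<i> * z = 2 * of_real pi * \<i> * w + (of_int (2 * n) * pi) * \<i>"
    unfolding nome_def by (auto simp: exp_eq)
  hence "(2 * of_real pi * \<i>) * z = (2 * of_real pi * \<i>) * (w + of_int n)"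
    by (simp add: algebra_simps)
  hence "z = w + of_int n" by (subst (asm) mult_cancel_left) auto
  thus "\<exists>n::int. z = w + of_int n" ..
qed (auto simp: nome_add)

lemma nome_holomorphic [holomorphic_intros]:
  "f holomorphic_on S \<Longrightarrow> (\<lambda>z. nome (f z)) holomorphic_on S"
  unfolding nome_def by (intro holomorphic_intros)

lemma has_field_derivative_nome:
  "(nome has_field_derivative (2 * of_real pi * \<i> * nome z)) (at z)"
  unfolding nome_def by (auto intro!: derivative_eq_intros)

lemma nome_surj:
  assumes "r \<noteq> 0" "norm r < 1"
  obtains z where "nome z = r" "Im z > 0"
proof -
  define z where "z = Ln r / (2 * of_real pi * \<i>)"
  have 1: "nome z = r" unfolding nome_def z_def using assms by simp
  hence "exp (- 2 * pi * Im z) < 1" using assms norm_nome by metis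
  hence "Im z > 0" by (simp add: zero_less_mult_iff)
  with 1 show ?thesis using that by blast
qed

text \<open>The Jacobi theta function in product form, without the constant factor
  \<open>euler_prod q\<close>. As a function of w, with u = \<open>nome w\<close>, it vanishes
  exactly on the period lattice.\<close>

definition jtheta :: "complex \<Rightarrow> complex \<Rightarrow> complex" where
  "jtheta q u = qpoch u q * qpoch (q / u) q"

text \<open>Multiplying u by q takes one factor out of the first product and puts one into the
  second; the quotient of 1 - 1/u by 1 - u is -1/u.\<close>

lemma jtheta_shift:
  assumes "norm q < 1" "q \<noteq> 0" "u \<noteq> 0"
  shows "jtheta q (q * u) = - jtheta q u / u"
proof -
  have "qpoch u q = (1 - u) * qpoch (q * u) q"
    using qpoch_rec[OF assms(1), of u] by (simp add: mult.commute)
  moreover have "qpoch (1 / u) q = (1 - 1 / u) * qpoch (q / u) q"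
    using qpoch_rec[OF assms(1), of "1/u"] by simp
  moreover have "q / (q * u) = 1 / u" using assms by simp
  ultimately have "jtheta q (q * u) = qpoch (q * u) q * ((1 - 1 / u) * qpoch (q / u) q)"
    and "jtheta q u = (1 - u) * qpoch (q * u) q * qpoch (q / u) q"
    unfolding jtheta_def by simp_all
  thus ?thesis by (simp only:) (use assms in \<open>simp add: field_simps\<close>)
qed

lemma jtheta_eq_0_iff:
  assumes "norm q < 1" "q \<noteq> 0" "u \<noteq> 0"
  shows "jtheta q u = 0 \<longleftrightarrow> (\<exists>n::int. u = q powi n)"
proof
  assume "jtheta q u = 0"
  then consider n where "u * q ^ n = 1" | n where "q / u * q ^ n = 1"
    unfolding jtheta_def by (auto simp: qpoch_eq_0_iff[OF assms(1)])
  thus "\<exists>n::int. u = q powi n"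
  proof cases
    case (1 n)
    hence "u = q powi (- int n)" using assms by (simp add: power_int_minus field_simps)
    thus ?thesis ..
  next
    case (2 n)
    hence "u = q powi (int (Suc n))" using assms unfolding power_int_of_nat by (simp add: field_simps)
    thus ?thesis ..
  qed
next
  assume "\<exists>n::int. u = q powi n"
  then obtain n :: int where n: "u = q powi n" by blast
  show "jtheta q u = 0"
  proof (cases "n \<le> 0")
    case True
    hence "u * q ^ nat (-n) = 1" using n assms by (simp add: power_int_def power_inverse[symmetric] field_simps)
    thus ?thesis unfolding jtheta_def using qpoch_eq_0_iff[OF assms(1)] by auto
  next
    case False
    define k where "k = nat (n - 1)"
    have "u = q ^ Suc k" using n False unfolding k_def power_int_def by (simp add: Suc_nat_eq_nat_zadd1)
    hence "q / u * q ^ k = 1" using assms by simp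
    thus ?thesis unfolding jtheta_def using qpoch_eq_0_iff[OF assms(1)] by auto
  qed
qed

text \<open>With q = h^2 the arguments -1, h and -h are the nomes of the three half periods. Their
  theta values multiply to an absolute constant, which is what removes theta from the inversion law
  of the Euler product.\<close>

lemma jtheta_half_periods:
  assumes "norm h < 1" "h \<noteq> 0"
  shows "jtheta (h\<^sup>2) (-1) * jtheta (h\<^sup>2) h * jtheta (h\<^sup>2) (-h) = 2"
proof -
  have q: "norm (h\<^sup>2) < 1" using assms by (simp add: norm_power power_less_one_iff)
  have "jtheta (h\<^sup>2) (-1) = 2 * (qpoch (-(h\<^sup>2)) (h\<^sup>2))\<^sup>2"
    unfolding jtheta_def by (subst qpoch_rec[OF q]) (simp add: power2_eq_square)
  moreover have "jtheta (h\<^sup>2) h = (qpoch h (h\<^sup>2))\<^sup>2"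
    unfolding jtheta_def using assms by (simp add: power2_eq_square)
  moreover have "jtheta (h\<^sup>2) (-h) = (qpoch (-h) (h\<^sup>2))\<^sup>2"
    unfolding jtheta_def using assms by (simp add: power2_eq_square)
  ultimately have "jtheta (h\<^sup>2) (-1) * jtheta (h\<^sup>2) h * jtheta (h\<^sup>2) (-h)
      = 2 * (qpoch h (h\<^sup>2) * qpoch (-h) (h\<^sup>2) * qpoch (-(h\<^sup>2)) (h\<^sup>2))\<^sup>2"
    by (simp add: power_mult_distrib)
  also have "\<dots> = 2" by (simp add: qpoch_half_identity[OF assms(1)])
  finally show ?thesis .
qed

text \<open>Every value is taken on the compact period parallelogram, so the function is bounded and
  Liouville's theorem applies.\<close>

lemma doubly_periodic_entire_constant:
  assumes hol: "f holomorphic_on UNIV" and z: "Im z > 0"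
    and p1: "\<And>w. f (w + 1) = f w" and pz: "\<And>w. f (w + z) = f w"
  shows "f w = f 0"
proof -
  have p1n: "f (w + of_nat n) = f w" for w n
    by (induction n) (simp_all add: p1 add.assoc[symmetric] add.commute[of 1] flip: add.assoc)
  have pzn: "f (w + of_nat n * z) = f w" for w n
  proof (induction n)
    case (Suc n)
    have "f (w + of_nat (Suc n) * z) = f ((w + of_nat n * z) + z)" by (simp add: algebra_simps)
    thus ?case using Suc pz by simp
  qed simp
  have p1i: "f (w + of_int n) = f w" for w and n :: int
  proof (cases "n \<ge> 0")
    case True
    thus ?thesis using p1n[of w "nat n"] by simp
  next
    case False
    thus ?thesis using p1n[of "w + of_int n" "nat (-n)"] by simp
  qed
  have pzi: "f (w + of_int n * z) = f w" for w and n :: int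
  proof (cases "n \<ge> 0")
    case True
    thus ?thesis using pzn[of w "nat n"] by simp
  next
    case False
    thus ?thesis using pzn[of "w + of_int n * z" "nat (-n)"] by simp
  qed
  define K where "K = (\<lambda>(a, b). of_real a + of_real b * z) ` ({0..1::real} \<times> {0..1::real})"
  have "compact K" unfolding K_def
    by (intro compact_continuous_image compact_Times) (auto intro!: continuous_intros simp: case_prod_unfold)
  hence "compact (f ` K)"
    using hol by (intro compact_continuous_image) (meson holomorphic_on_imp_continuous_on holomorphic_on_subset subset_UNIV)
  have "range f \<subseteq> f ` K"
  proof
    fix y assume "y \<in> range f"
    then obtain w where y: "y = f w" by auto
    define b where "b = Im w / Im z"
    define a where "a = Re w - b * Re z"
    have w: "w = of_real a + of_real b * z"
      using z by (simp add: complex_eq_iff a_def b_def)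
    define x where "x = of_real (frac a) + of_real (frac b) * z"
    have "w = x + of_int \<lfloor>a\<rfloor> + of_int \<lfloor>b\<rfloor> * z"
      unfolding w x_def frac_def by (simp add: algebra_simps)
    hence "f w = f x" by (simp add: pzi p1i)
    moreover have "x \<in> K" unfolding K_def x_def
      by (rule image_eqI[of _ _ "(frac a, frac b)"]) (auto simp: frac_ge_0 frac_lt_1 less_imp_le)
    ultimately show "y \<in> f ` K" using y by blast
  qed
  hence "bounded (range f)"
    using \<open>compact (f ` K)\<close> bounded_subset compact_imp_bounded by blast
  hence "f constant_on UNIV" by (rule Liouville_theorem[OF hol])
  thus ?thesis by (auto simp: constant_on_def)
qed

text \<open>
  As a function of \<open>w\<close>, the quotient of \<open>exp (\<pi>iw(1 - (w + 1)/z)) \<theta>(w/z; -1/z)\<close> by \<open>\<theta>(w; z)\<close> is entire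
  and doubly periodic, hence equal to its value at \<open>0\<close>.
\<close>
lemma jtheta_inversion:
  assumes z: "Im z > 0" and nz: "jtheta (nome z) (nome w) \<noteq> 0"
  shows "exp (of_real pi * \<i> * w * (1 - (w + 1) / z)) * jtheta (nome (-1/z)) (nome (w / z)) =
           euler_prod (nome (-1/z)) ^ 2 / (z * euler_prod (nome z) ^ 2) * jtheta (nome z) (nome w)"
proof -
  define q where "q = nome z"
  define q' where "q' = nome (-1/z)"
  have z0: "z \<noteq> 0" using z by auto
  have "Im (-1/z) > 0" using z z0 by (simp add: Im_divide field_simps complex_eq_iff sum_power2_gt_zero_iff)
  hence q: "norm q < 1" "q \<noteq> 0" and q': "norm q' < 1" "q' \<noteq> 0"
    using z by (auto simp: q_def q'_def norm_nome_less_1)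
  define T where "T = (\<lambda>w. jtheta q (nome w))"
  define E where "E = (\<lambda>w. exp (of_real pi * \<i> * w * (1 - (w + 1) / z)))"
  define N where "N = (\<lambda>w. E w * jtheta q' (nome (w / z)))"
  \<comment> \<open>\<open>g c\<close> is the divided difference of \<open>nome (c * w)\<close> at
    0. It isolates the simple zero of both theta products at w = 0 and has the value 2\<pi>ic
    there.\<close>
  define g where "g = (\<lambda>c w. if w = 0 then deriv (\<lambda>w. nome (c * w)) 0 else (nome (c * w) - nome (c * 0)) / (w - 0))"
  have g_hol: "g c holomorphic_on UNIV" for c
    unfolding g_def by (rule pole_lemma_open) (auto intro!: holomorphic_intros)
  have g: "1 - nome (c * w) = - w * g c w" for c w by (simp add: g_def)
  have g0: "g c 0 = 2 * of_real pi * \<i> * c" for c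
  proof -
    have "((\<lambda>w. nome (c * w)) has_field_derivative (2 * of_real pi * \<i> * nome (c * 0)) * c) (at 0)"
      by (rule DERIV_chain'[OF _ has_field_derivative_nome]) (auto intro!: derivative_eq_intros)
    thus ?thesis unfolding g_def by (simp add: DERIV_imp_deriv)
  qed
  define V where "V = (\<lambda>q u. qpoch (u * q) q * qpoch (q / u) q)"
  have jt: "jtheta q u = (1 - u) * V q u" if "norm q < 1" for q u
    unfolding jtheta_def V_def using qpoch_rec[OF that, of u] by simp
  define Dn where "Dn = (\<lambda>w. g 1 w * V q (nome w))"
  define Nn where "Nn = (\<lambda>w. E w * g (1/z) w * V q' (nome (w / z)))"
  have TD: "T w = - w * Dn w" for w
    using g[of 1 w] by (simp add: T_def Dn_def jt[OF q(1)])
  have NN: "N w = - w * Nn w" for w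
    using g[of "1/z" w] by (simp add: N_def Nn_def jt[OF q'(1)])
  have E_hol: "E holomorphic_on UNIV" unfolding E_def using z0 by (auto intro!: holomorphic_intros)
  have Dn_hol: "Dn holomorphic_on UNIV" unfolding Dn_def V_def
    by (intro holomorphic_intros g_hol q) auto
  have Nn_hol: "Nn holomorphic_on UNIV" unfolding Nn_def V_def
    by (intro holomorphic_intros g_hol E_hol q') (use z0 in auto)
  have T1: "T (w + 1) = T w" for w by (simp add: T_def nome_add)
  have Tz: "T (w + z) = - T w / nome w" for w
    using jtheta_shift[OF q, of "nome w"] by (simp add: T_def nome_add q_def mult.commute)
  have N1: "N (w + 1) = N w" for w
  proof -
    define u where "u = nome (w / z)"
    have "jtheta q' u = - jtheta q' (u / q') / (u / q')"
      using jtheta_shift[OF q', of "u / q'"] q' by (simp add: u_def)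
    hence "jtheta q' (u / q') = - (u / q') * jtheta q' u"
      using q' by (simp add: u_def field_simps)
    moreover have "nome ((w + 1) / z) = u / q'"
      by (simp add: u_def q'_def add_divide_distrib nome_add nome_minus field_simps)
    moreover have "E (w + 1) = E w * (- q' / u)"
    proof -
      have "E (w + 1) = exp (of_real pi * \<i> * w * (1 - (w + 1) / z) + of_real pi * \<i> + (2 * of_real pi * \<i> * (-1/z) - 2 * of_real pi * \<i> * (w / z)))"
        unfolding E_def by (rule arg_cong[of _ _ exp]) (use z0 in \<open>simp add: field_simps power2_eq_square\<close>)
      also have "\<dots> = E w * (-1) * (q' / u)"
        unfolding exp_add exp_diff E_def q'_def u_def nome_def by simp
      finally show ?thesis by simp
    qed
    ultimately show ?thesis using q' by (simp add: N_def u_def[symmetric]) (simp add: u_def)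
  qed
  have Nz: "N (w + z) = - N w / nome w" for w
  proof -
    have "E (w + z) = exp (of_real pi * \<i> * w * (1 - (w + 1) / z) - of_real pi * \<i> - 2 * of_real pi * \<i> * w)"
      unfolding E_def by (rule arg_cong[of _ _ exp]) (use z0 in \<open>simp add: field_simps power2_eq_square\<close>)
    also have "\<dots> = - E w / nome w"
      unfolding exp_diff E_def nome_def by simp
    finally show ?thesis using z0 by (simp add: N_def add_divide_distrib nome_add)
  qed
  \<comment> \<open>At zeros of the denominator the value is set to the limit at 0. All these zeros
    are lattice points, so periodicity carries differentiability from 0 to each of them.\<close>
  define R where "R = (\<lambda>w. if T w = 0 then Nn 0 / Dn 0 else N w / T w)"
  have R1: "R (w + 1) = R w" and Rz: "R (w + z) = R w" for w
    by (simp_all add: R_def T1 N1 Tz Nz)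
  have Dn0: "Dn 0 \<noteq> 0"
    by (simp add: Dn_def g0 V_def qpoch_self_nonzero[OF q(1)])
  have R_Dn: "R w = Nn w / Dn w" if "Dn w \<noteq> 0" for w
    using that by (auto simp: R_def TD NN)
  have fd0: "R field_differentiable at w" if "Dn w \<noteq> 0" for w
  proof -
    have "(\<lambda>w. Nn w / Dn w) holomorphic_on {w. Dn w \<noteq> 0}"
      by (intro holomorphic_intros) (use Nn_hol Dn_hol holomorphic_on_subset in auto)
    hence "R holomorphic_on {w. Dn w \<noteq> 0}"
      by (rule holomorphic_transform) (simp add: R_Dn)
    moreover have "open {w. Dn w \<noteq> 0}"
      using Dn_hol by (intro open_Collect_neq holomorphic_on_imp_continuous_on continuous_on_const) 
    ultimately show ?thesis using that by (simp add: holomorphic_on_imp_differentiable_at)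
  qed
  have R_lat: "R (w + of_int m + of_int n * z) = R w" for w and m n :: int
  proof -
    have a: "R (w + of_nat k) = R w" for w k
    proof (induction k)
      case (Suc k)
      have "R (w + of_nat (Suc k)) = R ((w + of_nat k) + 1)" by (simp add: algebra_simps)
      thus ?case using Suc R1 by simp
    qed simp
    have b: "R (w + of_nat k * z) = R w" for w k
    proof (induction k)
      case (Suc k)
      have "R (w + of_nat (Suc k) * z) = R ((w + of_nat k * z) + z)" by (simp add: algebra_simps)
      thus ?case using Suc Rz by simp
    qed simp
    have "R (w + of_int m) = R w" for w
      using a[of w "nat m"] a[of "w + of_int m" "nat (-m)"] by (cases "m \<ge> 0") auto
    moreover have "R (w + of_int n * z) = R w" for w
      using b[of w "nat n"] b[of "w + of_int n * z" "nat (-n)"] by (cases "n \<ge> 0") auto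
    ultimately show ?thesis by simp
  qed
  have "R field_differentiable at w" for w
  proof (cases "T w = 0")
    case False
    thus ?thesis using fd0[of w] by (auto simp: TD)
  next
    case True
    then obtain n :: int where "nome w = q powi n"
      unfolding T_def using jtheta_eq_0_iff[OF q, of "nome w"] by auto
    then obtain m :: int where w: "w = of_int n * z + of_int m"
      by (auto simp: q_def nome_powi nome_eq_iff)
    obtain d where d: "(R has_field_derivative d) (at (w + of_int (-m) + of_int (-n) * z))"
      using fd0[OF Dn0] unfolding w field_differentiable_def by auto
    have "((\<lambda>x. R (x + of_int (-m) + of_int (-n) * z)) has_field_derivative d * 1) (at w)"
      by (rule DERIV_chain'[where g = R and f = "\<lambda>x. x + of_int (-m) + of_int (-n) * z", OF _ d]) (auto intro!: derivative_eq_intros)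
    thus ?thesis unfolding R_lat field_differentiable_def by auto
  qed
  hence "R holomorphic_on UNIV" by (simp add: holomorphic_on_def)
  from doubly_periodic_entire_constant[OF this z R1 Rz, of w] have "R w = R 0" .
  also have "R 0 = Nn 0 / Dn 0" using R_Dn[OF Dn0] .
  also have "\<dots> = euler_prod q' ^ 2 / (z * euler_prod q ^ 2)"
    by (simp add: Nn_def Dn_def g0 V_def E_def euler_prod_def power2_eq_square)
  finally have "R w = euler_prod q' ^ 2 / (z * euler_prod q ^ 2)" .
  moreover have "R w = N w / T w" using nz by (simp add: R_def T_def q_def)
  ultimately have "N w = euler_prod q' ^ 2 / (z * euler_prod q ^ 2) * T w"
    using nz by (simp add: T_def q_def divide_eq_eq)
  thus ?thesis unfolding N_def T_def E_def q_def q'_def .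
qed

lemma Im_inversion_pos: "Im z > 0 \<Longrightarrow> Im (-1/z) > 0"
  by (simp add: Im_divide field_simps complex_eq_iff sum_power2_gt_zero_iff)

text \<open>The inversion law of theta is applied at the half periods -1/2, z/2 and (z - 1)/2, which
  division by z carries to half periods of the lattice of -1/z. In the product of the three
  equations the theta values multiply to 2 on either side, leaving only the cube of the constant C
  and explicit exponentials; the fourth power then turns these into q/q'.\<close>

theorem euler_prod_inversion:
  assumes z: "Im z > 0"
  shows "nome (-1/z) * euler_prod (nome (-1/z)) ^ 24 = z ^ 12 * (nome z * euler_prod (nome z) ^ 24)"
proof -
  define h where "h = nome (z / 2)"
  define h' where "h' = nome (-1 / (2 * z))"
  have z0: "z \<noteq> 0" using z by auto
  have qh: "nome z = h\<^sup>2" unfolding h_def nome_power by simp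
  have qh': "nome (-1/z) = h'\<^sup>2" unfolding h'_def nome_power by simp
  have h: "norm h < 1" "h \<noteq> 0" using z by (auto simp: h_def norm_nome_less_1)
  have "Im (-1 / (2 * z)) > 0" using Im_inversion_pos[of "2 * z"] z by simp
  hence h': "norm h' < 1" "h' \<noteq> 0" unfolding h'_def by (auto intro: norm_nome_less_1)
  define C where "C = euler_prod (nome (-1/z)) ^ 2 / (z * euler_prod (nome z) ^ 2)"
  define E where "E = (\<lambda>w. of_real pi * \<i> * w * (1 - (w + 1) / z))"
  note half = jtheta_half_periods[OF h] jtheta_half_periods[OF h']
  have nz: "jtheta (h\<^sup>2) (-1) \<noteq> 0" "jtheta (h\<^sup>2) h \<noteq> 0" "jtheta (h\<^sup>2) (-h) \<noteq> 0"
    using half(1) by auto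
  have m12: "nome (-1/2) = -1" using nome_minus[of "1/2"] by simp
  have e1: "exp (E (-1/2)) * jtheta (h'\<^sup>2) h' = C * jtheta (h\<^sup>2) (-1)"
  proof -
    have "-1 / 2 / z = -1 / (2 * z)" using z0 by (simp add: field_simps)
    thus ?thesis using jtheta_inversion[OF z, of "-1/2"] nz(1)
      unfolding C_def E_def qh qh' m12 h'_def by simp
  qed
  have e2: "exp (E (z/2)) * jtheta (h'\<^sup>2) (-1) = C * jtheta (h\<^sup>2) h"
  proof -
    have "z / 2 / z = 1 / 2" using z0 by (simp add: field_simps)
    thus ?thesis using jtheta_inversion[OF z, of "z/2"] nz(2)
      unfolding C_def E_def qh qh' h_def[symmetric] \<open>z / 2 / z = 1 / 2\<close> nome_half by blast
  qed
  have e3: "exp (E ((z-1)/2)) * jtheta (h'\<^sup>2) (-h') = C * jtheta (h\<^sup>2) (-h)"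
  proof -
    have "(z-1) / 2 / z = 1 / 2 + (-1) / (2 * z)" using z0 by (simp add: field_simps)
    hence "nome ((z-1) / 2 / z) = - h'" by (simp only: nome_add h'_def) simp
    moreover have "nome ((z-1)/2) = - h"
      by (simp add: h_def diff_divide_distrib nome_diff)
    ultimately show ?thesis using jtheta_inversion[OF z, of "(z-1)/2"] nz(3)
      unfolding C_def E_def qh qh' by simp
  qed
  have "exp (E (-1/2)) * exp (E (z/2)) * exp (E ((z-1)/2)) * (jtheta (h'\<^sup>2) (-1) * jtheta (h'\<^sup>2) h' * jtheta (h'\<^sup>2) (-h'))
     = (exp (E (-1/2)) * jtheta (h'\<^sup>2) h') * (exp (E (z/2)) * jtheta (h'\<^sup>2) (-1)) * (exp (E ((z-1)/2)) * jtheta (h'\<^sup>2) (-h'))"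
    by (simp add: mult_ac)
  also have "\<dots> = C ^ 3 * (jtheta (h\<^sup>2) (-1) * jtheta (h\<^sup>2) h * jtheta (h\<^sup>2) (-h))"
    unfolding e1 e2 e3 by (simp add: power3_eq_cube mult_ac)
  finally have "C ^ 3 = exp (E (-1/2)) * exp (E (z/2)) * exp (E ((z-1)/2))"
    unfolding half by simp
  also have "\<dots> = exp (of_real pi * \<i> * (z / 2 + 1 / (2 * z) - 3 / 2))"
    unfolding exp_add[symmetric] E_def
    by (rule arg_cong[of _ _ exp]) (use z0 in \<open>simp add: field_simps power2_eq_square\<close>)
  finally have "(C ^ 3) ^ 4 = exp (of_real pi * \<i> * (z / 2 + 1 / (2 * z) - 3 / 2)) ^ 4" by simp
  also have "\<dots> = exp (2 * of_real pi * \<i> * z - 2 * of_real pi * \<i> * (-1/z) - of_int 3 * (2 * of_real pi * \<i>))"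
    unfolding exp_of_nat_mult[symmetric]
    by (rule arg_cong[of _ _ exp]) (use z0 in \<open>simp add: field_simps power2_eq_square\<close>)
  also have "\<dots> = nome z / nome (-1/z) / nome (of_int 3)"
    unfolding exp_diff nome_def by (simp add: mult_ac)
  finally have C: "C ^ 12 = nome z / nome (-1/z)"
    unfolding nome_of_int by (simp flip: power_mult)
  have "norm (nome z) < 1" using z by (rule norm_nome_less_1)
  hence P: "euler_prod (nome z) \<noteq> 0" by (rule euler_prod_nonzero)
  have "C ^ 12 = euler_prod (nome (-1/z)) ^ 24 / (z ^ 12 * euler_prod (nome z) ^ 24)"
    unfolding C_def by (simp add: power_divide power_mult_distrib flip: power_mult)
  with C show ?thesis using P z0 by (simp add: field_simps)
qed

section \<open>Eisenstein series and the modular group\<close>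

text \<open>The operator q d/dq, that is 1/(2\<pi>i) d/dz on the half-plane.\<close>

definition qderiv :: "(complex \<Rightarrow> complex) \<Rightarrow> complex \<Rightarrow> complex" where
  "qderiv f r = r * deriv f r"

definition delta_q :: "complex \<Rightarrow> complex" where
  "delta_q r = r * euler_prod r ^ 24"

text \<open>The logarithmic derivative of \<open>delta_q\<close> with respect to q d/dq, written
  through the Euler product so that it makes sense at 0.\<close>

definition E2_q :: "complex \<Rightarrow> complex" where
  "E2_q r = 1 + 24 * (r * deriv euler_prod r / euler_prod r)"

text \<open>Ramanujan's differential equations serve as the definitions of \<open>E\<^sub>4\<close> and \<open>E\<^sub>6\<close>.\<close>
definition E4_q :: "complex \<Rightarrow> complex" where
  "E4_q r = E2_q r ^ 2 - 12 * qderiv E2_q r"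

definition E6_q :: "complex \<Rightarrow> complex" where
  "E6_q r = E2_q r * E4_q r - 3 * qderiv E4_q r"

definition j_q :: "complex \<Rightarrow> complex" where
  "j_q r = E4_q r ^ 3 / delta_q r"

lemma qderiv_holomorphic [holomorphic_intros]:
  "f holomorphic_on ball 0 1 \<Longrightarrow> qderiv f holomorphic_on ball 0 1"
  unfolding qderiv_def by (intro holomorphic_intros) auto

lemma delta_q_holomorphic: "delta_q holomorphic_on ball 0 1"
  unfolding delta_q_def by (intro holomorphic_intros euler_prod_holomorphic)

lemma E2_q_holomorphic: "E2_q holomorphic_on ball 0 1"
  unfolding E2_q_def using euler_prod_nonzero
  by (intro holomorphic_intros euler_prod_holomorphic) auto

lemma E4_q_holomorphic: "E4_q holomorphic_on ball 0 1"
  unfolding E4_q_def by (intro holomorphic_intros E2_q_holomorphic)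

lemma E6_q_holomorphic: "E6_q holomorphic_on ball 0 1"
  unfolding E6_q_def by (intro holomorphic_intros E2_q_holomorphic E4_q_holomorphic)

lemma delta_q_eq_0_iff: "norm r < 1 \<Longrightarrow> delta_q r = 0 \<longleftrightarrow> r = 0"
  by (simp add: delta_q_def euler_prod_nonzero)

lemma E2_q_0 [simp]: "E2_q 0 = 1" by (simp add: E2_q_def)
lemma E4_q_0 [simp]: "E4_q 0 = 1" by (simp add: E4_q_def qderiv_def)
lemma E6_q_0 [simp]: "E6_q 0 = 1" by (simp add: E6_q_def qderiv_def)

lemma holomorphic_ball_DERIV:
  assumes "f holomorphic_on ball 0 1" "norm r < 1"
  shows "(f has_field_derivative deriv f r) (at r)"
  using assms by (intro holomorphic_derivI[OF _ open_ball]) auto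

lemma qderiv_delta_q:
  assumes "norm r < 1"
  shows "qderiv delta_q r = E2_q r * delta_q r"
proof -
  note d = holomorphic_ball_DERIV[OF euler_prod_holomorphic assms]
  have "((\<lambda>r. r * euler_prod r ^ 24) has_field_derivative
          (euler_prod r ^ 24 + r * (24 * (euler_prod r ^ 23 * deriv euler_prod r)))) (at r)"
    by (auto intro!: derivative_eq_intros d)
  hence "deriv delta_q r = euler_prod r ^ 24 + r * (24 * (euler_prod r ^ 23 * deriv euler_prod r))"
    unfolding delta_q_def[abs_def] by (rule DERIV_imp_deriv)
  moreover have "euler_prod r ^ 24 = euler_prod r ^ 23 * euler_prod r"
    by (simp flip: power_Suc2)
  ultimately show ?thesis using euler_prod_nonzero[OF assms]
    by (simp add: qderiv_def E2_q_def delta_q_def field_simps)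
qed

text \<open>Ramanujan's equations for \<Delta> and E4 combine to this derivative. Its numerator E4^2
  E6 splits as \<open>eis_q a b * eis_q (2 - a) (1 - b)\<close> for every admissible weight class,
  which is why the kernel below contains the complementary Eisenstein factor.\<close>

lemma qderiv_j_q:
  assumes "norm r < 1" "r \<noteq> 0"
  shows "(j_q has_field_derivative - (E4_q r ^ 2 * E6_q r / (delta_q r * r))) (at r)"
proof -
  note d4 = holomorphic_ball_DERIV[OF E4_q_holomorphic assms(1)]
  note dd = holomorphic_ball_DERIV[OF delta_q_holomorphic assms(1)]
  have nz: "delta_q r \<noteq> 0" using assms delta_q_eq_0_iff by blast
  have "(j_q has_field_derivative
     (3 * E4_q r ^ 2 * deriv E4_q r * delta_q r - E4_q r ^ 3 * deriv delta_q r) / (delta_q r * delta_q r)) (at r)"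
    unfolding j_q_def[abs_def] using nz
    by (auto intro!: derivative_eq_intros d4 dd simp: power2_eq_square mult_ac)
  also have "deriv delta_q r = E2_q r * delta_q r / r"
    using qderiv_delta_q[OF assms(1)] assms(2) by (simp add: qderiv_def field_simps)
  also have "deriv E4_q r = (E2_q r * E4_q r - E6_q r) / (3 * r)"
    using assms(2) by (simp add: E6_q_def qderiv_def)
  also have "(3 * E4_q r ^ 2 * ((E2_q r * E4_q r - E6_q r) / (3 * r)) * delta_q r - E4_q r ^ 3 * (E2_q r * delta_q r / r)) / (delta_q r * delta_q r)
     = - (E4_q r ^ 2 * E6_q r / (delta_q r * r))"
    using nz assms(2) by (simp add: field_simps power2_eq_square power3_eq_cube)
  finally show ?thesis .
qed

lemma DERIV_nome_compose:
  assumes "f holomorphic_on ball 0 1" "Im z > 0"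
  shows "((\<lambda>z. f (nome z)) has_field_derivative 2 * of_real pi * \<i> * qderiv f (nome z)) (at z)"
proof -
  have "((\<lambda>z. f (nome z)) has_field_derivative deriv f (nome z) * (2 * of_real pi * \<i> * nome z)) (at z)"
    by (rule DERIV_chain'[OF has_field_derivative_nome holomorphic_ball_DERIV[OF assms(1) norm_nome_less_1[OF assms(2)]]])
  thus ?thesis by (simp add: qderiv_def mult_ac)
qed

lemma open_Im_pos: "open {z. Im z > 0}"
  by (intro open_Collect_less continuous_intros)

text \<open>Up to the factor z^2, both sides are the derivative of \<open>f (nome (-1/w))\<close> at
  z, once by the chain rule and once through the law G. Repeated use carries the inversion law from
  \<Delta> to E2, from E2 to E4 and from E4 to E6.\<close>

lemma qderiv_inversion:
  assumes f: "f holomorphic_on ball 0 1" and z: "Im z > 0"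
    and G: "\<And>w. Im w > 0 \<Longrightarrow> f (nome (-1/w)) = G w" and G': "(G has_field_derivative G') (at z)"
  shows "2 * of_real pi * \<i> * qderiv f (nome (-1/z)) = z ^ 2 * G'"
proof -
  have z0: "z \<noteq> 0" using z by auto
  have "((\<lambda>z. -1/z) has_field_derivative 1 / z ^ 2) (at z)"
    using z0 by (auto intro!: derivative_eq_intros simp: power2_eq_square)
  hence "((\<lambda>w. f (nome (-1/w))) has_field_derivative (2 * of_real pi * \<i> * qderiv f (nome (-1/z))) * (1 / z ^ 2)) (at z)"
    by (rule DERIV_chain'[where f = "\<lambda>w. -1/w" and g = "\<lambda>w. f (nome w)",
          OF _ DERIV_nome_compose[OF f Im_inversion_pos[OF z]]])
  moreover have "((\<lambda>w. f (nome (-1/w))) has_field_derivative G') (at z)"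
    by (rule has_field_derivative_transform_within_open[OF G' open_Im_pos]) (use z G in auto)
  ultimately have "(2 * of_real pi * \<i> * qderiv f (nome (-1/z))) * (1 / z ^ 2) = G'"
    by (rule DERIV_unique)
  thus ?thesis using z0 by (simp add: field_simps)
qed

lemma delta_q_inversion: "Im z > 0 \<Longrightarrow> delta_q (nome (-1/z)) = z ^ 12 * delta_q (nome z)"
  unfolding delta_q_def by (rule euler_prod_inversion)

text \<open>This is the logarithmic derivative of the law for \<Delta>: the factor z^12 contributes
  12/z, which becomes the quasimodular term.\<close>

lemma E2_q_inversion:
  assumes z: "Im z > 0"
  shows "E2_q (nome (-1/z)) = z ^ 2 * E2_q (nome z) + 12 * z / (2 * of_real pi * \<i>)"
proof -
  define c where "c = 2 * of_real pi * \<i>"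
  have z0: "z \<noteq> 0" and c0: "c \<noteq> 0" using z by (auto simp: c_def)
  define D where "D = delta_q (nome z)"
  have D0: "D \<noteq> 0" unfolding D_def using delta_q_eq_0_iff norm_nome_less_1[OF z] by simp
  have "((\<lambda>z. z ^ 12 * delta_q (nome z)) has_field_derivative
          12 * z ^ 11 * D + z ^ 12 * (c * qderiv delta_q (nome z))) (at z)"
    unfolding c_def D_def
    by (auto intro!: derivative_eq_intros DERIV_nome_compose[OF delta_q_holomorphic z])
  note * = qderiv_inversion[OF delta_q_holomorphic z delta_q_inversion this]
  have "qderiv delta_q (nome (-1/z)) = E2_q (nome (-1/z)) * (z ^ 12 * D)"
    unfolding qderiv_delta_q[OF norm_nome_less_1[OF Im_inversion_pos[OF z]]] delta_q_inversion[OF z] D_def ..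
  moreover have "qderiv delta_q (nome z) = E2_q (nome z) * D"
    unfolding qderiv_delta_q[OF norm_nome_less_1[OF z]] D_def ..
  ultimately have "c * (E2_q (nome (-1/z)) * (z ^ 12 * D)) = z ^ 2 * (12 * z ^ 11 * D + z ^ 12 * (c * (E2_q (nome z) * D)))"
    using * unfolding c_def[symmetric] by (simp only:)
  moreover have "z ^ 12 = z * z ^ 11" by (simp flip: power_Suc)
  ultimately have "(z ^ 12 * D) * (c * E2_q (nome (-1/z))) = (z ^ 12 * D) * (12 * z + z ^ 2 * c * E2_q (nome z))"
    by (simp add: power2_eq_square algebra_simps)
  hence "c * E2_q (nome (-1/z)) = 12 * z + z ^ 2 * c * E2_q (nome z)"
    using z0 D0 by (subst (asm) mult_cancel_left) auto
  thus ?thesis using c0 unfolding c_def[symmetric] by (simp add: field_simps)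
qed

text \<open>The terms caused by the quasimodularity of E2 in its square and in its derivative are
  equal and cancel; this is the reason for the factor 12.\<close>

lemma E4_q_inversion:
  assumes z: "Im z > 0"
  shows "E4_q (nome (-1/z)) = z ^ 4 * E4_q (nome z)"
proof -
  define c where "c = 2 * of_real pi * \<i>"
  have c0: "c \<noteq> 0" by (auto simp: c_def)
  have "((\<lambda>z. z ^ 2 * E2_q (nome z) + 12 * z / c) has_field_derivative
          2 * z * E2_q (nome z) + z ^ 2 * (c * qderiv E2_q (nome z)) + 12 / c) (at z)"
    using c0 unfolding c_def
    by (auto intro!: derivative_eq_intros DERIV_nome_compose[OF E2_q_holomorphic z])
  from qderiv_inversion[OF E2_q_holomorphic z E2_q_inversion[folded c_def] this]
  have *: "qderiv E2_q (nome (-1/z)) = z ^ 2 * (2 * z * E2_q (nome z) + z ^ 2 * (c * qderiv E2_q (nome z)) + 12 / c) / c"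
    using c0 unfolding c_def[symmetric] by (simp add: field_simps)
  show ?thesis
    unfolding E4_q_def * E2_q_inversion[OF z, folded c_def] using c0
    by (simp add: field_simps power2_eq_square power4_eq_xxxx)
qed

text \<open>\<open>E6_q\<close> is -3 times the Serre derivative of E4: differentiating z^4 produces
  4 z^3, and three times this cancels the anomaly 12 of E2.\<close>

lemma E6_q_inversion:
  assumes z: "Im z > 0"
  shows "E6_q (nome (-1/z)) = z ^ 6 * E6_q (nome z)"
proof -
  define c where "c = 2 * of_real pi * \<i>"
  have c0: "c \<noteq> 0" by (auto simp: c_def)
  have "((\<lambda>z. z ^ 4 * E4_q (nome z)) has_field_derivative
          4 * z ^ 3 * E4_q (nome z) + z ^ 4 * (c * qderiv E4_q (nome z))) (at z)"
    unfolding c_def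
    by (auto intro!: derivative_eq_intros DERIV_nome_compose[OF E4_q_holomorphic z])
  from qderiv_inversion[OF E4_q_holomorphic z E4_q_inversion this]
  have *: "qderiv E4_q (nome (-1/z)) = z ^ 2 * (4 * z ^ 3 * E4_q (nome z) + z ^ 4 * (c * qderiv E4_q (nome z))) / c"
    using c0 unfolding c_def[symmetric] by (simp add: field_simps)
  have p: "z ^ 6 = z * z * z * z * z * z" by (simp add: eval_nat_numeral)
  show ?thesis
    unfolding E6_q_def * E2_q_inversion[OF z, folded c_def] E4_q_inversion[OF z] using c0
    by (simp add: field_simps power2_eq_square power4_eq_xxxx power3_eq_cube p)
qed

lemma j_q_inversion:
  assumes z: "Im z > 0"
  shows "j_q (nome (-1/z)) = j_q (nome z)"
proof -
  have "z \<noteq> 0" using z by auto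
  thus ?thesis unfolding j_q_def E4_q_inversion[OF z] delta_q_inversion[OF z]
    by (simp add: power_mult_distrib flip: power_mult)
qed

section \<open>Integer Moebius transformations and reduction to the fundamental domain\<close>

definition moebius_int :: "int \<Rightarrow> int \<Rightarrow> int \<Rightarrow> int \<Rightarrow> complex \<Rightarrow> complex" where
  "moebius_int a b c d z = (of_int a * z + of_int b) / (of_int c * z + of_int d)"

lemma int_linear_eq_0:
  assumes "Im z > 0" "of_int c * z + of_int d = (0::complex)"
  shows "c = 0 \<and> d = 0"
proof -
  have "Im (of_int c * z + of_int d) = of_int c * Im z" by simp
  hence "c = 0" using assms by simp
  thus ?thesis using assms by simp
qed

lemma int_linear_nonzero:
  assumes "Im z > 0" "a * d - b * c = (1::int)"
  shows "of_int c * z + of_int d \<noteq> (0::complex)"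
  using int_linear_eq_0[OF assms(1), of c d] assms(2) by auto

lemma Im_moebius_int:
  assumes "Im z > 0" "a * d - b * c = 1"
  shows "Im (moebius_int a b c d z) = Im z / norm (of_int c * z + of_int d) ^ 2"
proof -
  have "Im (moebius_int a b c d z) = (of_int (a * d - b * c) * Im z) / norm (of_int c * z + of_int d) ^ 2"
    unfolding moebius_int_def Im_divide cmod_power2 by (simp add: algebra_simps)
  thus ?thesis using assms by simp
qed

lemma Im_moebius_int_pos:
  assumes "Im z > 0" "a * d - b * c = 1"
  shows "Im (moebius_int a b c d z) > 0"
  unfolding Im_moebius_int[OF assms] using assms int_linear_nonzero[OF assms] by simp

lemma moebius_int_compose:
  assumes "Im z > 0" "a' * d' - b' * c' = 1" "a * d - b * c = 1"
  shows "moebius_int a b c d (moebius_int a' b' c' d' z) =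
           moebius_int (a * a' + b * c') (a * b' + b * d') (c * a' + d * c') (c * b' + d * d') z"
proof -
  define D where "D = of_int c' * z + of_int d'"
  have D: "D \<noteq> 0" unfolding D_def by (rule int_linear_nonzero[OF assms(1,2)])
  have N: "of_int x * ((of_int a' * z + of_int b') / D) + of_int y =
        (of_int (x * a' + y * c') * z + of_int (x * b' + y * d')) / D" for x y
    using D by (simp add: field_simps) (simp add: D_def algebra_simps)
  show ?thesis unfolding moebius_int_def D_def[symmetric] N using D by simp
qed

text \<open>Euclid's algorithm on the entry c: a translation replaces a by a mod c, and the
  inversion then makes it the new lower left entry. The base case c = 0 consists of translations up
  to sign, where evenness of k absorbs the sign.\<close>

lemma modular_SL2:
  fixes F :: "complex \<Rightarrow> complex"
  assumes k: "even k"
    and T: "\<And>z. Im z > 0 \<Longrightarrow> F (z + 1) = F z"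
    and S: "\<And>z. Im z > 0 \<Longrightarrow> F (-1/z) = z powi k * F z"
    and z: "Im z > 0" and det: "a * d - b * c = 1"
  shows "F (moebius_int a b c d z) = (of_int c * z + of_int d) powi k * F z"
proof -
  have Tn: "F (z + of_nat n) = F z" if "Im z > 0" for z n
  proof (induction n)
    case (Suc n)
    have "F (z + of_nat (Suc n)) = F ((z + of_nat n) + 1)" by (simp add: algebra_simps)
    thus ?case using Suc T[of "z + of_nat n"] that by simp
  qed simp
  have Ti: "F (z + of_int n) = F z" if "Im z > 0" for z n
    using Tn[OF that, of "nat n"] Tn[of "z + of_int n" "nat (-n)"] that by (cases "n \<ge> 0") auto
  have "\<forall>a b d. a * d - b * c = 1 \<longrightarrow> F (moebius_int a b c d z) = (of_int c * z + of_int d) powi k * F z"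
  proof (induction "nat \<bar>c\<bar>" arbitrary: c rule: less_induct)
    case less
    show ?case
    proof (intro allI impI)
      fix a b d :: int assume det: "a * d - b * c = 1"
      show "F (moebius_int a b c d z) = (of_int c * z + of_int d) powi k * F z"
      proof (cases "c = 0")
        case True
        hence "a * d = 1" using det by simp
        hence "(a = 1 \<and> d = 1) \<or> (a = -1 \<and> d = -1)" by (simp add: zmult_eq_1_iff)
        thus ?thesis
        proof
          assume "a = 1 \<and> d = 1"
          thus ?thesis using True Ti[OF z, of b] by (simp add: moebius_int_def)
        next
          assume "a = -1 \<and> d = -1"
          thus ?thesis using True Ti[OF z, of "-b"] k by (simp add: moebius_int_def)
        qed
      next
        case False
        define n where "n = a div c"
        define a' where "a' = a mod c"
        define b' where "b' = b - n * d"
        have a: "a = a' + n * c" by (simp add: a'_def n_def)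
        have det': "a' * d - b' * c = 1" using det unfolding a b'_def by (simp add: algebra_simps)
        have "nat \<bar>a'\<bar> < nat \<bar>c\<bar>" using abs_mod_less[OF False, of a] False by (simp add: a'_def)
        moreover have det'': "(-c) * b' - (-d) * a' = 1" using det' by (simp add: algebra_simps)
        ultimately have IH: "F (moebius_int (-c) (-d) a' b' z) = (of_int a' * z + of_int b') powi k * F z"
          using less by blast
        define w where "w = moebius_int a' b' c d z"
        have w: "Im w > 0" unfolding w_def by (rule Im_moebius_int_pos[OF z det'])
        have nz: "of_int c * z + of_int d \<noteq> 0" by (rule int_linear_nonzero[OF z det'])
        have nz': "of_int a' * z + of_int b' \<noteq> 0" by (rule int_linear_nonzero[OF z det''])
        have "moebius_int a b c d z = w + of_int n"
          unfolding w_def moebius_int_def using nz by (simp add: field_simps a b'_def)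
        hence "F (moebius_int a b c d z) = F w" using Ti[OF w] by simp
        also have "moebius_int (-c) (-d) a' b' z = -1 / w"
          unfolding w_def moebius_int_def using nz nz' by (simp add: field_simps)
        hence "w powi k * F w = (of_int a' * z + of_int b') powi k * F z" using IH S[OF w] by simp
        hence "F w = (of_int c * z + of_int d) powi k * F z"
          using nz nz' unfolding w_def moebius_int_def by (simp add: power_int_divide_distrib field_simps)
        finally show ?thesis .
      qed
    qed
  qed
  thus ?thesis using det by blast
qed

definition sl2_equiv :: "complex \<Rightarrow> complex \<Rightarrow> bool" where
  "sl2_equiv z w \<longleftrightarrow> (\<exists>a b c d. a * d - b * c = 1 \<and> w = moebius_int a b c d z)"

lemma sl2_equiv_trans:
  assumes "Im x > 0" "sl2_equiv x y" "sl2_equiv y z"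
  shows "sl2_equiv x z"
proof -
  obtain a' b' c' d' where 1: "a' * d' - b' * c' = 1" "y = moebius_int a' b' c' d' x"
    using assms(2) unfolding sl2_equiv_def by blast
  obtain a b c d where 2: "a * d - b * c = 1" "z = moebius_int a b c d y"
    using assms(3) unfolding sl2_equiv_def by blast
  have "(a * a' + b * c') * (c * b' + d * d') - (a * b' + b * d') * (c * a' + d * c') = (a * d - b * c) * (a' * d' - b' * c')"
    by (simp add: algebra_simps)
  thus ?thesis unfolding sl2_equiv_def using moebius_int_compose[OF assms(1) 1(1) 2(1)] 1 2
    by (metis mult_1)
qed

lemma sl2_equiv_sym:
  assumes "Im x > 0" "sl2_equiv x y"
  shows "sl2_equiv y x"
proof -
  obtain a b c d where 1: "a * d - b * c = 1" "y = moebius_int a b c d x"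
    using assms(2) unfolding sl2_equiv_def by blast
  have 2: "d * a - (-b) * (-c) = 1" using 1(1) by (simp add: algebra_simps)
  have "moebius_int d (-b) (-c) a y = moebius_int (d * a - b * c) 0 0 (d * a - b * c) x"
    unfolding 1(2) moebius_int_compose[OF assms(1) 1(1) 2] by (simp add: algebra_simps)
  also have "\<dots> = x" using 2 by (simp add: moebius_int_def)
  finally show ?thesis unfolding sl2_equiv_def using 2 by metis
qed

lemma sl2_equiv_add_int: "sl2_equiv z (z + of_int n)"
  unfolding sl2_equiv_def by (rule exI[of _ 1], rule exI[of _ n], rule exI[of _ 0], rule exI[of _ 1])
    (simp add: moebius_int_def)

lemma finite_int_linear_le:
  assumes z: "Im z > 0"
  shows "finite {(c, d). norm (of_int c * z + of_int d) \<le> R}"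
proof (rule finite_subset)
  define B where "B = \<lceil>R / Im z\<rceil>"
  define B' where "B' = \<lceil>R + of_int \<bar>B\<bar> * norm z\<rceil>"
  show "{(c, d). norm (of_int c * z + of_int d) \<le> R} \<subseteq> {-B..B} \<times> {-B'..B'}"
  proof safe
    fix c d :: int assume le: "norm (of_int c * z + of_int d) \<le> R"
    have "\<bar>of_int c * Im z\<bar> \<le> norm (of_int c * z + of_int d)"
      using abs_Im_le_cmod[of "of_int c * z + of_int d"] by simp
    hence "\<bar>of_int c\<bar> \<le> R / Im z" using le z by (simp add: abs_mult field_simps)
    hence c: "\<bar>c\<bar> \<le> B" unfolding B_def by linarith
    have "norm (of_int d :: complex) \<le> norm (of_int c * z + of_int d) + norm (of_int c * z)"
      using norm_triangle_ineq4[of "of_int c * z + of_int d" "of_int c * z"] by simp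
    also have "norm (of_int c * z) = of_int \<bar>c\<bar> * norm z" by (simp add: norm_mult)
    also have "\<dots> \<le> of_int \<bar>B\<bar> * norm z" using c by (intro mult_right_mono) auto
    finally have "\<bar>of_int d\<bar> \<le> R + of_int \<bar>B\<bar> * norm z" using le by simp
    hence d: "\<bar>d\<bar> \<le> B'" unfolding B'_def by linarith
    show "c \<in> {-B..B}" "d \<in> {-B'..B'}" using c d by auto
  qed
qed auto

text \<open>A pair (c, d) minimising |cz + d| exists by finiteness and is coprime, because division
  by the gcd gives another candidate. Bezout completes it to a matrix, and a translation normalises
  the real part.\<close>

lemma sl2_reduction:
  assumes z: "Im z > 0"
  obtains w where "sl2_equiv z w" "Im w > 0" "\<bar>Re w\<bar> \<le> 1/2" "norm w \<ge> 1"
proof -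
  define f where "f = (\<lambda>(c, d). norm (of_int c * z + of_int d))"
  define S where "S = {p. p \<noteq> (0, 0) \<and> f p \<le> 1}"
  have "finite S"
    by (rule finite_subset[OF _ finite_int_linear_le[OF z, of 1]]) (auto simp: S_def f_def)
  moreover have "(0, 1) \<in> S" by (simp add: S_def f_def)
  ultimately obtain p where p: "is_arg_min f (\<lambda>p. p \<in> S) p"
    using ex_is_arg_min_if_finite[of S f] by blast
  obtain c d where cd: "p = (c, d)" by (cases p)
  have pS: "(c, d) \<noteq> (0, 0)" "f (c, d) \<le> 1" using p by (auto simp: is_arg_min_def S_def cd)
  have min: "f (c, d) \<le> f x" if "x \<noteq> (0, 0)" for x
    using p that pS(2) unfolding is_arg_min_linorder cd S_def by (cases "f x \<le> 1"; cases x) auto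
  have pos: "f (c, d) > 0" using int_linear_eq_0[OF z, of c d] pS(1) by (auto simp: f_def)
  define g where "g = gcd c d"
  have g: "g > 0" using pS by (simp add: g_def gcd_pos_int)
  obtain c' d' where c': "c = g * c'" and d': "d = g * d'"
    by (metis dvd_def gcd_dvd1 gcd_dvd2 g_def)
  have "(c', d') \<noteq> (0, 0)" using pS(1) c' d' by auto
  hence "f (c, d) \<le> f (c', d')" by (rule min)
  moreover have "f (c, d) = of_int g * f (c', d')"
  proof -
    have "of_int c * z + of_int d = of_int g * (of_int c' * z + of_int d')"
      unfolding c' d' by (simp add: algebra_simps)
    thus ?thesis using g by (simp add: f_def norm_mult)
  qed
  ultimately have "of_int g * f (c', d') \<le> 1 * f (c', d')" "f (c', d') > 0" using pos g
    by (auto simp: zero_less_mult_iff)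
  hence "g \<le> 1" by (subst (asm) mult_le_cancel_right) auto
  hence "gcd c d = 1" using g unfolding g_def by linarith
  then obtain u v where uv: "u * c + v * d = 1" using bezout_int[of c d] by metis
  define w0 where "w0 = moebius_int v (-u) c d z"
  define n where "n = round (Re w0)"
  define a where "a = v - n * c"
  define b where "b = - u - n * d"
  define w where "w = moebius_int a b c d z"
  have det: "a * d - b * c = 1" using uv by (simp add: a_def b_def algebra_simps)
  have nz: "of_int c * z + of_int d \<noteq> 0" by (rule int_linear_nonzero[OF z det])
  have ww0: "w = w0 - of_int n"
    unfolding w_def w0_def moebius_int_def a_def b_def using nz by (simp add: field_simps)
  \<comment> \<open>The numerator az + b belongs to a competing pair, so minimality of the
    denominator gives |w| \<ge> 1.\<close>
  have "(a, b) \<noteq> (0, 0)" using det by auto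
  from min[OF this] have "norm w \<ge> 1"
    using pos unfolding w_def moebius_int_def f_def by (simp add: norm_divide)
  moreover have "\<bar>Re w\<bar> \<le> 1/2"
    using of_int_round_abs_le[of "Re w0"] unfolding ww0 n_def by (simp add: abs_minus_commute)
  moreover have "sl2_equiv z w" unfolding sl2_equiv_def w_def using det by blast
  moreover have "Im w > 0" unfolding w_def by (rule Im_moebius_int_pos[OF z det])
  ultimately show ?thesis using that by blast
qed

lemma fundamental_domain_Im:
  assumes "\<bar>Re w\<bar> \<le> 1/2" "norm w \<ge> 1" "Im w > 0"
  shows "Im w \<ge> sqrt 3 / 2"
proof -
  have "1 \<le> (norm w)\<^sup>2" using assms by simp
  hence "(Re w)\<^sup>2 + (Im w)\<^sup>2 \<ge> 1" by (simp add: cmod_power2)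
  moreover have "(Re w)\<^sup>2 \<le> (1/2)\<^sup>2" using assms(1) by (simp add: abs_le_square_iff[symmetric])
  ultimately have "(Im w)\<^sup>2 \<ge> 3 / 4" by (simp add: power2_eq_square)
  hence "(sqrt 3 / 2)\<^sup>2 \<le> (Im w)\<^sup>2" by (simp add: power_divide)
  thus ?thesis using assms(3) by (simp add: power2_le_iff_abs_le)
qed

section \<open>The maximum principle on the fundamental domain\<close>

lemma j_q_holomorphic: "j_q holomorphic_on ball 0 1 - {0}"
proof -
  have "(\<lambda>r. E4_q r ^ 3 / delta_q r) holomorphic_on ball 0 1 - {0}"
    using E4_q_holomorphic delta_q_holomorphic delta_q_eq_0_iff
    by (intro holomorphic_intros) (auto intro: holomorphic_on_subset)
  thus ?thesis unfolding j_q_def[abs_def] .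
qed

lemma q_invariant:
  fixes g :: "complex \<Rightarrow> complex"
  assumes "\<And>z. Im z > 0 \<Longrightarrow> g (nome (-1/z)) = g (nome z)" "Im z > 0" "sl2_equiv z w"
  shows "g (nome w) = g (nome z)"
proof -
  obtain a b c d where *: "a * d - b * c = 1" "w = moebius_int a b c d z"
    using assms(3) unfolding sl2_equiv_def by blast
  have "g (nome (moebius_int a b c d z)) = (of_int c * z + of_int d) powi 0 * g (nome z)"
    by (rule modular_SL2[where F = "\<lambda>z. g (nome z)"]) (use assms * in \<open>auto simp: nome_add\<close>)
  thus ?thesis using * by simp
qed

lemma norm_nome_le:
  assumes "Im w \<ge> sqrt 3 / 2"
  shows "norm (nome w) \<le> exp (- pi * sqrt 3)"
  unfolding norm_nome using assms by simp

text \<open>Every orbit meets the fundamental domain, so each value on the punctured disc is also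
  taken at radius at most exp (-\<pi> sqrt 3). Hence |g| attains its maximum inside the open disc
  and g is constant.\<close>

lemma weight_zero_constant:
  assumes hol: "g holomorphic_on ball 0 1"
    and inv: "\<And>z. Im z > 0 \<Longrightarrow> g (nome (-1/z)) = g (nome z)" and r: "norm r < 1"
  shows "g r = g 0"
proof -
  define \<rho> where "\<rho> = exp (- pi * sqrt 3)"
  have \<rho>: "0 < \<rho>" "\<rho> < 1" by (auto simp: \<rho>_def)
  have "cball (0::complex) \<rho> \<subseteq> ball 0 1" using \<rho> by auto
  hence "continuous_on (cball 0 \<rho>) g"
    using hol by (intro holomorphic_on_imp_continuous_on) (rule holomorphic_on_subset)
  hence "continuous_on (cball 0 \<rho>) (\<lambda>r. norm (g r))" by (rule continuous_on_norm)
  from continuous_attains_sup[OF compact_cball _ this]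
  obtain r0 where r0: "r0 \<in> cball 0 \<rho>" "\<And>r. r \<in> cball 0 \<rho> \<Longrightarrow> norm (g r) \<le> norm (g r0)"
    using \<rho> by (auto simp del: mem_cball)
  have max: "norm (g r) \<le> norm (g r0)" if r1: "norm r < 1" for r
  proof (cases "r = 0")
    case True
    thus ?thesis using r0(2)[of 0] \<rho> by simp
  next
    case False
    then obtain z where z: "nome z = r" "Im z > 0" using nome_surj[OF False r1] by blast
    then obtain w where w: "sl2_equiv z w" "Im w > 0" "\<bar>Re w\<bar> \<le> 1/2" "norm w \<ge> 1"
      using sl2_reduction by blast
    have "norm (nome w) \<le> \<rho>"
      unfolding \<rho>_def by (rule norm_nome_le[OF fundamental_domain_Im[OF w(3,4,2)]])
    moreover have "g (nome w) = g r" using q_invariant[OF inv z(2) w(1)] z(1) by simp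
    ultimately show ?thesis using r0(2)[of "nome w"] by simp
  qed
  have "g constant_on ball 0 1"
    by (rule maximum_modulus_principle[OF hol open_ball connected_ball open_ball subset_refl, of r0])
       (use r0 \<rho> max in auto)
  thus ?thesis using r by (auto simp: constant_on_def)
qed

text \<open>g^12 \<Delta>^n has weight 0 and vanishes at the cusp. The automorphy factor stands on
  the left so that weight -n is expressed with a natural exponent.\<close>

lemma negative_weight_zero:
  assumes hol: "g holomorphic_on ball 0 1" and n: "n > 0"
    and inv: "\<And>z. Im z > 0 \<Longrightarrow> z ^ n * g (nome (-1/z)) = g (nome z)" and r: "norm r < 1"
  shows "g r = 0"
proof -
  define h where "h = (\<lambda>r. g r ^ 12 * delta_q r ^ n)"
  have h_hol: "h holomorphic_on ball 0 1"
    unfolding h_def by (intro holomorphic_intros hol delta_q_holomorphic)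
  have "h (nome (-1/z)) = h (nome z)" if "Im z > 0" for z
  proof -
    have "h (nome (-1/z)) = (z ^ n * g (nome (-1/z))) ^ 12 * delta_q (nome z) ^ n"
      unfolding h_def delta_q_inversion[OF that] by (simp add: power_mult_distrib mult_ac flip: power_mult)
    thus ?thesis unfolding inv[OF that] h_def .
  qed
  hence h0: "h r = 0" if "norm r < 1" for r
    using weight_zero_constant[OF h_hol _ that] n by (simp add: h_def delta_q_def)
  have g0: "g r = 0" if "norm r < 1" "r \<noteq> 0" for r
    using h0[OF that(1)] delta_q_eq_0_iff[OF that(1)] that(2) by (simp add: h_def)
  show ?thesis
  proof (cases "r = 0")
    case True
    have "isCont g 0"
      using holomorphic_ball_DERIV[OF hol, of 0] by (simp add: DERIV_isCont)
    hence "(g \<longlongrightarrow> g 0) (at 0)" by (simp add: isCont_def)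
    moreover have "\<forall>\<^sub>F r in at 0. g r = 0"
      unfolding eventually_at by (rule exI[of _ 1]) (auto simp: g0)
    hence "(g \<longlongrightarrow> 0) (at 0)" by (rule tendsto_eventually)
    ultimately have "g 0 = 0" by (rule tendsto_unique[OF _ , rotated]) simp
    thus ?thesis using True by simp
  qed (use g0 r in blast)
qed

section \<open>The discriminant identity and forms of weight two\<close>

lemma holomorphic_factor_0:
  assumes "g holomorphic_on ball 0 1" "g 0 = (0::complex)"
  obtains u where "u holomorphic_on ball 0 1" "\<And>r. g r = r * u r" "u 0 = deriv g 0"
proof
  show "(\<lambda>z. if z = 0 then deriv g 0 else (g z - g 0) / (z - 0)) holomorphic_on ball 0 1"
    by (rule pole_lemma_open[OF assms(1) open_ball])
qed (use assms in auto)

lemma qderiv_deriv_0: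
  assumes "f holomorphic_on ball 0 1"
  shows "(qderiv f has_field_derivative deriv f 0) (at 0)"
proof -
  have "(deriv f has_field_derivative deriv (deriv f) 0) (at 0)"
    by (rule holomorphic_ball_DERIV) (auto intro!: holomorphic_intros assms)
  from DERIV_mult[OF DERIV_ident this] show ?thesis by (simp add: qderiv_def[abs_def])
qed

lemma deriv_E2_q_0: "deriv E2_q 0 = -24"
proof -
  have "(deriv euler_prod has_field_derivative deriv (deriv euler_prod) 0) (at 0)"
    by (rule holomorphic_ball_DERIV) (auto intro!: holomorphic_intros euler_prod_holomorphic)
  moreover have "(euler_prod has_field_derivative deriv euler_prod 0) (at 0)"
    by (rule holomorphic_ball_DERIV[OF euler_prod_holomorphic]) simp
  ultimately have "((\<lambda>r. 1 + 24 * (r * deriv euler_prod r / euler_prod r)) has_field_derivative -24) (at 0)"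
    by (auto intro!: derivative_eq_intros simp: deriv_euler_prod_0)
  thus ?thesis unfolding E2_q_def[abs_def] by (rule DERIV_imp_deriv)
qed

text \<open>The quotient by \<Delta> is holomorphic at the cusp and of weight 0, hence constant. Its
  value there is the derivative of the left-hand side at 0, which is 3 * 240 + 2 * 504 =
  1728.\<close>

lemma E4_E6_delta:
  assumes r: "norm r < 1"
  shows "E4_q r ^ 3 - E6_q r ^ 2 = 1728 * delta_q r"
proof -
  note d2 = holomorphic_ball_DERIV[OF E2_q_holomorphic, of 0, unfolded deriv_E2_q_0, simplified]
  have d4: "(E4_q has_field_derivative 240) (at 0)"
    unfolding E4_q_def[abs_def]
    by (rule derivative_eq_intros d2 qderiv_deriv_0 E2_q_holomorphic refl)+ (simp add: deriv_E2_q_0)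
  hence e4: "deriv E4_q 0 = 240" by (rule DERIV_imp_deriv)
  have d6: "(E6_q has_field_derivative -504) (at 0)"
    unfolding E6_q_def[abs_def]
    by (rule derivative_eq_intros d2 d4 qderiv_deriv_0 E4_q_holomorphic refl)+ (simp add: e4)
  define g where "g = (\<lambda>r. E4_q r ^ 3 - E6_q r ^ 2)"
  have "(g has_field_derivative 1728) (at 0)"
    unfolding g_def by (rule derivative_eq_intros d4 d6 refl)+ simp
  hence dg: "deriv g 0 = 1728" by (rule DERIV_imp_deriv)
  have "g holomorphic_on ball 0 1" "g 0 = 0"
    unfolding g_def by (auto intro!: holomorphic_intros E4_q_holomorphic E6_q_holomorphic)
  then obtain u where u: "u holomorphic_on ball 0 1" "\<And>r. g r = r * u r" "u 0 = deriv g 0"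
    using holomorphic_factor_0 by blast
  define v where "v = (\<lambda>r. u r / euler_prod r ^ 24)"
  have v_hol: "v holomorphic_on ball 0 1" unfolding v_def
    by (intro holomorphic_intros u euler_prod_holomorphic) (use euler_prod_nonzero in auto)
  have v: "v (nome z) = g (nome z) / delta_q (nome z)" for z
    unfolding v_def u(2) delta_q_def by simp
  have "v (nome (-1/z)) = v (nome z)" if z: "Im z > 0" for z
  proof -
    have "z \<noteq> 0" using z by auto
    have "g (nome (-1/z)) = z ^ 12 * g (nome z)"
      unfolding g_def E4_q_inversion[OF z] E6_q_inversion[OF z]
      by (simp add: power_mult_distrib ring_distribs flip: power_mult)
    thus ?thesis unfolding v delta_q_inversion[OF z] using \<open>z \<noteq> 0\<close> by simp
  qed
  hence "v r = v 0" using weight_zero_constant[OF v_hol _ r] by blast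
  also have "v 0 = 1728" by (simp add: v_def u dg)
  finally have "u r = 1728 * euler_prod r ^ 24"
    using euler_prod_nonzero[OF r] by (simp add: v_def field_simps)
  thus ?thesis using u(2)[of r] by (simp add: g_def delta_q_def)
qed

lemma E6_q_at_i: "E6_q (nome \<i>) = 0"
proof -
  have "\<i> ^ 6 = -1" by (simp add: eval_nat_numeral)
  thus ?thesis using E6_q_inversion[of \<i>] by simp
qed

text \<open>With c the value at the cusp, (g^2 - c^2 E4)/\<Delta> has weight -8 and is 0. At z = i
  weight two forces g to vanish while E4 does not, so c = 0. The class k' = 14 leads to this weight
  in the uniqueness proof.\<close>

lemma weight_two_zero:
  assumes hol: "g holomorphic_on ball 0 1"
    and inv: "\<And>z. Im z > 0 \<Longrightarrow> g (nome (-1/z)) = z ^ 2 * g (nome z)" and r: "norm r < 1"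
  shows "g r = 0"
proof -
  define c where "c = g 0"
  define h where "h = (\<lambda>r. g r ^ 2 - c ^ 2 * E4_q r)"
  have "h holomorphic_on ball 0 1" "h 0 = 0"
    unfolding h_def c_def by (auto intro!: holomorphic_intros E4_q_holomorphic hol)
  then obtain u where u: "u holomorphic_on ball 0 1" "\<And>r. h r = r * u r"
    using holomorphic_factor_0 by blast
  define v where "v = (\<lambda>r. u r / euler_prod r ^ 24)"
  have v_hol: "v holomorphic_on ball 0 1" unfolding v_def
    by (intro holomorphic_intros u euler_prod_holomorphic) (use euler_prod_nonzero in auto)
  have v: "v (nome z) = h (nome z) / delta_q (nome z)" for z
    unfolding v_def u(2) delta_q_def by simp
  have "z ^ 8 * v (nome (-1/z)) = v (nome z)" if z: "Im z > 0" for z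
  proof -
    have "z \<noteq> 0" using z by auto
    have "h (nome (-1/z)) = z ^ 4 * h (nome z)"
      unfolding h_def E4_q_inversion[OF z] inv[OF z]
      by (simp add: power_mult_distrib algebra_simps flip: power_mult)
    moreover have "z ^ 12 = z ^ 8 * z ^ 4" by (simp flip: power_add)
    ultimately show ?thesis unfolding v delta_q_inversion[OF z] using \<open>z \<noteq> 0\<close> by simp
  qed
  hence v0: "v r = 0" if "norm r < 1" for r
    using negative_weight_zero[OF v_hol, of 8 r] that by simp
  have h0: "g r ^ 2 = c ^ 2 * E4_q r" if "norm r < 1" for r
    using v0[OF that] euler_prod_nonzero[OF that] u(2)[of r] by (simp add: v_def h_def)
  have i: "norm (nome \<i>) < 1" by (rule norm_nome_less_1) simp
  have "g (nome \<i>) = 0" using inv[of \<i>] by simp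
  hence "c ^ 2 * E4_q (nome \<i>) = 0" using h0[OF i] by simp
  moreover have "E4_q (nome \<i>) \<noteq> 0"
    using E4_E6_delta[OF i] E6_q_at_i delta_q_eq_0_iff[OF i] by auto
  ultimately have "c = 0" by simp
  thus ?thesis using h0[OF r] by simp
qed

text \<open>If w' = (aw + b)/(cw + d) with w, w' near z, z', the ratio of the imaginary parts bounds
  cw + d, and then |w'| bounds aw + b. So only finitely many matrices matter, and each of them keeps
  the image of a small neighbourhood of z away from z'.\<close>

lemma sl2_separation:
  assumes z: "Im z > 0" and z': "Im z' > 0" and ne: "\<not> sl2_equiv z z'"
  obtains U U' where "open U" "z \<in> U" "open U'" "z' \<in> U'"
    "\<And>w w'. w \<in> U \<Longrightarrow> w' \<in> U' \<Longrightarrow> Im w > 0 \<Longrightarrow> Im w' > 0 \<Longrightarrow> \<not> sl2_equiv w w'"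
proof -
  define R where "R = norm z + 1"
  define R' where "R' = norm z' + 1"
  \<comment> \<open>The summand 1 passes from a bound for D^2 to one for D, by D \<le> 1 +
    D^2.\<close>
  define M where "M = 1 + R / (Im z' / 2)"
  \<comment> \<open>The four summands bound |c|, |d|, |a| and |b| in turn; since all are positive,
    their sum bounds every entry.\<close>
  define B where "B = \<lceil>M / (Im z / 2)\<rceil> + \<lceil>M + (M / (Im z / 2)) * R\<rceil> + \<lceil>R' * M / (Im z / 2)\<rceil>
     + \<lceil>R' * M + (R' * M / (Im z / 2)) * R\<rceil>"
  have R: "R > 0" "R' > 0" by (simp_all add: R_def R'_def add_nonneg_pos)
  have M: "M > 0" using R z' by (simp add: M_def add_pos_pos)
  define \<Gamma> where "\<Gamma> = {(a, b, c, d). a * d - b * c = 1 \<and> (a, b, c, d) \<in> {-B..B} \<times> {-B..B} \<times> {-B..B} \<times> {-B..B}}"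
  have "finite \<Gamma>" by (rule finite_subset[of _ "{-B..B} \<times> {-B..B} \<times> {-B..B} \<times> {-B..B}"]) (auto simp: \<Gamma>_def)
  have "\<forall>\<^sub>F p in nhds (z, z'). \<forall>\<gamma>\<in>\<Gamma>. (case \<gamma> of (a, b, c, d) \<Rightarrow> snd p - moebius_int a b c d (fst p) \<noteq> 0)"
  proof (rule eventually_ball_finite[OF \<open>finite \<Gamma>\<close>], rule ballI)
    fix \<gamma> assume \<gamma>: "\<gamma> \<in> \<Gamma>"
    obtain a b c d where abcd: "\<gamma> = (a, b, c, d)" by (cases \<gamma>)
    have det: "a * d - b * c = 1" using \<gamma> by (simp add: abcd \<Gamma>_def)
    have "((\<lambda>p. snd p - moebius_int a b c d (fst p)) \<longlongrightarrow> snd (z, z') - moebius_int a b c d (fst (z, z'))) (nhds (z, z'))"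
      unfolding moebius_int_def using int_linear_nonzero[OF z det]
      by (intro tendsto_intros tendsto_fst tendsto_snd filterlim_ident) auto
    moreover have "snd (z, z') - moebius_int a b c d (fst (z, z')) \<noteq> 0"
      using ne det unfolding sl2_equiv_def by auto
    ultimately show "\<forall>\<^sub>F p in nhds (z, z'). (case \<gamma> of (a, b, c, d) \<Rightarrow> snd p - moebius_int a b c d (fst p) \<noteq> 0)"
      unfolding abcd prod.case by (rule tendsto_imp_eventually_ne)
  qed
  then obtain A where A: "open A" "(z, z') \<in> A"
    "\<And>p a b c d. p \<in> A \<Longrightarrow> (a, b, c, d) \<in> \<Gamma> \<Longrightarrow> snd p \<noteq> moebius_int a b c d (fst p)"
    unfolding eventually_nhds by fastforce
  obtain V V' where V: "open V" "open V'" "(z, z') \<in> V \<times> V'" "V \<times> V' \<subseteq> A"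
    using open_prod_elim[OF A(1,2)] by blast
  define U where "U = V \<inter> {w. Im w > Im z / 2} \<inter> ball z 1"
  define U' where "U' = V' \<inter> {w. Im w > Im z' / 2} \<inter> ball z' 1"
  show ?thesis
  proof (rule that)
    show "open U" "open U'" unfolding U_def U'_def using V
      by (auto intro!: open_Int open_Collect_less continuous_intros)
    show "z \<in> U" "z' \<in> U'" using V z z' by (auto simp: U_def U'_def)
    fix w w' assume w: "w \<in> U" "Im w > 0" and w': "w' \<in> U'" "Im w' > 0"
    show "\<not> sl2_equiv w w'"
    proof
      assume "sl2_equiv w w'"
      then obtain a b c d where det: "a * d - b * c = 1" and ww: "w' = moebius_int a b c d w"
        unfolding sl2_equiv_def by blast
      have wb: "Im w > Im z / 2" "norm w \<le> R"
        using w norm_triangle_ineq2[of w z] by (auto simp: U_def R_def dist_norm norm_minus_commute)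
      have wb': "Im w' > Im z' / 2" "norm w' \<le> R'"
        using w' norm_triangle_ineq2[of w' z'] by (auto simp: U'_def R'_def dist_norm norm_minus_commute)
      have nz: "of_int c * w + of_int d \<noteq> 0" by (rule int_linear_nonzero[OF w(2) det])
      define D where "D = norm (of_int c * w + of_int d)"
      have D: "D > 0" using nz by (simp add: D_def)
      have "Im w' = Im w / D ^ 2" unfolding ww D_def by (rule Im_moebius_int[OF w(2) det])
      hence "D ^ 2 = Im w / Im w'" using D w'(2) by (simp add: field_simps)
      also have "\<dots> \<le> R / (Im z' / 2)"
        using wb wb' z' w abs_Im_le_cmod[of w] by (intro frac_le) auto
      finally have "D ^ 2 \<le> M" by (simp add: M_def)
      moreover have "D \<le> 1 + D ^ 2" using zero_le_power2[of "D - 1"] D by (simp add: power2_eq_square algebra_simps)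
      moreover have "D ^ 2 \<le> R / (Im z' / 2)" using \<open>D ^ 2 = Im w / Im w'\<close> \<open>Im w / Im w' \<le> R / (Im z' / 2)\<close> by simp
      ultimately have DM: "D \<le> M" unfolding M_def by linarith
      have lin: "of_int \<bar>x\<bar> \<le> L / (Im z / 2) \<and> of_int \<bar>y\<bar> \<le> L + L / (Im z / 2) * R"
        if "norm (of_int x * w + of_int y) \<le> L" for x y :: int and L
      proof -
        have "\<bar>of_int x\<bar> * Im w \<le> L"
          using abs_Im_le_cmod[of "of_int x * w + of_int y"] that w(2) by (simp add: abs_mult)
        moreover have "\<bar>of_int x\<bar> * (Im z / 2) \<le> \<bar>of_int x\<bar> * Im w" using wb by (intro mult_left_mono) auto
        ultimately have x: "\<bar>of_int x\<bar> \<le> L / (Im z / 2)" using z by (simp add: field_simps)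
        have "norm (of_int y :: complex) \<le> norm (of_int x * w + of_int y) + norm (of_int x * w)"
          using norm_triangle_ineq4[of "of_int x * w + of_int y" "of_int x * w"] by simp
        moreover have "norm (of_int x * w) \<le> L / (Im z / 2) * R"
          unfolding norm_mult norm_of_int using x wb(2) by (intro mult_mono) auto
        ultimately show ?thesis using that x by simp
      qed
      have cd: "of_int \<bar>c\<bar> \<le> M / (Im z / 2) \<and> of_int \<bar>d\<bar> \<le> M + M / (Im z / 2) * R"
        by (rule lin) (use DM in \<open>simp add: D_def\<close>)
      have "norm (of_int a * w + of_int b) = norm w' * D"
        unfolding ww moebius_int_def D_def norm_divide using nz by simp
      also have "\<dots> \<le> R' * M" using wb' DM D R by (intro mult_mono) auto
      finally have ab: "of_int \<bar>a\<bar> \<le> R' * M / (Im z / 2) \<and> of_int \<bar>b\<bar> \<le> R' * M + R' * M / (Im z / 2) * R"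
        by (rule lin)
      have pos: "M / (Im z / 2) > 0" "M + M / (Im z / 2) * R > 0" "R' * M / (Im z / 2) > 0"
         "R' * M + R' * M / (Im z / 2) * R > 0"
        using M R z by (auto intro!: add_pos_pos mult_pos_pos divide_pos_pos)
      have "\<bar>a\<bar> \<le> B \<and> \<bar>b\<bar> \<le> B \<and> \<bar>c\<bar> \<le> B \<and> \<bar>d\<bar> \<le> B"
        using ab cd pos unfolding B_def by linarith
      hence "(a, b, c, d) \<in> \<Gamma>" using det unfolding \<Gamma>_def by auto
      moreover have "(w, w') \<in> A" using V(4) w w' by (auto simp: U_def U'_def)
      ultimately show False using A(3)[of "(w, w')"] ww by auto
    qed
  qed
qed

section \<open>Injectivity of j\<close>

lemma j_q_equiv:
  assumes "Im z > 0" "sl2_equiv z w"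
  shows "j_q (nome w) = j_q (nome z)"
  by (rule q_invariant[OF _ assms]) (rule j_q_inversion)

lemma has_field_derivative_j:
  assumes z: "Im z > 0"
  shows "((\<lambda>z. j_q (nome z)) has_field_derivative
     - (2 * of_real pi * \<i> * (E4_q (nome z) ^ 2 * E6_q (nome z)) / delta_q (nome z))) (at z)"
proof -
  have "((\<lambda>z. j_q (nome z)) has_field_derivative
     - (E4_q (nome z) ^ 2 * E6_q (nome z) / (delta_q (nome z) * nome z)) * (2 * of_real pi * \<i> * nome z)) (at z)"
    by (rule DERIV_chain'[where f = nome and g = j_q, OF has_field_derivative_nome qderiv_j_q])
       (use norm_nome_less_1[OF z] in auto)
  thus ?thesis by (simp add: mult_ac)
qed

lemma j_holomorphic: "(\<lambda>z. j_q (nome z)) holomorphic_on {z. Im z > 0}"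
  unfolding holomorphic_on_open[OF open_Im_pos] using has_field_derivative_j by blast

lemma delta_q_tendsto_0: "filterlim delta_q (at 0) (at 0)"
proof -
  have "isCont delta_q 0"
    using holomorphic_ball_DERIV[OF delta_q_holomorphic, of 0] by (simp add: DERIV_isCont)
  hence "(delta_q \<longlongrightarrow> 0) (at 0)" by (simp add: isCont_def delta_q_def)
  moreover have "\<forall>\<^sub>F r in at 0. delta_q r \<noteq> 0"
    unfolding eventually_at by (rule exI[of _ 1]) (auto simp: delta_q_eq_0_iff)
  ultimately show ?thesis by (simp add: filterlim_at)
qed

lemma j_q_at_cusp: "filterlim j_q at_infinity (at 0)"
proof -
  have "isCont (\<lambda>r. E4_q r ^ 3) 0"
    using holomorphic_ball_DERIV[OF E4_q_holomorphic, of 0] by (intro continuous_intros) (simp add: DERIV_isCont)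
  hence "((\<lambda>r. E4_q r ^ 3) \<longlongrightarrow> 1) (at 0)" by (simp add: isCont_def)
  from filterlim_divide_at_infinity[OF this delta_q_tendsto_0] show ?thesis
    unfolding j_q_def[abs_def] by simp
qed

lemma j_q_large_near_cusp:
  obtains e where "e > 0" "e < 1" "\<And>r. r \<noteq> 0 \<Longrightarrow> norm r < e \<Longrightarrow> norm (j_q r) > M"
proof -
  have "\<forall>\<^sub>F r in at 0. norm (j_q r) > M"
    using filterlim_compose[OF filterlim_norm_at_top j_q_at_cusp] by (simp add: filterlim_at_top_dense)
  then obtain d where "d > 0" "\<And>r. r \<noteq> 0 \<Longrightarrow> norm r < d \<Longrightarrow> norm (j_q r) > M"
    unfolding eventually_at by (auto simp: dist_norm)
  thus ?thesis by (intro that[of "min d (1/2)"]) auto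
qed

text \<open>1/j extends to a holomorphic function r + O(r^2) at 0, hence is injective on a small
  disc. The radius also keeps E4^2 E6, the numerator of j', away from 0.\<close>

lemma j_injective_near_cusp:
  obtains e where "e > 0" "e < 1"
    "\<And>r s. r \<noteq> 0 \<Longrightarrow> s \<noteq> 0 \<Longrightarrow> norm r < e \<Longrightarrow> norm s < e \<Longrightarrow> j_q r = j_q s \<Longrightarrow> r = s"
    "\<And>r. norm r < e \<Longrightarrow> E4_q r ^ 2 * E6_q r \<noteq> 0"
proof -
  have cont: "isCont (\<lambda>r. E4_q r ^ 2 * E6_q r) 0"
    using holomorphic_ball_DERIV[OF E4_q_holomorphic, of 0] holomorphic_ball_DERIV[OF E6_q_holomorphic, of 0]
    by (intro continuous_intros) (auto simp: DERIV_isCont)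
  have "E4_q 0 ^ 2 * E6_q 0 \<noteq> 0" by simp
  from continuous_at_avoid[OF cont this] obtain d where
    d: "d > 0" "\<And>r. dist 0 r < d \<Longrightarrow> E4_q r ^ 2 * E6_q r \<noteq> 0" by blast
  define d' where "d' = min d 1"
  have d': "d' > 0" "d' \<le> 1" "\<And>r. norm r < d' \<Longrightarrow> E4_q r ^ 2 * E6_q r \<noteq> 0"
    using d by (auto simp: d'_def)
  define u where "u = (\<lambda>r. r * (euler_prod r ^ 24 / E4_q r ^ 3))"
  have sub: "ball 0 d' \<subseteq> ball (0::complex) 1" using d' by auto
  have v_hol: "(\<lambda>r. euler_prod r ^ 24 / E4_q r ^ 3) holomorphic_on ball 0 d'"
    by (intro holomorphic_intros holomorphic_on_subset[OF euler_prod_holomorphic sub]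
        holomorphic_on_subset[OF E4_q_holomorphic sub]) (use d'(3) in auto)
  hence u_hol: "u holomorphic_on ball 0 d'"
    unfolding u_def by (intro holomorphic_on_mult holomorphic_on_ident)
  obtain v' where v': "((\<lambda>r. euler_prod r ^ 24 / E4_q r ^ 3) has_field_derivative v') (at 0)"
    using v_hol d'(1) by (meson centre_in_ball holomorphic_on_imp_differentiable_at open_ball field_differentiable_def)
  have "(u has_field_derivative 1) (at 0)"
    using DERIV_mult[OF DERIV_ident v'] unfolding u_def by simp
  hence du: "deriv u 0 \<noteq> 0" by (simp add: DERIV_imp_deriv)
  have 0: "0 \<in> ball (0::complex) d'" using d'(1) by simp
  obtain e where e: "e > 0" "ball (0::complex) e \<subseteq> ball 0 d'" "inj_on u (ball 0 e)"
    by (rule has_complex_derivative_locally_injective[OF u_hol 0 open_ball du]) (rule that)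
  have ju: "u r = inverse (j_q r)" for r unfolding u_def j_q_def delta_q_def by (simp add: field_simps)
  have sub2: "norm r < e \<Longrightarrow> norm r < d'" for r :: complex using e(2) by (auto simp: subset_iff)
  show ?thesis
  proof (rule that[of "min e (1/2)"])
    fix r s :: complex assume "norm r < min e (1/2)" "norm s < min e (1/2)" "j_q r = j_q s"
    hence "u r = u s" "r \<in> ball 0 e" "s \<in> ball 0 e" by (auto simp only: ju mem_ball_0 min_less_iff_conj)
    thus "r = s" using e(3) by (meson inj_onD)
  next
    show "E4_q r ^ 2 * E6_q r \<noteq> 0" if "norm r < min e (1/2)" for r
      by (rule d'(3)[OF sub2]) (use that in simp)
  qed (use e(1) in simp_all)
qed

lemma sl2_equiv_if_nome_eq: "nome z = nome w \<Longrightarrow> sl2_equiv z w"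
  using nome_eq_iff[of w z] sl2_equiv_add_int by metis

lemma fsigma_Im_pos: "fsigma {z :: complex. Im z > 0}"
proof -
  have "{z :: complex. Im z > 0} = (\<Union>n::nat. {z. Im z \<ge> 1 / real (Suc n)})"
  proof safe
    fix z :: complex assume "Im z > 0"
    then obtain n where "1 / real (Suc n) < Im z" using nat_approx_posE by blast
    thus "z \<in> (\<Union>n::nat. {z. Im z \<ge> 1 / real (Suc n)})" by (auto intro!: exI[of _ n])
  next
    fix z :: complex and n :: nat assume "1 / real (Suc n) \<le> Im z"
    thus "Im z > 0" by (rule less_le_trans[rotated]) simp
  qed
  moreover have "fsigma (\<Union>n::nat. {z :: complex. Im z \<ge> 1 / real (Suc n)})"
    by (rule fsigma.intros) (intro closed_Collect_le continuous_intros)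
  ultimately show ?thesis by simp
qed

lemma connected_Im_pos: "connected {z :: complex. Im z > 0}"
  using convex_halfspace_Im_gt[of 0] convex_connected by blast

lemma countable_critical_points: "countable {z \<in> {z. Im z > 0}. E4_q (nome z) ^ 2 * E6_q (nome z) = 0}"
proof (rule holomorphic_countable_zeros[OF _ open_Im_pos connected_Im_pos fsigma_Im_pos])
  show "(\<lambda>z. E4_q (nome z) ^ 2 * E6_q (nome z)) holomorphic_on {z. Im z > 0}"
    unfolding holomorphic_on_open[OF open_Im_pos]
    by (auto intro!: derivative_eq_intros exI DERIV_nome_compose E4_q_holomorphic E6_q_holomorphic)
  show "\<not> (\<lambda>z. E4_q (nome z) ^ 2 * E6_q (nome z)) constant_on {z. Im z > 0}"
  proof
    assume "(\<lambda>z. E4_q (nome z) ^ 2 * E6_q (nome z)) constant_on {z. Im z > 0}"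
    then obtain c where c: "\<And>z. Im z > 0 \<Longrightarrow> E4_q (nome z) ^ 2 * E6_q (nome z) = c"
      by (auto simp: constant_on_def)
    have "c = 0" using c[of \<i>] E6_q_at_i by simp
    obtain e where e: "e > 0" "e < 1" "\<And>r. norm r < e \<Longrightarrow> E4_q r ^ 2 * E6_q r \<noteq> 0"
      using j_injective_near_cusp by metis
    have "norm (of_real (e/2) :: complex) < 1" "of_real (e/2) \<noteq> (0::complex)" using e by auto
    then obtain z where z: "nome z = of_real (e/2)" "Im z > 0" using nome_surj by metis
    moreover have "norm (nome z) = e / 2" unfolding z(1) norm_of_real using e(1) by simp
    ultimately show False using c[of z] e(3)[of "nome z"] \<open>c = 0\<close> e(1) by simp
  qed
qed

text \<open>B collects the points whose j-value is shared with an inequivalent point. It is open by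
  the open mapping theorem and the separation of orbits; off the critical set C its complement is
  open too. As the half-plane minus C is connected and some point high up lies outside B, B is
  contained in the countable set C, and a countable open set is empty.\<close>

theorem j_injective:
  assumes "Im z > 0" "Im z' > 0" "j_q (nome z) = j_q (nome z')"
  shows "sl2_equiv z z'"
proof -
  define H where "H = {z :: complex. Im z > 0}"
  define J where "J = (\<lambda>z. j_q (nome z))"
  define B where "B = {z \<in> H. \<exists>z'\<in>H. J z' = J z \<and> \<not> sl2_equiv z z'}"
  define C where "C = {z \<in> H. E4_q (nome z) ^ 2 * E6_q (nome z) = 0}"
  have openH: "open H" unfolding H_def by (rule open_Im_pos)
  have J_hol: "J holomorphic_on H" unfolding J_def H_def by (rule j_holomorphic)
  have J_cont: "isCont J z" if "z \<in> H" for z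
    using has_field_derivative_j that unfolding H_def J_def by (auto intro: DERIV_isCont)
  have C: "countable C" using countable_critical_points unfolding C_def H_def .
  have J_nc: "\<not> J constant_on H"
  proof
    assume "J constant_on H"
    then obtain c where c: "\<And>z. Im z > 0 \<Longrightarrow> j_q (nome z) = c"
      by (auto simp: constant_on_def H_def J_def)
    obtain e where e: "e > 0" "e < 1" "\<And>r. r \<noteq> 0 \<Longrightarrow> norm r < e \<Longrightarrow> norm (j_q r) > norm c"
      using j_q_large_near_cusp[of "norm c"] by blast
    have "norm (of_real (e/2) :: complex) < 1" "of_real (e/2) \<noteq> (0::complex)" using e by auto
    then obtain z where z: "nome z = of_real (e/2)" "Im z > 0" using nome_surj by metis
    moreover have "norm (nome z) = e / 2" unfolding z(1) norm_of_real using e(1) by simp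
    ultimately show False using c[of z] e(3)[of "nome z"] e(1) by simp
  qed
  have openB: "open B"
  proof (subst open_subopen, safe)
    fix z assume "z \<in> B"
    then obtain z' where z: "z \<in> H" and z': "z' \<in> H" "J z' = J z" "\<not> sl2_equiv z z'"
      unfolding B_def by blast
    obtain U U' where U: "open U" "z \<in> U" "open U'" "z' \<in> U'"
      "\<And>w w'. w \<in> U \<Longrightarrow> w' \<in> U' \<Longrightarrow> Im w > 0 \<Longrightarrow> Im w' > 0 \<Longrightarrow> \<not> sl2_equiv w w'"
      using sl2_separation[of z z'] z z' unfolding H_def by auto
    have W: "open (J ` (U' \<inter> H))"
      using U(3) openH J_nc connected_Im_pos
      by (intro open_mapping_thm[OF J_hol openH]) (auto simp: H_def)
    define V where "V = {w \<in> U \<inter> H. J w \<in> J ` (U' \<inter> H)}"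
    have "V = (U \<inter> H) \<inter> J -` (J ` (U' \<inter> H))" by (auto simp: V_def)
    moreover have "open ((U \<inter> H) \<inter> J -` (J ` (U' \<inter> H)))"
      using U(1) openH W J_hol
      by (intro continuous_open_preimage) (auto intro: holomorphic_on_imp_continuous_on holomorphic_on_subset)
    ultimately have "open V" by simp
    moreover have "z \<in> V" using z U z' unfolding V_def by (auto intro!: image_eqI[of _ J z'])
    moreover have "V \<subseteq> B"
    proof
      fix w assume "w \<in> V"
      then obtain w' where "w \<in> U" "w \<in> H" "w' \<in> U'" "w' \<in> H" "J w' = J w" unfolding V_def by auto
      thus "w \<in> B" unfolding B_def using U(5)[of w w'] by (auto simp: H_def)
    qed
    ultimately show "\<exists>T. open T \<and> z \<in> T \<and> T \<subseteq> B" by blast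
  qed
  \<comment> \<open>Otherwise points \<open>w n\<close> of B tend to z. Representatives
    \<open>w' n\<close> of their inequivalent partners in the fundamental domain have bounded height
    because j stays bounded, so a subsequence tends to some l with the j-value of z. Since z is not
    in B, l is equivalent to z, and moving the \<open>w' n\<close> by the same matrix contradicts
    local injectivity of j at z.\<close>
  have nbhd: "\<exists>T. open T \<and> z \<in> T \<and> T \<inter> B = {}" if z: "z \<in> H" "z \<notin> C" "z \<notin> B" for z
  proof (rule ccontr)
    assume "\<not> (\<exists>T. open T \<and> z \<in> T \<and> T \<inter> B = {})"
    hence "\<exists>w. w \<in> ball z (inverse (Suc n)) \<inter> B" for n
      by (metis centre_in_ball ex_in_conv inverse_positive_iff_positive of_nat_0_less_iff open_ball zero_less_Suc)
    then obtain w where w: "\<And>n. w n \<in> ball z (inverse (Suc n))" "\<And>n. w n \<in> B" by (metis IntD1 IntD2)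
    have w_lim: "w \<longlonglongrightarrow> z"
    proof (rule metric_LIMSEQ_I)
      fix r :: real assume "r > 0"
      then obtain N where N: "inverse (real (Suc N)) < r" using reals_Archimedean by blast
      have "dist (w n) z < r" if "n \<ge> N" for n
      proof -
        have "dist (w n) z < inverse (real (Suc n))" using w(1)[of n] by (simp add: dist_commute)
        also have "\<dots> \<le> inverse (real (Suc N))" using that by (intro le_imp_inverse_le) auto
        finally show ?thesis using N by simp
      qed
      thus "\<exists>no. \<forall>n\<ge>no. dist (w n) z < r" by blast
    qed
    have "\<exists>w'. Im w' > 0 \<and> \<bar>Re w'\<bar> \<le> 1/2 \<and> norm w' \<ge> 1 \<and> J w' = J (w n) \<and> \<not> sl2_equiv (w n) w'" for n
    proof -
      obtain v where v: "w n \<in> H" "v \<in> H" "J v = J (w n)" "\<not> sl2_equiv (w n) v"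
        using w(2)[of n] unfolding B_def by blast
      have Iv: "Im v > 0" using v by (simp add: H_def)
      obtain w' where w': "sl2_equiv v w'" "Im w' > 0" "\<bar>Re w'\<bar> \<le> 1/2" "norm w' \<ge> 1"
        using sl2_reduction[OF Iv] by blast
      have "J w' = J v" unfolding J_def by (rule j_q_equiv[OF Iv w'(1)])
      moreover have "\<not> sl2_equiv (w n) w'"
        using v sl2_equiv_trans[OF _ _ sl2_equiv_sym[OF Iv w'(1)], of "w n"] by (auto simp: H_def)
      ultimately show ?thesis using v w' by auto
    qed
    then obtain w' where w': "\<And>n. Im (w' n) > 0" "\<And>n. \<bar>Re (w' n)\<bar> \<le> 1/2" "\<And>n. norm (w' n) \<ge> 1"
      "\<And>n. J (w' n) = J (w n)" "\<And>n. \<not> sl2_equiv (w n) (w' n)" by metis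
    have "(\<lambda>n. J (w n)) \<longlonglongrightarrow> J z"
      using isCont_tendsto_compose[OF J_cont[OF z(1)] w_lim] .
    hence "Bseq (\<lambda>n. J (w n))" by (intro convergent_imp_Bseq convergentI)
    then obtain M where M: "\<And>n. norm (J (w n)) \<le> M" unfolding Bseq_def by blast
    obtain e where e: "e > 0" "e < 1" "\<And>r. r \<noteq> 0 \<Longrightarrow> norm r < e \<Longrightarrow> norm (j_q r) > M"
      using j_q_large_near_cusp[of M] by blast
    \<comment> \<open>The height at which |q| = e, above which |j| exceeds M.\<close>
    define Y where "Y = ln (1/e) / (2 * pi)"
    have Y: "Im (w' n) \<le> Y" for n
    proof -
      have "\<not> norm (nome (w' n)) < e" using e(3)[of "nome (w' n)"] M[of n] w'(4)[of n] by (auto simp: J_def)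
      hence "e \<le> exp (- 2 * pi * Im (w' n))" unfolding norm_nome by simp
      hence "ln e \<le> - 2 * pi * Im (w' n)" using ln_mono[OF _ e(1)] by fastforce
      thus ?thesis using e(1) by (simp add: Y_def ln_div field_simps)
    qed
    define K where "K = cbox (Complex (-1/2) (sqrt 3 / 2)) (Complex (1/2) Y)"
    have "w' n \<in> K" for n
      using w'(1-3)[of n] Y[of n] fundamental_domain_Im[OF w'(2,3,1), of n]
      by (auto simp: K_def in_cbox_complex_iff)
    then obtain l r where l: "l \<in> K" "strict_mono r" "(w' \<circ> r) \<longlonglongrightarrow> l"
      using compact_cbox[of "Complex (-1/2) (sqrt 3 / 2)" "Complex (1/2) Y"] unfolding K_def compact_def by metis
    have "sqrt 3 \<le> Im l * 2" using l(1) unfolding K_def in_cbox_complex_iff by simp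
    moreover have "sqrt 3 > (0::real)" by simp
    ultimately have lH: "Im l > 0" by linarith
    have wr: "(w \<circ> r) \<longlonglongrightarrow> z" using LIMSEQ_subseq_LIMSEQ[OF w_lim l(2)] .
    have "(\<lambda>n. J ((w' \<circ> r) n)) \<longlonglongrightarrow> J l"
      using isCont_tendsto_compose[OF J_cont l(3)] lH by (simp add: H_def)
    moreover have "(\<lambda>n. J ((w' \<circ> r) n)) \<longlonglongrightarrow> J z"
      using isCont_tendsto_compose[OF J_cont[OF z(1)] wr] by (simp add: w'(4) o_def)
    ultimately have "J l = J z" by (rule LIMSEQ_unique)
    hence "sl2_equiv z l" using z lH unfolding B_def H_def by auto
    hence "sl2_equiv l z" using sl2_equiv_sym z(1) by (auto simp: H_def)
    then obtain a b c d where det: "a * d - b * c = 1" and zl: "z = moebius_int a b c d l"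
      unfolding sl2_equiv_def by blast
    define v where "v = (\<lambda>n. moebius_int a b c d (w' (r n)))"
    have v_lim: "v \<longlonglongrightarrow> z"
      unfolding v_def zl moebius_int_def using int_linear_nonzero[OF lH det] l(3)
      by (intro tendsto_intros) (auto simp: o_def)
    have eqv: "sl2_equiv (w' (r n)) (v n)" for n
      unfolding v_def sl2_equiv_def using det by blast
    have Jv: "J (v n) = J (w (r n))" for n
      using j_q_equiv[OF w'(1) eqv] w'(4) by (simp add: J_def)
    have "deriv J z \<noteq> 0"
    proof -
      have "deriv J z = - (2 * of_real pi * \<i> * (E4_q (nome z) ^ 2 * E6_q (nome z)) / delta_q (nome z))"
        unfolding J_def by (rule DERIV_imp_deriv[OF has_field_derivative_j]) (use z in \<open>simp add: H_def\<close>)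
      moreover have "delta_q (nome z) \<noteq> 0" using z by (simp add: delta_q_eq_0_iff norm_nome_less_1 H_def)
      ultimately show ?thesis using z(1,2) unfolding C_def by auto
    qed
    from has_complex_derivative_locally_injective[OF J_hol z(1) openH this]
    obtain s where s: "s > 0" "inj_on J (ball z s)" by blast
    have "\<forall>\<^sub>F n in sequentially. v n \<in> ball z s \<and> (w \<circ> r) n \<in> ball z s"
      using topological_tendstoD[OF v_lim open_ball] topological_tendstoD[OF wr open_ball] s(1)
      by (intro eventually_conj) auto
    then obtain n where "v n \<in> ball z s" "w (r n) \<in> ball z s"
      by (auto simp: eventually_sequentially)
    hence "v n = w (r n)" using s(2) Jv[of n] by (auto dest: inj_onD)
    hence "sl2_equiv (w (r n)) (w' (r n))" using sl2_equiv_sym[OF w'(1) eqv[of n]] by simp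
    thus False using w'(5) by blast
  qed
  define G where "G = \<Union>{T. open T \<and> T \<inter> B = {}}"
  have openG: "open G" unfolding G_def by blast
  have "H - C \<subseteq> B \<union> G" using nbhd unfolding G_def by blast
  moreover have "B \<inter> G \<inter> (H - C) = {}" unfolding G_def by blast
  moreover have "connected (H - C)"
    by (rule connected_open_diff_countable[OF _ openH _ C]) (use connected_Im_pos in \<open>simp_all add: H_def\<close>)
  ultimately have "B \<inter> (H - C) = {} \<or> G \<inter> (H - C) = {}"
    using connectedD openB openG by blast
  moreover have "\<exists>z0. z0 \<in> H - C \<and> z0 \<notin> B"
  proof -
    obtain e where e: "e > 0" "e < 1"
      "\<And>r s. r \<noteq> 0 \<Longrightarrow> s \<noteq> 0 \<Longrightarrow> norm r < e \<Longrightarrow> norm s < e \<Longrightarrow> j_q r = j_q s \<Longrightarrow> r = s"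
      "\<And>r. norm r < e \<Longrightarrow> E4_q r ^ 2 * E6_q r \<noteq> 0"
      using j_injective_near_cusp by blast
    define \<rho> where "\<rho> = exp (- pi * sqrt 3)"
    have \<rho>: "\<rho> < 1" by (simp add: \<rho>_def)
    have "compact (cball (0::complex) \<rho> - ball 0 e)" by (intro compact_diff) auto
    moreover have "continuous_on (cball 0 \<rho> - ball 0 e) j_q"
      by (rule continuous_on_subset[OF holomorphic_on_imp_continuous_on[OF j_q_holomorphic]]) (use \<rho> e in auto)
    ultimately have "bounded (j_q ` (cball 0 \<rho> - ball 0 e))"
      by (intro compact_imp_bounded compact_continuous_image)
    then obtain M where M: "\<And>r. norm r \<le> \<rho> \<Longrightarrow> norm r \<ge> e \<Longrightarrow> norm (j_q r) \<le> M"
      unfolding bounded_iff by fastforce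
    obtain e' where e': "e' > 0" "e' < 1" "\<And>r. r \<noteq> 0 \<Longrightarrow> norm r < e' \<Longrightarrow> norm (j_q r) > M"
      using j_q_large_near_cusp[of M] by blast
    \<comment> \<open>On the circle |q| = t, j is larger than on the part |q| \<ge> e of the image
      of the fundamental domain. A reduced partner therefore has |q| < e, where j is injective in
      q.\<close>
    define t where "t = min e e' / 2"
    have t: "t > 0" "t < e" "t < e'" "t < 1" using e e' by (auto simp: t_def min_def)
    have "norm (of_real t :: complex) < 1" "of_real t \<noteq> (0::complex)" using t by auto
    then obtain z0 where z0: "nome z0 = of_real t" "Im z0 > 0" using nome_surj by metis
    have n0: "norm (nome z0) = t" using z0 t by simp
    have "z0 \<notin> C" using e(4)[of "nome z0"] n0 t by (auto simp: C_def)
    moreover have "z0 \<notin> B"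
    proof
      assume "z0 \<in> B"
      then obtain v where v: "Im v > 0" "J v = J z0" "\<not> sl2_equiv z0 v" unfolding B_def H_def by blast
      obtain w where w: "sl2_equiv v w" "Im w > 0" "\<bar>Re w\<bar> \<le> 1/2" "norm w \<ge> 1"
        using sl2_reduction[OF v(1)] by blast
      have jw: "j_q (nome w) = j_q (nome z0)" using j_q_equiv[OF v(1) w(1)] v(2) by (simp add: J_def)
      have "norm (nome w) \<le> \<rho>" unfolding \<rho>_def by (rule norm_nome_le[OF fundamental_domain_Im[OF w(3,4,2)]])
      hence "norm (nome w) < e" using M[of "nome w"] e'(3)[of "nome z0"] jw n0 t by force
      hence "nome w = nome z0" using e(3)[of "nome w" "nome z0"] jw n0 t by simp
      hence "sl2_equiv z0 w" by (intro sl2_equiv_if_nome_eq) simp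
      from sl2_equiv_trans[OF z0(2) this sl2_equiv_sym[OF v(1) w(1)]] show False using v(3) by blast
    qed
    ultimately show ?thesis using z0(2) unfolding H_def by blast
  qed
  ultimately have "B \<inter> (H - C) = {}" using \<open>H - C \<subseteq> B \<union> G\<close> by blast
  hence "B \<subseteq> C" unfolding B_def by blast
  have "B = {}"
  proof (rule ccontr)
    assume "B \<noteq> {}"
    then obtain x s where "s > 0" and xs: "ball x s \<subseteq> B" using openB open_contains_ball by blast
    have "countable (ball x s)"
      by (rule countable_subset[OF order_trans[OF xs \<open>B \<subseteq> C\<close>] C])
    thus False using uncountable_ball[OF \<open>s > 0\<close>] by blast
  qed
  thus ?thesis using assms unfolding B_def H_def J_def by auto
qed

section \<open>The canonical basis\<close>

text \<open>For a \<le> 2 and b \<le> 1 the weights 4a + 6b are exactly 0, 4, 6, 8, 10, 14, so this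
  is the Eisenstein series of weight k'; replacing (a, b) by (2 - a, 1 - b) gives weight 14 -
  k'.\<close>

definition eis_q :: "nat \<Rightarrow> nat \<Rightarrow> complex \<Rightarrow> complex" where
  "eis_q a b r = E4_q r ^ a * E6_q r ^ b"

lemma eis_q_holomorphic: "eis_q a b holomorphic_on ball 0 1"
  unfolding eis_q_def by (intro holomorphic_intros E4_q_holomorphic E6_q_holomorphic)

lemma eis_q_0 [simp]: "eis_q a b 0 = 1"
  by (simp add: eis_q_def)

lemma eis_q_inversion:
  "Im z > 0 \<Longrightarrow> eis_q a b (nome (-1/z)) = z ^ (4 * a + 6 * b) * eis_q a b (nome z)"
  by (simp add: eis_q_def E4_q_inversion[simplified] E6_q_inversion[simplified] power_mult_distrib power_add power_mult)

lemma weight_ell_unique: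
  assumes "k - 12 * l \<in> {0, 4, 6, 8, 10, 14}"
  shows "weight_ell k = l"
  unfolding weight_ell_def
proof (rule the_equality)
  show "k - 12 * l \<in> {0, 4, 6, 8, 10, 14}" by fact
  fix l' :: int assume "k - 12 * l' \<in> {0, 4, 6, 8, 10, 14}"
  thus "l' = l" using assms by auto presburger+
qed

lemma even_weight_decomp:
  assumes "even (k :: int)"
  obtains a b where "a \<le> 2" "b \<le> 1" "k = 12 * weight_ell k + 4 * int a + 6 * int b"
proof -
  have "\<exists>l. k - 12 * l \<in> {0, 4, 6, 8, 10, 14}"
  proof -
    define d r where "d = k div 12" and "r = k mod 12"
    have k: "k = 12 * d + r" by (simp add: d_def r_def)
    have "even r" using assms by (simp add: k)
    moreover have "0 \<le> r" "r < 12" by (simp_all add: r_def)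
    ultimately have "r \<in> {0, 2, 4, 6, 8, 10}" by (auto elim!: evenE)
    hence "k - 12 * d \<in> {0, 4, 6, 8, 10, 14} \<or> k - 12 * (d - 1) \<in> {0, 4, 6, 8, 10, 14}"
      unfolding k by auto
    thus ?thesis by blast
  qed
  then obtain l where l: "k - 12 * l \<in> {0, 4, 6, 8, 10, 14}" by blast
  have wl: "weight_ell k = l" by (rule weight_ell_unique[OF l])
  from l consider "k = 12 * l + 4 * int 0 + 6 * int 0" | "k = 12 * l + 4 * int 1 + 6 * int 0"
    | "k = 12 * l + 4 * int 0 + 6 * int 1" | "k = 12 * l + 4 * int 2 + 6 * int 0"
    | "k = 12 * l + 4 * int 1 + 6 * int 1" | "k = 12 * l + 4 * int 2 + 6 * int 1"
    by auto
  thus ?thesis unfolding wl[symmetric]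
    by cases (use that[of 0 0] that[of 1 0] that[of 0 1] that[of 2 0] that[of 1 1] that[of 2 1] in simp_all)
qed

section \<open>q-expansions and uniqueness of the basis\<close>

lemma holomorphic_has_q_expansion:
  assumes V: "V holomorphic_on ball 0 1"
  obtains v where "\<And>z. Im z > 0 \<Longrightarrow>
    ((\<lambda>n. (if n \<ge> N then v (nat (n - N)) else 0) * nome z powi n) has_sum (nome z powi N * V (nome z))) UNIV"
proof
  define v where "v = (\<lambda>n. (deriv ^^ n) V 0 / fact n)"
  have sums: "(\<lambda>n. v n * r ^ n) sums V r" if "norm r < 1" for r
    using holomorphic_power_series[OF V, of r] that by (simp add: v_def)
  fix z :: complex assume z: "Im z > 0"
  define q where "q = nome z"
  have q: "norm q < 1" "q \<noteq> 0" using norm_nome_less_1[OF z] by (auto simp: q_def)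
  obtain s where s: "norm q < s" "s < 1" using dense[OF q(1)] by blast
  have "s > 0" using s norm_ge_zero[of q] by linarith
  hence "summable (\<lambda>n. v n * of_real s ^ n)"
    by (intro sums_summable[OF sums]) (use s in simp)
  hence "summable (\<lambda>n. norm (v n * q ^ n))"
    by (rule powser_insidea) (use s in auto)
  hence "((\<lambda>n. v n * q ^ n) has_sum V q) UNIV"
    by (rule norm_summable_imp_has_sum[OF _ sums[OF q(1)]])
  hence "((\<lambda>n. q powi N * (v n * q ^ n)) has_sum (q powi N * V q)) UNIV"
    by (rule has_sum_cmult_right)
  also have "?this \<longleftrightarrow> ((\<lambda>n. v (nat (n - N)) * q powi n) has_sum (q powi N * V q)) {N..}"
  proof (rule has_sum_reindex_bij_witness[of _ "\<lambda>n. nat (n - N)" "\<lambda>n. int n + N"])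
    fix n :: nat
    show "v (nat (int n + N - N)) * q powi (int n + N) = q powi N * (v n * q ^ n)"
      using q(2) by (simp add: power_int_add)
  qed auto
  also have "\<dots> \<longleftrightarrow> ((\<lambda>n. (if n \<ge> N then v (nat (n - N)) else 0) * q powi n) has_sum (q powi N * V q)) UNIV"
    by (rule has_sum_cong_neutral) auto
  finally show "((\<lambda>n. (if n \<ge> N then v (nat (n - N)) else 0) * nome z powi n) has_sum (nome z powi N * V (nome z))) UNIV"
    unfolding q_def .
qed

text \<open>Every r in the punctured disc is some \<open>nome z\<close>, so the expansion converges
  there; after division by r^N it is an ordinary power series on the whole disc.\<close>

lemma has_q_expansion_holomorphic:
  assumes f: "has_q_expansion f a" and N: "\<And>n. n < N \<Longrightarrow> a n = 0"
  obtains V where "V holomorphic_on ball 0 1" "\<And>z. Im z > 0 \<Longrightarrow> f z = nome z powi N * V (nome z)"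
proof
  define V where "V = (\<lambda>r. \<Sum>n. a (int n + N) * r ^ n)"
  have hs: "((\<lambda>n. a (int n + N) * r ^ n) has_sum (f z / r powi N)) UNIV"
    if z: "Im z > 0" and r: "r = nome z" for z r
  proof -
    have rn: "r \<noteq> 0" using r by simp
    have "((\<lambda>n. a n * r powi n) has_sum f z) UNIV"
      using f z r unfolding has_q_expansion_def upper_half_plane_def by auto
    also have "?this \<longleftrightarrow> ((\<lambda>n. a n * r powi n) has_sum f z) {N..}"
      by (rule has_sum_cong_neutral) (use N in auto)
    also have "\<dots> \<longleftrightarrow> ((\<lambda>n. a (int n + N) * r powi (int n + N)) has_sum f z) UNIV"
      by (rule has_sum_reindex_bij_witness[of _ "\<lambda>n. int n + N" "\<lambda>n. nat (n - N)"]) auto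
    finally have "((\<lambda>n. inverse (r powi N) * (a (int n + N) * r powi (int n + N))) has_sum (inverse (r powi N) * f z)) UNIV"
      by (rule has_sum_cmult_right)
    moreover have "inverse (r powi N) * (a (int n + N) * r powi (int n + N)) = a (int n + N) * r ^ n" for n
      using rn by (simp add: power_int_add)
    ultimately show ?thesis by (simp add: divide_inverse mult.commute)
  qed
  have "(\<lambda>n. a (int n + N) * r ^ n) sums V r" if "norm r < 1" for r
  proof (cases "r = 0")
    case True
    have "(\<lambda>n. a (int n + N) * 0 ^ n) sums a (int 0 + N)"
      by (rule powser_sums_zero)
    thus ?thesis unfolding V_def True by (simp add: sums_iff)
  next
    case False
    then obtain z where "nome z = r" "Im z > 0" using nome_surj[OF False \<open>norm r < 1\<close>] by blast
    from has_sum_imp_sums[OF hs[OF this(2) this(1)[symmetric]]] show ?thesis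
      unfolding V_def by (simp add: sums_iff)
  qed
  thus "V holomorphic_on ball 0 1"
    by (intro power_series_holomorphic[where a = "\<lambda>n. a (int n + N)"]) auto
  show "f z = nome z powi N * V (nome z)" if "Im z > 0" for z
  proof -
    have "V (nome z) = f z / nome z powi N"
      using has_sum_imp_sums[OF hs[OF that refl]] unfolding V_def by (simp add: sums_iff)
    thus ?thesis by simp
  qed
qed

lemma weakly_holomorphic_S:
  assumes "weakly_holomorphic_modular_form k f" "Im z > 0"
  shows "f (-1/z) = z powi k * f z"
proof -
  have "f ((of_int 0 * z + of_int (-1)) / (of_int 1 * z + of_int 0)) = (of_int 1 * z + of_int 0) powi k * f z"
    using assms unfolding weakly_holomorphic_modular_form_def upper_half_plane_def
    by (metis (mono_tags, lifting) mem_Collect_eq mult_zero_left mult_minus1 diff_0 minus_minus mult_1)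
  thus ?thesis by simp
qed

text \<open>f/\<Delta>^(l+1) is holomorphic at the cusp and has weight k' - 12, which is 2 or
  negative but never 0. The two vanishing results cover both cases.\<close>

lemma weakly_holomorphic_eq_0:
  assumes k: "even k" and f: "\<And>z. Im z > 0 \<Longrightarrow> f (-1/z) = z powi k * f z"
    and exp: "has_q_expansion f a" and a: "\<And>n. n \<le> weight_ell k \<Longrightarrow> a n = 0" and z: "Im z > 0"
  shows "f z = 0"
proof -
  define l where "l = weight_ell k"
  obtain V where V: "V holomorphic_on ball 0 1" "\<And>z. Im z > 0 \<Longrightarrow> f z = nome z powi (l + 1) * V (nome z)"
    using has_q_expansion_holomorphic[OF exp, of "l + 1"] a unfolding l_def by auto
  define G where "G = (\<lambda>r. V r / (euler_prod r ^ 24) powi (l + 1))"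
  have G_hol: "G holomorphic_on ball 0 1" unfolding G_def
    by (intro holomorphic_intros V(1) euler_prod_holomorphic) (use euler_prod_nonzero in auto)
  have Gf: "G (nome z) = f z / delta_q (nome z) powi (l + 1)" if "Im z > 0" for z
    unfolding G_def V(2)[OF that] delta_q_def power_int_mult_distrib by simp
  obtain i j where ij: "i \<le> 2" "j \<le> 1" "k = 12 * l + 4 * int i + 6 * int j"
    using even_weight_decomp[OF k] unfolding l_def by blast
  define w where "w = k - 12 * (l + 1)"
  have inv: "G (nome (-1/z)) = z powi w * G (nome z)" if z: "Im z > 0" for z
  proof -
    have z0: "z \<noteq> 0" using z by auto
    have "(z ^ 12 * delta_q (nome z)) powi (l + 1) = z powi (12 * (l + 1)) * delta_q (nome z) powi (l + 1)"
      by (simp only: power_int_mult_distrib power_int_mult power_int_numeral)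
    hence "G (nome (-1/z)) = (z powi k / z powi (12 * (l + 1))) * (f z / delta_q (nome z) powi (l + 1))"
      unfolding Gf[OF Im_inversion_pos[OF z]] delta_q_inversion[OF z] f[OF z] by simp
    also have "z powi k / z powi (12 * (l + 1)) = z powi w"
      unfolding w_def using z0 by (simp add: power_int_diff)
    finally show ?thesis unfolding Gf[OF z] .
  qed
  have "G r = 0" if r: "norm r < 1" for r
  proof (cases "w > 0")
    case True
    have "i = 0 \<or> i = 1 \<or> i = 2" "j = 0 \<or> j = 1" using ij by auto
    hence "w = 2" using True ij(3) unfolding w_def by auto
    hence inv2: "\<And>z. Im z > 0 \<Longrightarrow> G (nome (-1/z)) = z ^ 2 * G (nome z)" using inv by simp
    show ?thesis by (rule weight_two_zero[OF G_hol inv2 r])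
  next
    case False
    define n where "n = nat (- w)"
    have "w \<noteq> 0" using ij unfolding w_def by presburger
    hence n: "n > 0" "w = - int n" using False by (auto simp: n_def)
    have inv2: "z ^ n * G (nome (-1/z)) = G (nome z)" if z: "Im z > 0" for z
    proof -
      have "z \<noteq> 0" using z by auto
      thus ?thesis unfolding inv[OF z] n(2) by (simp add: power_int_minus)
    qed
    show ?thesis by (rule negative_weight_zero[OF G_hol n(1) inv2 r])
  qed
  hence "f z / delta_q (nome z) powi (l + 1) = 0" using Gf[OF z] norm_nome_less_1[OF z] by metis
  moreover have "delta_q (nome z) \<noteq> 0" using norm_nome_less_1[OF z] by (simp add: delta_q_eq_0_iff)
  ultimately show ?thesis by simp
qed

definition is_basis_form :: "int \<Rightarrow> int \<Rightarrow> (complex \<Rightarrow> complex) \<Rightarrow> bool" where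
  "is_basis_form k m f \<longleftrightarrow>
     weakly_holomorphic_modular_form k f \<and>
     (\<exists>a. has_q_expansion f a \<and>
          (\<forall>n\<le>weight_ell k. a n = (if n = -m then 1 else 0))) \<and>
     (\<forall>z. z \<notin> upper_half_plane \<longrightarrow> f z = 0)"

lemma is_basis_form_unique:
  assumes k: "even k" and f: "is_basis_form k m f" and g: "is_basis_form k m g"
  shows "f = g"
proof
  fix z
  obtain a where a: "has_q_expansion f a" "\<forall>n\<le>weight_ell k. a n = (if n = -m then 1 else 0)"
    using f unfolding is_basis_form_def by blast
  obtain b where b: "has_q_expansion g b" "\<forall>n\<le>weight_ell k. b n = (if n = -m then 1 else 0)"
    using g unfolding is_basis_form_def by blast
  show "f z = g z"
  proof (cases "Im z > 0")
    case True
    have exp: "has_q_expansion (\<lambda>z. f z - g z) (\<lambda>n. a n - b n)"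
      unfolding has_q_expansion_def
    proof
      obtain N1 N2 where "\<forall>n<N1. a n = 0" "\<forall>n<N2. b n = 0"
        using a b unfolding has_q_expansion_def by blast
      thus "\<exists>N. \<forall>n<N. a n - b n = 0" by (intro exI[of _ "min N1 N2"]) auto
      show "\<forall>z\<in>upper_half_plane. ((\<lambda>n. (a n - b n) * nome z powi n) has_sum f z - g z) UNIV"
      proof
        fix z assume "z \<in> upper_half_plane"
        hence "((\<lambda>n. a n * nome z powi n) has_sum f z) UNIV" "((\<lambda>n. b n * nome z powi n) has_sum g z) UNIV"
          using a b unfolding has_q_expansion_def by auto
        from has_sum_add[OF this(1) has_sum_cmult_right[OF this(2), of "-1"]]
        show "((\<lambda>n. (a n - b n) * nome z powi n) has_sum f z - g z) UNIV"
          by (simp add: algebra_simps)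
      qed
    qed
    have "f z - g z = 0"
    proof (rule weakly_holomorphic_eq_0[OF k _ exp _ True])
      fix z :: complex assume "Im z > 0"
      thus "f (-1/z) - g (-1/z) = z powi k * (f z - g z)"
        using weakly_holomorphic_S f g unfolding is_basis_form_def by (simp only: right_diff_distrib)
    qed (use a b in auto)
    thus ?thesis by simp
  next
    case False
    thus ?thesis using f g unfolding is_basis_form_def upper_half_plane_def by auto
  qed
qed

lemma basis_form_eqI:
  assumes "even k" "is_basis_form k m f"
  shows "basis_form k m = f"
proof -
  have "basis_form k m = (THE f. is_basis_form k m f)"
    unfolding basis_form_def is_basis_form_def ..
  also have "\<dots> = f"
    by (rule the_equality) (use assms is_basis_form_unique in blast)+
  finally show ?thesis .
qed

section \<open>Existence of the basis\<close>

definition rj_q :: "complex \<Rightarrow> complex" where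
  "rj_q r = E4_q r ^ 3 / euler_prod r ^ 24"

lemma rj_q_holomorphic: "rj_q holomorphic_on ball 0 1"
  unfolding rj_q_def using euler_prod_nonzero
  by (intro holomorphic_intros E4_q_holomorphic euler_prod_holomorphic) auto

lemma rj_q_0 [simp]: "rj_q 0 = 1"
  by (simp add: rj_q_def)

lemma rj_q_eq: "r \<noteq> 0 \<Longrightarrow> rj_q r = r * j_q r"
  by (simp add: rj_q_def j_q_def delta_q_def)

text \<open>Coefficients are chosen one at a time. All products g h^(D - i) have value 1 at 0, so
  adding -V(0) times the next one removes the constant term of the remainder V and raises its order
  by one.\<close>

lemma triangular_solution:
  fixes g h :: "complex \<Rightarrow> complex"
  assumes g: "g holomorphic_on ball 0 1" "g 0 = 1" and h: "h holomorphic_on ball 0 1" "h 0 = 1"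
  shows "\<exists>c V. V holomorphic_on ball 0 1 \<and>
           (\<forall>r. g r * (\<Sum>i<n. c i * r ^ i * h r ^ (D - i)) = 1 + r ^ n * V r)"
proof (induction n)
  case 0
  show ?case by (intro exI[of _ "\<lambda>_. -1"]) auto
next
  case (Suc n)
  then obtain c V where V: "V holomorphic_on ball 0 1"
    and eq: "\<And>r. g r * (\<Sum>i<n. c i * r ^ i * h r ^ (D - i)) = 1 + r ^ n * V r" by blast
  define W where "W = (\<lambda>r. V r - V 0 * (g r * h r ^ (D - n)))"
  have "W holomorphic_on ball 0 1" "W 0 = 0"
    unfolding W_def by (auto intro!: holomorphic_intros V g h simp: g h)
  then obtain u where u: "u holomorphic_on ball 0 1" "\<And>r. W r = r * u r"
    using holomorphic_factor_0 by blast
  define c' where "c' = c(n := - V 0)"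
  have "g r * (\<Sum>i<Suc n. c' i * r ^ i * h r ^ (D - i)) = 1 + r ^ Suc n * u r" for r
  proof -
    have "g r * (\<Sum>i<Suc n. c' i * r ^ i * h r ^ (D - i)) =
        g r * (\<Sum>i<n. c i * r ^ i * h r ^ (D - i)) + g r * (- V 0 * r ^ n * h r ^ (D - n))"
      by (simp add: c'_def algebra_simps)
    also have "\<dots> = 1 + r ^ n * W r" unfolding eq W_def by (simp add: algebra_simps)
    finally show ?thesis unfolding u(2) by (simp add: mult_ac)
  qed
  thus ?case using u(1) by blast
qed

text \<open>The form is sought as \<Delta>^l times the Eisenstein factor times p(j). Multiplication
  by r^m removes all poles and leads to the triangular system, whose D + 1 unknowns with D = l + m
  are the coefficients of p.\<close>

lemma basis_polynomial:
  fixes l m :: int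
  assumes "l + m \<ge> 0"
  obtains p V where "V holomorphic_on ball 0 1"
    "\<And>r. norm r < 1 \<Longrightarrow> r \<noteq> 0 \<Longrightarrow>
       delta_q r powi l * eis_q a b r * poly p (j_q r) = r powi (-m) + r powi (l + 1) * V r"
proof -
  define D where "D = nat (l + m)"
  define g where "g = (\<lambda>r. (euler_prod r ^ 24) powi l * eis_q a b r)"
  have g_hol: "g holomorphic_on ball 0 1" unfolding g_def
    by (intro holomorphic_intros euler_prod_holomorphic eis_q_holomorphic) (use euler_prod_nonzero in auto)
  have g0: "g 0 = 1" by (simp add: g_def)
  obtain c V where V: "V holomorphic_on ball 0 1" and
    eq: "\<And>r. g r * (\<Sum>i<Suc D. c i * r ^ i * rj_q r ^ (D - i)) = 1 + r ^ Suc D * V r"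
    using triangular_solution[OF g_hol g0 rj_q_holomorphic rj_q_0, where n = "Suc D" and D = D] by blast
  define p where "p = (\<Sum>i<Suc D. monom (c i) (D - i))"
  show ?thesis
  proof (rule that[OF V])
    fix r :: complex assume r: "norm r < 1" "r \<noteq> 0"
    have "(\<Sum>i<Suc D. c i * r ^ i * rj_q r ^ (D - i)) = r ^ D * poly p (j_q r)"
      unfolding p_def poly_sum poly_monom sum_distrib_left
    proof (rule sum.cong[OF refl])
      fix i assume "i \<in> {..<Suc D}"
      hence "r ^ D = r ^ i * r ^ (D - i)" by (simp flip: power_add)
      thus "c i * r ^ i * rj_q r ^ (D - i) = r ^ D * (c i * j_q r ^ (D - i))"
        using r by (simp add: rj_q_eq power_mult_distrib mult_ac)
    qed
    hence *: "g r * (r ^ D * poly p (j_q r)) = 1 + r ^ Suc D * V r" using eq[of r] by simp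
    have rD: "r ^ D = r powi (l + m)" using assms unfolding D_def by (simp add: power_int_def)
    have "delta_q r powi l * eis_q a b r * poly p (j_q r) = r powi l * (g r * poly p (j_q r))"
      unfolding delta_q_def g_def power_int_mult_distrib by (simp add: mult_ac)
    also have "r powi l = r powi (-m) * r ^ D" unfolding rD using r by (simp flip: power_int_add)
    also have "r powi (-m) * r ^ D * (g r * poly p (j_q r)) = r powi (-m) * (1 + r ^ Suc D * V r)"
      unfolding *[symmetric] by (simp add: mult_ac)
    also have "\<dots> = r powi (-m) + (r powi (-m) * r ^ Suc D) * V r" by (simp add: algebra_simps)
    also have "r powi (-m) * r ^ Suc D = r powi (l + 1)"
      unfolding power_Suc rD using r by (simp flip: power_int_add power_int_add_1' add: mult.commute mult.left_commute)
    finally show "delta_q r powi l * eis_q a b r * poly p (j_q r) = r powi (-m) + r powi (l + 1) * V r" .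
  qed
qed

lemma holomorphic_nome_compose:
  assumes "g holomorphic_on ball 0 1 - {0}"
  shows "(\<lambda>z. g (nome z)) holomorphic_on {z. Im z > 0}"
proof -
  have "g \<circ> nome holomorphic_on {z. Im z > 0}"
    by (rule holomorphic_on_compose_gen[OF _ assms]) (auto intro!: nome_holomorphic norm_nome_less_1)
  thus ?thesis by (simp add: o_def)
qed

lemma basis_form_formula:
  assumes l: "weight_ell k = l" and k: "k = 12 * l + 4 * int a + 6 * int b" and m: "l + m \<ge> 0"
  obtains p V where "V holomorphic_on ball 0 1"
    "\<And>r. norm r < 1 \<Longrightarrow> r \<noteq> 0 \<Longrightarrow>
       delta_q r powi l * eis_q a b r * poly p (j_q r) = r powi (-m) + r powi (l + 1) * V r"
    "\<And>z. Im z > 0 \<Longrightarrow> basis_form k m z = delta_q (nome z) powi l * eis_q a b (nome z) * poly p (j_q (nome z))"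
    "is_basis_form k m (basis_form k m)"
proof -
  obtain p V where V: "V holomorphic_on ball 0 1" and pV: "\<And>r. norm r < 1 \<Longrightarrow> r \<noteq> 0 \<Longrightarrow>
       delta_q r powi l * eis_q a b r * poly p (j_q r) = r powi (-m) + r powi (l + 1) * V r"
    by (rule basis_polynomial[OF m, where a = a and b = b]) (rule that)
  have even: "even k" using k by simp
  define F where "F = (\<lambda>z. delta_q (nome z) powi l * eis_q a b (nome z) * poly p (j_q (nome z)))"
  define f where "f = (\<lambda>z. if Im z > 0 then F z else 0)"
  have F_hol: "F holomorphic_on {z. Im z > 0}"
  proof -
    have "(\<lambda>r. delta_q r powi l * eis_q a b r * poly p (j_q r)) holomorphic_on ball 0 1 - {0}"
      by (intro holomorphic_intros j_q_holomorphic
          holomorphic_on_subset[OF delta_q_holomorphic] holomorphic_on_subset[OF eis_q_holomorphic])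
         (auto simp: delta_q_eq_0_iff)
    from holomorphic_nome_compose[OF this] show ?thesis unfolding F_def .
  qed
  have f_hol: "f holomorphic_on upper_half_plane"
    unfolding upper_half_plane_def by (rule holomorphic_transform[OF F_hol]) (auto simp: f_def)
  have fT: "f (z + 1) = f z" for z by (simp add: f_def F_def nome_add)
  have fS: "f (-1/z) = z powi k * f z" if z: "Im z > 0" for z
  proof -
    have "(z ^ 12 * delta_q (nome z)) powi l = z powi (12 * l) * delta_q (nome z) powi l"
      by (simp only: power_int_mult_distrib power_int_mult power_int_numeral)
    moreover have "z powi k = z powi (12 * l) * z ^ (4 * a + 6 * b)"
    proof -
      have "z \<noteq> 0" using z by auto
      moreover have "k = 12 * l + int (4 * a + 6 * b)" using k by simp
      ultimately show ?thesis by (metis power_int_add power_int_of_nat)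
    qed
    ultimately have "F (-1/z) = z powi k * F z"
      unfolding F_def delta_q_inversion[OF z] eis_q_inversion[OF z] j_q_inversion[OF z] by (simp only: mult_ac)
    thus ?thesis using z Im_inversion_pos[OF z] by (simp add: f_def)
  qed
  obtain v where v: "\<And>z. Im z > 0 \<Longrightarrow>
    ((\<lambda>n. (if n \<ge> l + 1 then v (nat (n - (l + 1))) else 0) * nome z powi n) has_sum (nome z powi (l + 1) * V (nome z))) UNIV"
    using holomorphic_has_q_expansion[OF V] by blast
  define c where "c = (\<lambda>n. (if n = -m then 1 else 0) + (if n \<ge> l + 1 then v (nat (n - (l + 1))) else 0))"
  have exp: "has_q_expansion f c"
    unfolding has_q_expansion_def
  proof
    show "\<exists>N. \<forall>n<N. c n = 0"
      using m by (intro exI[of _ "-m"]) (auto simp: c_def)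
    show "\<forall>z\<in>upper_half_plane. ((\<lambda>n. c n * nome z powi n) has_sum f z) UNIV"
    proof
      fix z assume "z \<in> upper_half_plane"
      hence z: "Im z > 0" by (simp add: upper_half_plane_def)
      have "((\<lambda>n. (if n = -m then 1 else 0) * nome z powi n) has_sum (nome z powi (-m))) UNIV \<longleftrightarrow>
            ((\<lambda>n. nome z powi n) has_sum (nome z powi (-m))) {-m}"
        by (rule has_sum_cong_neutral) auto
      moreover have "((\<lambda>n. nome z powi n) has_sum (nome z powi (-m))) {-m}"
        using has_sum_finite[of "{-m}" "\<lambda>n. nome z powi n"] by simp
      ultimately have "((\<lambda>n. (if n = -m then 1 else 0) * nome z powi n) has_sum (nome z powi (-m))) UNIV" by blast
      from has_sum_add[OF this v[OF z]]
      have "((\<lambda>n. c n * nome z powi n) has_sum (nome z powi (-m) + nome z powi (l + 1) * V (nome z))) UNIV"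
        unfolding c_def ring_distribs .
      moreover have "f z = nome z powi (-m) + nome z powi (l + 1) * V (nome z)"
        using pV[of "nome z"] norm_nome_less_1[OF z] z by (simp add: f_def F_def)
      ultimately show "((\<lambda>n. c n * nome z powi n) has_sum f z) UNIV" by simp
    qed
  qed
  have "is_basis_form k m f"
    unfolding is_basis_form_def weakly_holomorphic_modular_form_def
  proof (intro conjI allI impI ballI)
    fix a b c d :: int and z assume det: "a * d - b * c = 1" and "z \<in> upper_half_plane"
    hence z: "Im z > 0" by (simp add: upper_half_plane_def)
    show "f ((of_int a * z + of_int b) / (of_int c * z + of_int d)) = (of_int c * z + of_int d) powi k * f z"
      using modular_SL2[of k f, OF even fT fS z det] unfolding moebius_int_def .
  next
    show "\<exists>a. has_q_expansion f a \<and> (\<forall>n\<le>weight_ell k. a n = (if n = - m then 1 else 0))"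
      using exp unfolding l by (intro exI[of _ c]) (auto simp: c_def)
  qed (use exp f_hol in \<open>auto simp: f_def upper_half_plane_def\<close>)
  moreover from basis_form_eqI[OF even this] have "basis_form k m = f" .
  ultimately show ?thesis using that[OF V pV] by (auto simp: f_def F_def)
qed

lemma nome_cnj: "nome (- cnj z) = cnj (nome z)"
  by (simp add: nome_def exp_cnj)

text \<open>Conjugating the coefficients preserves the defining expansion, so by uniqueness they are
  real. This is the source of real values on the arc.\<close>

lemma basis_form_cnj:
  assumes k: "even k" and f: "is_basis_form k m (basis_form k m)"
  shows "basis_form k m (- cnj z) = cnj (basis_form k m z)"
proof -
  define f where "f = basis_form k m"
  define g where "g = (\<lambda>z. cnj (f (- cnj z)))"
  have ff: "is_basis_form k m f" using f by (simp add: f_def)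
  have uhp: "- cnj z \<in> upper_half_plane \<longleftrightarrow> z \<in> upper_half_plane" for z
    by (simp add: upper_half_plane_def)
  have "is_basis_form k m g"
    unfolding is_basis_form_def weakly_holomorphic_modular_form_def
  proof (intro conjI allI impI ballI)
    have "cnj \<circ> (\<lambda>w. f (- w)) \<circ> cnj holomorphic_on upper_half_plane"
    proof (rule holomorphic_on_compose_cnj_cnj)
      have "f \<circ> uminus holomorphic_on cnj ` upper_half_plane"
        by (rule holomorphic_on_compose_gen[where t = upper_half_plane])
           (use ff in \<open>auto intro!: holomorphic_intros simp: is_basis_form_def weakly_holomorphic_modular_form_def upper_half_plane_def\<close>)
      thus "(\<lambda>w. f (- w)) holomorphic_on cnj ` upper_half_plane" by (simp add: o_def)
      show "open upper_half_plane" unfolding upper_half_plane_def by (rule open_Im_pos)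
    qed
    thus "g holomorphic_on upper_half_plane" by (simp add: g_def o_def)
  next
    fix a b c d :: int and z assume det: "a * d - b * c = 1" and z: "z \<in> upper_half_plane"
    have "(of_int a * (- cnj z) + of_int (-b)) / (of_int (-c) * (- cnj z) + of_int d)
        = (- cnj (of_int a * z + of_int b)) / cnj (of_int c * z + of_int d)"
      by simp
    also have "\<dots> = - cnj ((of_int a * z + of_int b) / (of_int c * z + of_int d))"
      by (simp only: complex_cnj_divide minus_divide_left)
    finally have "(of_int a * (- cnj z) + of_int (-b)) / (of_int (-c) * (- cnj z) + of_int d)
        = - cnj ((of_int a * z + of_int b) / (of_int c * z + of_int d))" .
    moreover have "f ((of_int a * (- cnj z) + of_int (-b)) / (of_int (-c) * (- cnj z) + of_int d))
        = (of_int (-c) * (- cnj z) + of_int d) powi k * f (- cnj z)"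
    proof -
      have "a * d - (-b) * (-c) = 1" using det by simp
      thus ?thesis using ff uhp[of z] z unfolding is_basis_form_def weakly_holomorphic_modular_form_def by blast
    qed
    ultimately show "g ((of_int a * z + of_int b) / (of_int c * z + of_int d)) = (of_int c * z + of_int d) powi k * g z"
      unfolding g_def by simp
  next
    obtain a where a: "has_q_expansion f a" "\<forall>n\<le>weight_ell k. a n = (if n = - m then 1 else 0)"
      using ff unfolding is_basis_form_def by blast
    have *: "has_q_expansion g (\<lambda>n. cnj (a n))"
      unfolding has_q_expansion_def
    proof
      show "\<exists>N. \<forall>n<N. cnj (a n) = 0" using a unfolding has_q_expansion_def by auto
      show "\<forall>z\<in>upper_half_plane. ((\<lambda>n. cnj (a n) * nome z powi n) has_sum g z) UNIV"
      proof
        fix z assume "z \<in> upper_half_plane"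
        hence "((\<lambda>n. a n * nome (- cnj z) powi n) has_sum f (- cnj z)) UNIV"
          using a uhp[of z] unfolding has_q_expansion_def by blast
        hence "((\<lambda>n. cnj (a n * nome (- cnj z) powi n)) has_sum cnj (f (- cnj z))) UNIV"
          by (rule has_sum_cnj_iff[THEN iffD2])
        thus "((\<lambda>n. cnj (a n) * nome z powi n) has_sum g z) UNIV"
          by (simp add: g_def nome_cnj)
      qed
    qed
    show "\<exists>a. has_q_expansion g a" using * by blast
    show "\<exists>a. has_q_expansion g a \<and> (\<forall>n\<le>weight_ell k. a n = (if n = - m then 1 else 0))"
      using * a(2) by (intro exI[of _ "\<lambda>n. cnj (a n)"]) auto
  next
    fix z assume "z \<notin> upper_half_plane"
    thus "g z = 0" using ff uhp[of z] unfolding is_basis_form_def g_def by auto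
  qed
  hence "f = g" using is_basis_form_unique[OF k ff] by blast
  hence "cnj (f z) = cnj (g z)" by simp
  thus ?thesis by (simp add: g_def f_def)
qed

section \<open>The generating function integral\<close>

lemma eis_q_mult_complement:
  assumes "a \<le> 2" "b \<le> 1"
  shows "eis_q a b r * eis_q (2 - a) (1 - b) r = E4_q r ^ 2 * E6_q r"
proof -
  have "E4_q r ^ a * E4_q r ^ (2 - a) = E4_q r ^ 2" "E6_q r ^ b * E6_q r ^ (1 - b) = E6_q r"
    using assms by (simp_all flip: power_add)
  thus ?thesis unfolding eis_q_def by (metis mult.assoc mult.left_commute)
qed

text \<open>E4^3 = j \<Delta> and E6^2 = (j - 1728) \<Delta>, so the vanishing of either depends on
  j alone. Consequently all poles of the kernel are simple as soon as z is not critical.\<close>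

lemma noncritical_j_q:
  assumes "norm r < 1" "r \<noteq> 0" "norm s < 1" "s \<noteq> 0" "j_q r = j_q s" "E4_q s \<noteq> 0" "E6_q s \<noteq> 0"
  shows "E4_q r \<noteq> 0" "E6_q r \<noteq> 0"
proof -
  have d: "delta_q r \<noteq> 0" "delta_q s \<noteq> 0" using assms delta_q_eq_0_iff by auto
  have "E4_q r ^ 3 * delta_q s = E4_q s ^ 3 * delta_q r"
    using assms(5) d by (simp add: j_q_def field_simps)
  thus "E4_q r \<noteq> 0" using assms(6) d by auto
  have "E6_q x ^ 2 = (j_q x - 1728) * delta_q x" if "norm x < 1" "delta_q x \<noteq> 0" for x
  proof -
    have "(j_q x - 1728) * delta_q x = E4_q x ^ 3 - 1728 * delta_q x"
      using that(2) by (simp add: j_q_def left_diff_distrib)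
    thus ?thesis using E4_E6_delta[OF that(1)] by (simp add: algebra_simps)
  qed
  hence "E6_q r ^ 2 * delta_q s = E6_q s ^ 2 * delta_q r"
    using assms(1,3,5) d by (simp add: mult_ac)
  thus "E6_q r \<noteq> 0" using assms(7) d by auto
qed

lemma circle_integral_simple_poles:
  assumes N: "N holomorphic_on ball 0 1" and g: "g holomorphic_on ball 0 1"
    and R: "0 < R" "R < 1" and circ: "\<And>r. norm r = R \<Longrightarrow> g r \<noteq> 0"
    and nz: "\<And>r. norm r < R \<Longrightarrow> g r = 0 \<Longrightarrow> N r \<noteq> 0 \<and> deriv g r \<noteq> 0"
  shows "finite {r. norm r < R \<and> g r = 0}"
    and "((\<lambda>r. N r / g r) has_contour_integral
           2 * of_real pi * \<i> * (\<Sum>r | norm r < R \<and> g r = 0. N r / deriv g r)) (circlepath 0 R)"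
proof -
  define R' where "R' = (1 + R) / 2"
  have R': "R < R'" "R' < 1" using R by (auto simp: R'_def)
  define Z where "Z = {r. norm r < R \<and> g r = 0}"
  define O' where "O' = {r \<in> cball 0 R'. g r = 0}"
  have fin: "finite O'"
  proof (cases "g constant_on ball 0 1")
    case True
    then obtain c where c: "\<And>r. norm r < 1 \<Longrightarrow> g r = c" by (auto simp: constant_on_def)
    have "c \<noteq> 0" using circ[of "of_real R"] c[of "of_real R"] R by auto
    hence "O' = {}" using c R' by (auto simp: O'_def)
    thus ?thesis by simp
  next
    case False
    show ?thesis unfolding O'_def
      by (rule holomorphic_compact_finite_zeros[OF g open_ball connected_ball compact_cball _ False]) (use R' in auto)
  qed
  have "Z \<subseteq> O'" using R' by (auto simp: Z_def O'_def)
  thus finZ: "finite {r. norm r < R \<and> g r = 0}" using fin finite_subset unfolding Z_def by blast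
  \<comment> \<open>Zeros of g in the closed disc of radius R' that the circle does not enclose are
    deleted, so that the only singularities left in S are those in Z.\<close>
  define S where "S = ball 0 R' - (O' - Z)"
  have openS: "open S" unfolding S_def using fin by (intro open_Diff finite_imp_closed) auto
  have connS: "connected S" unfolding S_def
    by (rule connected_open_delete_finite) (use fin in auto)
  have sub: "S \<subseteq> ball 0 1" using R' by (auto simp: S_def)
  have hol: "(\<lambda>r. N r / g r) holomorphic_on S - Z"
    by (intro holomorphic_intros holomorphic_on_subset[OF N] holomorphic_on_subset[OF g])
       (use sub in \<open>auto simp: S_def O'_def Z_def\<close>)
  have pim: "path_image (circlepath 0 R) \<subseteq> S - Z"
    using R R' circ by (auto simp: path_image_circlepath S_def Z_def O'_def sphere_def)
  have wind0: "winding_number (circlepath 0 R) z = 0" if "z \<notin> S" for z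
  proof (rule winding_number_zero_outside[where s = "cball 0 R"])
    show "z \<notin> cball 0 R"
      using that R' circ[of z] unfolding S_def O'_def Z_def by (auto simp: less_le)
  qed (use R in \<open>auto simp: path_image_circlepath\<close>)
  have "contour_integral (circlepath 0 R) (\<lambda>r. N r / g r) =
      2 * pi * \<i> * (\<Sum>p\<in>Z. winding_number (circlepath 0 R) p * residue (\<lambda>r. N r / g r) p)"
    by (rule Residue_theorem[OF openS connS _ hol _ _ pim]) (use finZ wind0 in \<open>auto simp: Z_def\<close>)
  also have "(\<Sum>p\<in>Z. winding_number (circlepath 0 R) p * residue (\<lambda>r. N r / g r) p) = (\<Sum>p\<in>Z. N p / deriv g p)"
  proof (rule sum.cong[OF refl])
    fix p assume p: "p \<in> Z"
    have p1: "norm p < 1" using p R by (simp add: Z_def)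
    have "winding_number (circlepath 0 R) p = 1"
      by (rule winding_number_circlepath) (use p in \<open>simp add: Z_def\<close>)
    moreover have "residue (\<lambda>r. N r / g r) p = N p / deriv g p"
      by (rule residue_simple_pole_deriv[OF N g open_ball connected_ball _ holomorphic_ball_DERIV[OF g p1]])
         (use p p1 nz in \<open>auto simp: Z_def\<close>)
    ultimately show "winding_number (circlepath 0 R) p * residue (\<lambda>r. N r / g r) p = N p / deriv g p" by simp
  qed
  finally have "contour_integral (circlepath 0 R) (\<lambda>r. N r / g r) = 2 * pi * \<i> * (\<Sum>p\<in>Z. N p / deriv g p)" .
  moreover have "(\<lambda>r. N r / g r) contour_integrable_on circlepath 0 R"
  proof (rule contour_integrable_holomorphic_simple[OF hol _ _ pim])
    show "open (S - Z)" using openS finZ unfolding Z_def by (intro open_Diff finite_imp_closed) auto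
  qed auto
  ultimately show "((\<lambda>r. N r / g r) has_contour_integral
           2 * of_real pi * \<i> * (\<Sum>r | norm r < R \<and> g r = 0. N r / deriv g r)) (circlepath 0 R)"
    using has_contour_integral_integral unfolding Z_def by fastforce
qed

text \<open>No sum over m is formed. Inserting the expansion of the form into the kernel gives K =
  -S(j) j' + p(x)/r - N/g, where x = j(z) and S(y) is the quotient of p(y) - p(x) by y - x. The
  first term is a derivative, the second integrates to 2\<pi>i p(x), and the last contributes
  r^(-m)/\<Phi>(r) for each solution of j(r) = x inside the circle.\<close>

theorem basis_form_integral:
  assumes l: "weight_ell k = l" and k: "k = 12 * l + 4 * int a + 6 * int b" and ab: "a \<le> 2" "b \<le> 1"
    and m: "l + m \<ge> 0" and z: "Im z > 0"
    and crit: "E4_q (nome z) \<noteq> 0" "E6_q (nome z) \<noteq> 0"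
    and R: "0 < R" "R < 1" and circ: "\<And>r. norm r = R \<Longrightarrow> j_q r \<noteq> j_q (nome z)"
  defines "\<Phi> \<equiv> (\<lambda>r. delta_q r powi l * eis_q a b r)"
  defines "K \<equiv> (\<lambda>r. eis_q (2 - a) (1 - b) r * delta_q r powi (- l - 1) * r powi (- m - 1) / (j_q r - j_q (nome z)))"
  shows "K contour_integrable_on circlepath 0 R"
    and "basis_form k m z = \<Phi> (nome z) / (2 * of_real pi * \<i>) * contour_integral (circlepath 0 R) K
       + (\<Sum>r | r \<noteq> 0 \<and> norm r < R \<and> j_q r = j_q (nome z). \<Phi> (nome z) / \<Phi> r * r powi (-m))"
proof -
  obtain p V where V: "V holomorphic_on ball 0 1" and
    pV: "\<And>r. norm r < 1 \<Longrightarrow> r \<noteq> 0 \<Longrightarrow>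
       delta_q r powi l * eis_q a b r * poly p (j_q r) = r powi (-m) + r powi (l + 1) * V r" and
    f: "\<And>z. Im z > 0 \<Longrightarrow> basis_form k m z = delta_q (nome z) powi l * eis_q a b (nome z) * poly p (j_q (nome z))"
    by (rule basis_form_formula[OF l k m]) (rule that)
  define x where "x = j_q (nome z)"
  define P where "P = (\<lambda>r. euler_prod r ^ 24)"
  define B where "B = eis_q (2 - a) (1 - b)"
  define A where "A = eis_q a b"
  define g where "g = (\<lambda>r. rj_q r - x * r)"
  \<comment> \<open>The logarithmic derivative of g = r (j - x) is 1/r + j'/(j - x), which is how
    p(x) g' enters; the second summand comes from the tail of the expansion. At a zero of g, N is
    minus the numerator of the kernel, up to a factor r.\<close>
  define N where "N = (\<lambda>r. poly p x * deriv g r + V r * B r * P r powi (- l - 1))"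
  have AB: "A r * B r = E4_q r ^ 2 * E6_q r" for r
    unfolding A_def B_def by (rule eis_q_mult_complement[OF ab])
  have g_hol: "g holomorphic_on ball 0 1"
    unfolding g_def by (intro holomorphic_intros rj_q_holomorphic)
  have N_hol: "N holomorphic_on ball 0 1"
    unfolding N_def P_def B_def
    by (intro holomorphic_intros V eis_q_holomorphic euler_prod_holomorphic g_hol)
       (use euler_prod_nonzero in auto)
  have g_eq: "g r = r * (j_q r - x)" if "r \<noteq> 0" for r
    using that by (simp add: g_def rj_q_eq algebra_simps)
  define j' where "j' = (\<lambda>r. - (A r * B r / (delta_q r * r)))"
  have j': "(j_q has_field_derivative j' r) (at r)" if "norm r < 1" "r \<noteq> 0" for r
    using qderiv_j_q[OF that] by (simp add: j'_def AB)
  have dg: "deriv g r = (j_q r - x) + r * j' r" if r: "norm r < 1" "r \<noteq> 0" for r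
  proof (rule DERIV_imp_deriv)
    have "((\<lambda>r. r * (j_q r - x)) has_field_derivative (j_q r - x) + r * j' r) (at r)"
      by (auto intro!: derivative_eq_intros j' r)
    thus "(g has_field_derivative (j_q r - x) + r * j' r) (at r)"
      by (rule has_field_derivative_transform_within_open[where S = "- {0}"]) (use r g_eq in auto)
  qed
  have Pr: "P r powi (- l - 1) = r powi (l + 1) * delta_q r powi (- l - 1)" if "r \<noteq> 0" for r
  proof -
    have "delta_q r powi (- l - 1) = r powi (- l - 1) * P r powi (- l - 1)"
      by (simp only: delta_q_def P_def power_int_mult_distrib)
    moreover have "r powi (l + 1) * r powi (- l - 1) = 1"
      using that by (subst power_int_add[symmetric]) auto
    ultimately show ?thesis by (metis mult.assoc mult_1)
  qed
  have dd: "delta_q r powi (- l - 1) * delta_q r powi l = 1 / delta_q r" if "norm r < 1" "r \<noteq> 0" for r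
  proof -
    have "delta_q r \<noteq> 0" using that delta_q_eq_0_iff by blast
    thus ?thesis by (subst power_int_add[symmetric]) (auto simp: power_int_minus divide_inverse)
  qed
  have rm: "r powi (-m) = delta_q r powi l * A r * poly p (j_q r) - r powi (l + 1) * V r"
    if "norm r < 1" "r \<noteq> 0" for r using pV[OF that] by (simp add: A_def)
  have key: "B r * delta_q r powi (- l - 1) * r powi (-m) =
      A r * B r / delta_q r * poly p (j_q r) - V r * B r * P r powi (- l - 1)" if r: "norm r < 1" "r \<noteq> 0" for r
  proof -
    have "B r * delta_q r powi (- l - 1) * r powi (-m) =
       A r * B r * (delta_q r powi (- l - 1) * delta_q r powi l) * poly p (j_q r)
         - V r * B r * (r powi (l + 1) * delta_q r powi (- l - 1))"
      unfolding rm[OF r] by (simp add: algebra_simps)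
    thus ?thesis unfolding dd[OF r] Pr[OF r(2), symmetric] by simp
  qed
  define Z where "Z = {r. norm r < R \<and> g r = 0}"
  have g0: "g 0 = 1" by (simp add: g_def)
  have Z_eq: "Z = {r. r \<noteq> 0 \<and> norm r < R \<and> j_q r = x}"
    using g0 g_eq unfolding Z_def by (metis (no_types, lifting) eq_iff_diff_eq_0 mult_eq_0_iff zero_neq_one)
  have nz: "nome z \<noteq> 0" "norm (nome z) < 1" using norm_nome_less_1[OF z] by auto
  have at_Z: "N r = - (B r * delta_q r powi (- l - 1) * r powi (-m))" "deriv g r = - (A r * B r / delta_q r)"
    "A r \<noteq> 0" "B r \<noteq> 0" "delta_q r \<noteq> 0" "r \<noteq> 0" if "r \<in> Z" for r
  proof -
    have r: "r \<noteq> 0" "norm r < R" "j_q r = x" using that unfolding Z_eq by auto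
    have r1: "norm r < 1" using r R by simp
    show d: "delta_q r \<noteq> 0" using r1 r delta_q_eq_0_iff by blast
    show dg': "deriv g r = - (A r * B r / delta_q r)"
      unfolding dg[OF r1 r(1)] j'_def using r by simp
    show "N r = - (B r * delta_q r powi (- l - 1) * r powi (-m))"
      unfolding N_def dg' key[OF r1 r(1)] r(3) by simp
    note nc = noncritical_j_q[OF r1 r(1) nz(2,1) r(3)[unfolded x_def] crit]
    show "A r \<noteq> 0" "B r \<noteq> 0" unfolding A_def B_def eis_q_def using nc by auto
    show "r \<noteq> 0" by fact
  qed
  note poles = circle_integral_simple_poles[OF N_hol g_hol R]
  have circ': "g r \<noteq> 0" if "norm r = R" for r
    using circ[OF that] that R g_eq[of r] unfolding x_def by auto
  have nzZ: "N r \<noteq> 0 \<and> deriv g r \<noteq> 0" if "norm r < R" "g r = 0" for r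
    using at_Z[of r] that unfolding Z_def by auto
  have I1: "((\<lambda>r. N r / g r) has_contour_integral
           2 * of_real pi * \<i> * (\<Sum>r\<in>Z. N r / deriv g r)) (circlepath 0 R)"
    unfolding Z_def by (rule poles(2)) (use circ' nzZ in auto)
  have I2: "((\<lambda>r. poly p x / (r - 0)) has_contour_integral 2 * of_real pi * \<i> * poly p x) (circlepath 0 R)"
    by (rule Cauchy_integral_circlepath_simple) (use R in auto)
  define S where "S = synthetic_div p x"
  have pS: "poly p y = (y - x) * poly S y + poly p x" for y
  proof -
    have "poly p y = poly ([:-x, 1:] * S + [:poly p x:]) y"
      unfolding S_def synthetic_div_correct' ..
    thus ?thesis by (simp add: algebra_simps)
  qed
  have "(\<lambda>y. poly S y) holomorphic_on UNIV" by (intro holomorphic_intros)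
  then obtain T where T: "\<And>y. (T has_field_derivative poly S y) (at y)"
    using holomorphic_convex_primitive'[where f = "\<lambda>y. poly S y" and S = UNIV] by auto
  have I3: "((\<lambda>r. poly S (j_q r) * j' r) has_contour_integral
      T (j_q (pathfinish (circlepath 0 R))) - T (j_q (pathstart (circlepath 0 R)))) (circlepath 0 R)"
  proof (rule contour_integral_primitive[where S = "ball 0 1 - {0}" and f = "\<lambda>r. T (j_q r)"])
    fix r :: complex assume "r \<in> ball 0 1 - {0}"
    hence r: "norm r < 1" "r \<noteq> 0" by auto
    show "((\<lambda>r. T (j_q r)) has_field_derivative poly S (j_q r) * j' r) (at r within ball 0 1 - {0})"
      by (rule has_field_derivative_at_within[OF DERIV_chain'[OF j'[OF r] T]])
  qed (use R in \<open>auto simp: path_image_circlepath\<close>)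
  have KK: "K r = - (poly S (j_q r) * j' r) + poly p x / (r - 0) - N r / g r"
    if "r \<in> path_image (circlepath 0 R)" for r
  proof -
    have nr: "norm r = R" using that R by (simp add: path_image_circlepath)
    have r: "norm r < 1" "r \<noteq> 0" using nr R by auto
    have jx: "j_q r - x \<noteq> 0" using circ[OF nr] by (simp add: x_def)
    have rd: "r powi (- m - 1) = r powi (-m) / r"
      using r(2) by (simp add: power_int_diff)
    have "K r = (B r * delta_q r powi (- l - 1) * r powi (-m)) / (r * (j_q r - x))"
      unfolding K_def x_def[symmetric] B_def[symmetric] rd by simp
    also have "\<dots> = (A r * B r / (delta_q r * r) * poly p (j_q r) * r - V r * B r * P r powi (- l - 1)) / (r * (j_q r - x))"
      unfolding key[OF r] using r(2) by simp
    also have "A r * B r / (delta_q r * r) = - j' r" by (simp add: j'_def)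
    also have "(- j' r * poly p (j_q r) * r - V r * B r * P r powi (- l - 1)) / (r * (j_q r - x))
       = - (poly S (j_q r) * j' r) + poly p x / r - (poly p x * ((j_q r - x) + r * j' r) + V r * B r * P r powi (- l - 1)) / (r * (j_q r - x))"
      unfolding pS[of "j_q r"] using jx r(2) by (simp add: field_simps)
    finally show ?thesis unfolding N_def dg[OF r] g_eq[OF r(2)] by simp
  qed
  have "((\<lambda>r. - (poly S (j_q r) * j' r) + poly p x / (r - 0) - N r / g r) has_contour_integral
     - (T (j_q (pathfinish (circlepath 0 R))) - T (j_q (pathstart (circlepath 0 R))))
     + 2 * of_real pi * \<i> * poly p x - 2 * of_real pi * \<i> * (\<Sum>r\<in>Z. N r / deriv g r)) (circlepath 0 R)"
    by (intro has_contour_integral_diff has_contour_integral_add has_contour_integral_neg I1 I2 I3)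
  from has_contour_integral_eq[OF this] KK[symmetric]
  have KI: "(K has_contour_integral
     2 * of_real pi * \<i> * poly p x - 2 * of_real pi * \<i> * (\<Sum>r\<in>Z. N r / deriv g r)) (circlepath 0 R)"
    by simp
  thus "K contour_integrable_on circlepath 0 R" by (rule has_contour_integral_integrable)
  have "contour_integral (circlepath 0 R) K = 2 * of_real pi * \<i> * (poly p x - (\<Sum>r\<in>Z. N r / deriv g r))"
    using contour_integral_unique[OF KI] by (simp add: right_diff_distrib)
  moreover have "N r / deriv g r = r powi (-m) / \<Phi> r" if "r \<in> Z" for r
  proof -
    have "delta_q r powi (- l - 1) = 1 / (delta_q r * delta_q r powi l)"
      using at_Z(5)[OF that] by (simp add: power_int_diff power_int_minus field_simps)
    thus ?thesis using at_Z[OF that] unfolding at_Z(1,2)[OF that] \<Phi>_def A_def[symmetric]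
      by (simp add: field_simps)
  qed
  ultimately have "poly p x = contour_integral (circlepath 0 R) K / (2 * of_real pi * \<i>) + (\<Sum>r\<in>Z. r powi (-m) / \<Phi> r)"
    by simp
  hence "basis_form k m z = \<Phi> (nome z) * (contour_integral (circlepath 0 R) K / (2 * of_real pi * \<i>) + (\<Sum>r\<in>Z. r powi (-m) / \<Phi> r))"
    using f[OF z] unfolding \<Phi>_def x_def by simp
  thus "basis_form k m z = \<Phi> (nome z) / (2 * of_real pi * \<i>) * contour_integral (circlepath 0 R) K
       + (\<Sum>r | r \<noteq> 0 \<and> norm r < R \<and> j_q r = j_q (nome z). \<Phi> (nome z) / \<Phi> r * r powi (-m))"
    unfolding Z_eq x_def[symmetric] by (simp add: distrib_left sum_distrib_left)
qed

section \<open>Points of large height equivalent to a point of the arc\<close>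

lemma norm_prod_eq: "norm (\<Prod>n<N. f n :: complex) = (\<Prod>n<N. norm (f n))" for N :: nat
  by (simp add: prod_norm)

lemma sum_geometric_le:
  fixes x :: real assumes "0 \<le> x" "x < 1"
  shows "(\<Sum>n<N. x ^ Suc n) \<le> x / (1 - x)"
proof -
  have "(\<Sum>n<N. x ^ n) \<le> (\<Sum>n. x ^ n)"
    by (rule sum_le_suminf) (use assms in \<open>auto intro: summable_geometric\<close>)
  also have "\<dots> = 1 / (1 - x)" by (rule suminf_geometric) (use assms in auto)
  finally have "x * (\<Sum>n<N. x ^ n) \<le> x * (1 / (1 - x))" using assms by (intro mult_left_mono) auto
  thus ?thesis by (simp add: sum_distrib_left)
qed

text \<open>Weierstrass' product inequality from below and 1 + t \<le> exp t from above, for the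
  partial products and then in the limit.\<close>

lemma norm_euler_prod_bounds:
  assumes "norm r \<le> x" "x < 1"
  shows "norm (euler_prod r) \<ge> 1 - x / (1 - x)" "norm (euler_prod r) \<le> exp (x / (1 - x))"
proof -
  have x0: "0 \<le> x" using norm_ge_zero assms(1) by (rule order_trans)
  have r1: "norm r < 1" using assms by simp
  have lim: "(\<lambda>N. norm (\<Prod>n<N. 1 - r * r ^ n)) \<longlonglongrightarrow> norm (euler_prod r)"
    unfolding euler_prod_def by (intro tendsto_norm qpoch_tendsto r1)
  have pow: "norm (r * r ^ n) \<le> x ^ Suc n" for n
    unfolding power_Suc[symmetric] norm_power using assms by (intro power_mono) auto
  have "1 - x / (1 - x) \<le> norm (\<Prod>n<N. 1 - r * r ^ n)" for N
  proof -
    have "1 - x / (1 - x) \<le> 1 - (\<Sum>n<N. x ^ Suc n)"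
      using sum_geometric_le[OF x0 assms(2), of N] by simp
    also have "\<dots> \<le> (\<Prod>n<N. 1 - x ^ Suc n)"
    proof (rule Weierstrass_prod_ineq)
      fix n show "x ^ Suc n \<in> {0..1}"
        using x0 assms(2) power_le_one[of x "Suc n"] zero_le_power[of x "Suc n"] by simp
    qed
    also have "\<dots> \<le> (\<Prod>n<N. norm (1 - r * r ^ n))"
    proof (rule prod_mono, safe)
      fix n
      show "0 \<le> 1 - x ^ Suc n" using x0 assms(2) power_le_one[of x "Suc n"] by simp
      show "1 - x ^ Suc n \<le> norm (1 - r * r ^ n)"
        using norm_triangle_ineq2[of 1 "r * r ^ n"] pow[of n] by simp
    qed
    finally show ?thesis by (simp add: norm_prod_eq)
  qed
  thus "norm (euler_prod r) \<ge> 1 - x / (1 - x)" using LIMSEQ_le_const[OF lim] by blast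
  have "norm (\<Prod>n<N. 1 - r * r ^ n) \<le> exp (x / (1 - x))" for N
  proof -
    have "(\<Prod>n<N. norm (1 - r * r ^ n)) \<le> (\<Prod>n<N. 1 + x ^ Suc n)"
    proof (rule prod_mono, safe)
      fix n
      show "norm (1 - r * r ^ n) \<le> 1 + x ^ Suc n"
        using norm_triangle_ineq4[of 1 "r * r ^ n"] pow[of n] by simp
    qed auto
    also have "\<dots> \<le> exp (\<Sum>n<N. x ^ Suc n)"
      by (rule prod_le_exp_sum) (use x0 in auto)
    also have "\<dots> \<le> exp (x / (1 - x))" using sum_geometric_le[OF x0 assms(2), of N] by simp
    finally show ?thesis by (simp add: norm_prod_eq)
  qed
  thus "norm (euler_prod r) \<le> exp (x / (1 - x))" using LIMSEQ_le_const2[OF lim] by blast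
qed

text \<open>The quadratic Taylor bound at an eighth of the argument, raised to the eighth power,
  gives rational lower bounds sharp enough to compare the discriminants.\<close>

lemma exp_ge_power8:
  fixes x y :: real
  assumes "8 * y \<le> x" "0 \<le> y"
  shows "(1 + y + y\<^sup>2 / 2) ^ 8 \<le> exp x"
proof -
  have "(1 + y + y\<^sup>2 / 2) ^ 8 \<le> exp y ^ 8"
    by (rule power_mono[OF exp_lower_Taylor_quadratic[OF assms(2)]]) (use assms in simp)
  also have "\<dots> = exp (8 * y)" by (simp add: exp_of_nat_mult[symmetric])
  also have "\<dots> \<le> exp x" using assms by simp
  finally show ?thesis .
qed

lemma sqrt_3_bounds: "1732/1000 \<le> sqrt 3" "sqrt 3 \<le> 2"
proof -
  show "1732/1000 \<le> sqrt 3" by (rule real_le_rsqrt) (simp add: power2_eq_square)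
  show "sqrt 3 \<le> 2" by (rule real_le_lsqrt) (simp_all add: power2_eq_square)
qed

lemma pi_sqrt_3_lower: "5438/1000 \<le> pi * sqrt 3"
proof -
  have "(314/100) * (1732/1000) \<le> pi * sqrt 3"
    using pi_approx sqrt_3_bounds by (intro mult_mono) auto
  thus ?thesis by simp
qed

text \<open>The Euler product is close to 1 at q, so |\<Delta>(q)| is at most 175/151 times x0. At r
  it costs a factor 1 - 24/38 or 1 - 24/68, while x1 is at least 4 or 2 times x0. The resulting
  56/38 and 88/68 both exceed 175/151.\<close>

lemma delta_q_comparison:
  assumes q: "norm q \<le> exp (- pi * sqrt 3)" and y: "y = 3/5 \<or> y = (7/10::real)"
    and r: "norm r = exp (- 2 * pi * y)"
  shows "norm (delta_q q) < norm (delta_q r)"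
proof -
  define x0 where "x0 = exp (- pi * sqrt 3)"
  define x1 where "x1 = exp (- 2 * pi * y)"
  have x0p: "x0 > 0" by (simp add: x0_def)
  \<comment> \<open>679/1000 is just below an eighth of 5438/1000, the lower bound for \<pi> sqrt
    3.\<close>
  have "176 \<le> (1 + 679/1000 + (679/1000)\<^sup>2 / 2 :: real) ^ 8" by (simp add: power_divide power2_eq_square)
  also have "\<dots> \<le> exp (pi * sqrt 3)" using pi_sqrt_3_lower by (intro exp_ge_power8) auto
  finally have x0: "x0 \<le> 1 / 176" unfolding x0_def by (simp add: exp_minus field_simps)
  have "x0 / (1 - x0) \<le> (1/176) / (1 - 1/176)" using x0 x0p by (intro frac_le) auto
  hence u: "x0 / (1 - x0) \<le> 1/175" by simp
  have "norm (delta_q q) \<le> x0 * exp (x0 / (1 - x0)) ^ 24"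
    unfolding delta_q_def norm_mult norm_power using q norm_euler_prod_bounds(2)[of q x0] x0 x0p
    by (intro mult_mono power_mono) (auto simp: x0_def)
  also have "\<dots> \<le> x0 * exp (1/175) ^ 24" using x0p u by (intro mult_left_mono power_mono) auto
  also have "exp (1/175) ^ 24 = exp (24 / 175 :: real)" by (simp add: exp_of_nat_mult[symmetric])
  also have "exp (24 / 175 :: real) \<le> 175 / 151"
    using exp_ge_add_one_self[of "- (24/175)"] by (simp add: exp_minus field_simps)
  finally have up: "norm (delta_q q) \<le> x0 * (175/151)" using x0p by simp
  have lower: "x1 * (1 - 24 * u) \<le> norm (delta_q r)" if "x1 / (1 - x1) \<le> u" "u \<le> 1/24" "x1 < 1" for u
  proof -
    have "x1 / (1 - x1) \<ge> 0" using that(3) by (simp add: x1_def)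
    hence u0: "u \<ge> 0" using that(1) by linarith
    have "1 - 24 * u \<le> (1 - u) ^ 24"
      using Bernoulli_inequality[of "- u" 24] that by simp
    also have "\<dots> \<le> norm (euler_prod r) ^ 24"
      using norm_euler_prod_bounds(1)[of r x1] r that u0 by (intro power_mono) (auto simp: x1_def)
    finally have "x1 * (1 - 24 * u) \<le> x1 * norm (euler_prod r) ^ 24" by (intro mult_left_mono) (auto simp: x1_def)
    thus ?thesis unfolding delta_q_def norm_mult norm_power r x1_def .
  qed
  have x10: "x1 = x0 * exp (pi * (sqrt 3 - 2 * y))"
    unfolding x1_def x0_def exp_add[symmetric] by (simp add: algebra_simps)
  show ?thesis
  proof (rule disjE[OF y])
    assume y: "y = 3/5"
    \<comment> \<open>471/1000 is an eighth of 2 * 3.14 * 3/5, and 532/1000 below is 1.732 - 2 *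
      3/5.\<close>
    have "39 \<le> (1 + 471/1000 + (471/1000)\<^sup>2 / 2 :: real) ^ 8" by (simp add: power_divide power2_eq_square)
    also have "\<dots> \<le> exp (2 * pi * y)" using pi_approx unfolding y by (intro exp_ge_power8) auto
    finally have x1: "x1 \<le> 1 / 39" unfolding x1_def by (simp add: exp_minus field_simps)
    have "x1 / (1 - x1) \<le> (1/39) / (1 - 1/39)" using x1 by (intro frac_le) (auto simp: x1_def)
    hence l: "x1 * (1 - 24 * (1/38)) \<le> norm (delta_q r)" using x1 by (intro lower) auto
    have "(314/100) * (532/1000) \<le> pi * (sqrt 3 - 2 * y)"
      using pi_approx sqrt_3_bounds unfolding y by (intro mult_mono) auto
    hence "1 + 167/100 + (167/100)\<^sup>2 / 2 \<le> exp (pi * (sqrt 3 - 2 * y))"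
      by (intro order_trans[OF exp_lower_Taylor_quadratic]) auto
    hence "x0 * 4 \<le> x1" unfolding x10 using x0p by (intro mult_left_mono) (auto simp: power2_eq_square)
    thus ?thesis using up l x0p by (simp add: field_simps)
  next
    assume y: "y = 7/10"
    \<comment> \<open>5495/10000 is an eighth of 2 * 3.14 * 7/10, and 332/1000 below is 1.732 - 2 *
      7/10.\<close>
    have "69 \<le> (1 + 5495/10000 + (5495/10000)\<^sup>2 / 2 :: real) ^ 8" by (simp add: power_divide power2_eq_square)
    also have "\<dots> \<le> exp (2 * pi * y)" using pi_approx unfolding y by (intro exp_ge_power8) auto
    finally have x1: "x1 \<le> 1 / 69" unfolding x1_def by (simp add: exp_minus field_simps)
    have "x1 / (1 - x1) \<le> (1/69) / (1 - 1/69)" using x1 by (intro frac_le) (auto simp: x1_def)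
    hence l: "x1 * (1 - 24 * (1/68)) \<le> norm (delta_q r)" using x1 by (intro lower) auto
    have "(314/100) * (332/1000) \<le> pi * (sqrt 3 - 2 * y)"
      using pi_approx sqrt_3_bounds unfolding y by (intro mult_mono) auto
    hence "2 \<le> exp (pi * (sqrt 3 - 2 * y))"
      by (intro order_trans[OF _ exp_ge_add_one_self]) auto
    hence "x0 * 2 \<le> x1" unfolding x10 using x0p by (intro mult_left_mono) auto
    thus ?thesis using up l x0p by (simp add: field_simps)
  qed
qed

text \<open>
  The coprime pairs \<open>(c, d)\<close> not listed in the conclusion satisfy \<open>|c z\<^sub>0 + d|\<^sup>2 \<ge> 2\<close> for \<open>z\<^sub>0\<close> on the arc.
\<close>
lemma arc_denominator:
  fixes c d :: int
  assumes "coprime c d" "-1/2 \<le> x" "x \<le> 0" "of_int (c^2 + d^2) + 2 * of_int (c * d) * x < (2::real)"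
  shows "(c = 0 \<and> \<bar>d\<bar> = 1) \<or> (d = 0 \<and> \<bar>c\<bar> = 1) \<or> (c = 1 \<and> d = 1) \<or> (c = -1 \<and> d = -1)"
proof (cases "c = 0 \<or> d = 0")
  case True
  thus ?thesis using assms(1) by auto
next
  case False
  hence sq: "c^2 \<ge> 1" "d^2 \<ge> 1" by (simp_all add: int_one_le_iff_zero_less)
  show ?thesis
  proof (cases "c * d \<le> 0")
    case True
    hence "of_int (c * d) * x \<ge> 0" using assms(3) by (intro mult_nonpos_nonpos) (auto simp del: of_int_mult)
    hence "of_int (c^2 + d^2) < (2::real)" using assms(4) by linarith
    thus ?thesis using sq by linarith
  next
    case False
    hence "(0::real) \<le> of_int (c * d)" by linarith
    hence "of_int (c * d) * x \<ge> of_int (c * d) * (-1/2)" by (rule mult_left_mono[OF assms(2)])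
    hence "of_int (c^2 + d^2 - c * d) < (2::real)" using assms(4) by simp
    hence lt: "c^2 + d^2 - c * d < 2" by linarith
    have "(c - d)^2 + c * d < 2" using lt by (simp add: power2_eq_square algebra_simps)
    hence "c * d < 2" using zero_le_power2[of "c - d"] by linarith
    hence "c * d = 1" using False by linarith
    thus ?thesis by (auto simp: zmult_eq_1_iff)
  qed
qed

section \<open>Location of the solutions of j(r) = j(z)\<close>

lemma cmod_int_linear_cis:
  "norm (of_int c * cis t + of_int d) ^ 2 = of_int (c^2 + d^2) + 2 * of_int (c * d) * cos t"
proof -
  have "norm (of_int c * cis t + of_int d) ^ 2 = of_int c ^ 2 * ((cos t)^2 + (sin t)^2) + of_int d ^ 2 + 2 * of_int c * of_int d * cos t"
  proof -
    have "(C * x + D)\<^sup>2 + (C * s)\<^sup>2 = C\<^sup>2 * (x\<^sup>2 + s\<^sup>2) + D\<^sup>2 + 2 * C * D * x" for C D x s :: real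
      by (simp add: power2_eq_square algebra_simps)
    thus ?thesis unfolding cmod_power2 by simp
  qed
  thus ?thesis by (simp add: algebra_simps)
qed

lemma arc_cos_sin:
  assumes "pi / 2 \<le> t" "t < 2 * pi / 3"
  shows "-1/2 < cos t" "cos t \<le> 0" "sin t > sqrt 3 / 2" "sin t \<le> 1"
proof -
  have "cos (2 * pi / 3) < cos t" using assms by (intro cos_monotone_0_pi) auto
  thus c: "-1/2 < cos t" by (simp add: cos_120)
  have "cos t \<le> cos (pi / 2)" using assms by (intro cos_monotone_0_pi_le) auto
  thus c': "cos t \<le> 0" by simp
  have "(- cos t)\<^sup>2 < (1/2)\<^sup>2" using c c' by (intro power_strict_mono) auto
  hence "(sqrt 3 / 2)\<^sup>2 < (sin t)\<^sup>2" by (simp add: sin_squared_eq power_divide)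
  moreover have "sin t > 0" using assms by (intro sin_gt_zero) auto
  ultimately show "sin t > sqrt 3 / 2" by (meson less_imp_le power2_less_imp_less)
qed simp

lemma nome_moebius_1: "a * d - b = 1 \<Longrightarrow> of_int 1 * z + of_int d \<noteq> 0 \<Longrightarrow>
    nome (moebius_int a b 1 d z) = nome (-1 / (z + of_int d))"
proof -
  assume ad: "a * d - b = 1" and nz: "of_int 1 * z + of_int d \<noteq> 0"
  have "moebius_int a b 1 d z = -1 / (z + of_int d) + of_int a"
    using ad nz unfolding moebius_int_def by (simp add: field_simps flip: of_int_mult of_int_add) (simp add: algebra_simps)
  thus ?thesis by (simp only: nome_add nome_of_int mult_1_right)
qed

lemma moebius_int_uminus: "moebius_int (-a) (-b) (-c) (-d) z = moebius_int a b c d z"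
proof -
  have "of_int (-a) * z + of_int (-b) = - (of_int a * z + of_int b)"
    "of_int (-c) * z + of_int (-d) = - (of_int c * z + of_int d)" by (simp_all add: algebra_simps)
  thus ?thesis by (simp only: moebius_int_def minus_divide_divide)
qed

text \<open>A solution r is the nome of a point w = (az + b)/(cz + d) of height at least 3/5. As Im
  w = Im z/|cz + d|^2, this bounds |cz + d|, and the bound survives the passage from z to
  \<open>cis t\<close>, where only c = 0, d = 0 or c = d = \<plusminus>1 remain.\<close>

lemma high_translates:
  assumes t: "pi / 2 \<le> t" "t < 2 * pi / 3" and z: "norm (z - cis t) < 1/25" "Im z > 0"
    and r: "r \<noteq> 0" "norm r \<le> exp (- 2 * pi * (3/5))" and jr: "j_q r = j_q (nome z)"
  shows "r = nome z \<or> r = nome (-1/z) \<or> r = nome (-1/(z+1))"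
proof -
  have "norm r < 1" using r(2) by (rule le_less_trans) simp
  then obtain w where w: "nome w = r" "Im w > 0" using nome_surj[OF r(1)] by blast
  have "sl2_equiv z w" using j_injective[OF z(2) w(2)] jr w(1) by simp
  then obtain a b c d where det: "a * d - b * c = 1" and wz: "w = moebius_int a b c d z"
    unfolding sl2_equiv_def by blast
  have cop: "coprime c d"
  proof (rule coprimeI)
    fix x assume "x dvd c" "x dvd d"
    hence "x dvd a * d - b * c" by simp
    thus "is_unit x" using det by simp
  qed
  note cs = arc_cos_sin[OF t]
  have Imw: "Im w \<ge> 3/5" using r(2) unfolding w(1)[symmetric] norm_nome by simp
  have nz: "of_int c * z + of_int d \<noteq> 0" by (rule int_linear_nonzero[OF z(2) det])
  have "Im w = Im z / norm (of_int c * z + of_int d) ^ 2" unfolding wz by (rule Im_moebius_int[OF z(2) det])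
  hence "Im z \<ge> 3/5 * norm (of_int c * z + of_int d) ^ 2"
    using Imw nz by (simp add: field_simps)
  \<comment> \<open>26/25 = 1 + 1/25, and 26/15 below is its quotient by 3/5.\<close>
  moreover have "Im z \<le> 26/25"
    using abs_Im_le_cmod[of "z - cis t"] z(1) cs(4) unfolding minus_complex.sel cis.sel by linarith
  ultimately have "norm (of_int c * z + of_int d) ^ 2 \<le> 26/15" by simp
  also have "(26/15 :: real) < (1317/1000)\<^sup>2" by (simp add: power2_eq_square)
  finally have n1: "norm (of_int c * z + of_int d) < 1317/1000"
    by (rule power2_less_imp_less) simp
  have "sin t > 4/5"
  proof -
    have "(8/5 :: real) < sqrt 3" by (rule real_less_rsqrt) (simp add: power2_eq_square)
    thus ?thesis using cs(3) by linarith
  qed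
  moreover have "\<bar>of_int c\<bar> * sin t \<le> norm (of_int c * cis t + of_int d)"
    using abs_Im_le_cmod[of "of_int c * cis t + of_int d"] \<open>sin t > 4/5\<close> by (simp add: abs_mult)
  ultimately have c1: "\<bar>of_int c\<bar> * (4/5) \<le> norm (of_int c * cis t + of_int d)"
    by (meson abs_ge_zero less_imp_le mult_left_mono order_trans)
  have "norm (of_int c * cis t + of_int d) \<le> norm (of_int c * z + of_int d) + norm (of_int c * (z - cis t))"
    using norm_triangle_ineq4[of "of_int c * z + of_int d" "of_int c * (z - cis t)"] by (simp add: algebra_simps)
  also have "norm (of_int c * (z - cis t)) \<le> \<bar>of_int c\<bar> * (1/25)"
    unfolding norm_mult using z(1) by (intro mult_mono) auto
  \<comment> \<open>By \<open>c1\<close>, |c|/25 is at most a twentieth of the norm at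
    \<open>cis t\<close>. Hence that norm is at most 20/19 * 1317/1000 < 14/10, whose square 196/100
    stays below the threshold 2 of the arithmetic lemma.\<close>
  finally have "norm (of_int c * cis t + of_int d) \<le> norm (of_int c * z + of_int d) + norm (of_int c * cis t + of_int d) / 20"
    using c1 by linarith
  hence "norm (of_int c * cis t + of_int d) < 14/10" using n1 by linarith
  hence "norm (of_int c * cis t + of_int d) ^ 2 < (14/10) ^ 2"
    by (intro power_strict_mono) auto
  hence "of_int (c^2 + d^2) + 2 * of_int (c * d) * cos t < (2::real)"
    unfolding cmod_int_linear_cis by (simp add: power2_eq_square)
  from arc_denominator[OF cop _ _ this] cs
  consider "c = 0" "\<bar>d\<bar> = 1" | "d = 0" "\<bar>c\<bar> = 1" | "c = 1 \<and> d = 1 \<or> c = -1 \<and> d = -1" by force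
  thus ?thesis
  proof cases
    case 1
    hence "sl2_equiv z w" "w = z + of_int (b * d)"
      using det wz \<open>sl2_equiv z w\<close> by (auto simp: moebius_int_def abs_if zmult_eq_1_iff split: if_splits)
    thus ?thesis using w(1) by (simp add: nome_add del: of_int_mult)
  next
    case 2
    hence "c = 1 \<or> c = -1" by auto
    thus ?thesis
    proof
      assume "c = 1"
      thus ?thesis using nome_moebius_1[of a d b z] det nz w(1) wz 2 by simp
    next
      assume "c = -1"
      thus ?thesis using nome_moebius_1[of "-a" "-d" "-b" z] moebius_int_uminus[of a b c d z] det nz w(1) wz 2 by simp
    qed
  next
    case 3
    thus ?thesis
    proof
      assume "c = 1 \<and> d = 1"
      thus ?thesis using nome_moebius_1[of a d b z] det nz w(1) wz by simp
    next
      assume "c = -1 \<and> d = -1"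
      moreover from this have "z + 1 \<noteq> 0" using nz by (auto simp: algebra_simps neg_eq_iff_add_eq_0)
      ultimately show ?thesis
        using nome_moebius_1[of "-a" "-d" "-b" z] moebius_int_uminus[of a b c d z] det w(1) wz by simp
    qed
  qed
qed

section \<open>The error term\<close>

text \<open>
  On the arc, \<open>arc_factor \<kappa> m (cis \<theta>)\<close> is \<open>exp (ik\<theta>/2 - 2\<pi>m sin \<theta>)\<close> with \<open>k = 2\<kappa>\<close>, and
  \<open>arc_main \<kappa> m (cis \<theta>)\<close> is \<open>exp (i(k\<theta>/2 - 2\<pi>m cos \<theta>))\<close>. Both extend holomorphically to the
  half-plane.
\<close>
definition arc_factor :: "int \<Rightarrow> int \<Rightarrow> complex \<Rightarrow> complex" where
  "arc_factor \<kappa> m z = z powi \<kappa> * exp (of_real pi * \<i> * (z - 1/z)) powi m"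

definition arc_main :: "int \<Rightarrow> int \<Rightarrow> complex \<Rightarrow> complex" where
  "arc_main \<kappa> m z = z powi \<kappa> * exp (- (of_real pi * \<i> * (z + 1/z))) powi m"

definition arc_error :: "int \<Rightarrow> int \<Rightarrow> complex \<Rightarrow> complex" where
  "arc_error \<kappa> m z = arc_factor \<kappa> m z * basis_form (2 * \<kappa>) m z - arc_main \<kappa> m z - inverse (arc_main \<kappa> m z)"

text \<open>The contribution of the pole at \<open>-1/(z + 1)\<close>.\<close>
definition arc_third :: "int \<Rightarrow> int \<Rightarrow> complex \<Rightarrow> complex" where
  "arc_third \<kappa> m z = (z / (z + 1) ^ 2) powi \<kappa> *
     exp (of_real pi * \<i> * (z - 1/z) + 2 * of_real pi * \<i> / (z + 1)) powi m"

lemma nome_as_exp_powi: "nome z powi (-m) = exp (- (2 * of_real pi * \<i> * z)) powi m"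
  unfolding nome_def by (simp add: power_int_minus exp_minus power_int_inverse)

text \<open>The residue at \<open>nome z\<close> times \<open>arc_factor\<close> is
  \<open>arc_main\<close>, and the inversion law of \<Phi> turns the residue at -1/z into its
  inverse. Subtracting both leaves the integral and, if the contour encloses it, the third
  residue.\<close>

lemma arc_error_formula:
  assumes l: "weight_ell (2 * \<kappa>) = l" and k: "2 * \<kappa> = 12 * l + 4 * int a + 6 * int b"
    and ab: "a \<le> 2" "b \<le> 1" and m: "l + m \<ge> 0" and z: "Im z > 0"
    and crit: "E4_q (nome z) \<noteq> 0" "E6_q (nome z) \<noteq> 0"
    and R: "0 < R" "R < 1" and circ: "\<And>r. norm r = R \<Longrightarrow> j_q r \<noteq> j_q (nome z)"
    and roots: "{r. r \<noteq> 0 \<and> norm r < R \<and> j_q r = j_q (nome z)} =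
                  {nome z, nome (-1/z)} \<union> (if c then {nome (-1/(z+1))} else {})"
    and distinct: "nome z \<noteq> nome (-1/z)" "nome (-1/(z+1)) \<noteq> nome z" "nome (-1/(z+1)) \<noteq> nome (-1/z)"
  defines "\<Phi> \<equiv> (\<lambda>r. delta_q r powi l * eis_q a b r)"
  defines "K \<equiv> (\<lambda>r. eis_q (2 - a) (1 - b) r * delta_q r powi (- l - 1) * r powi (- m - 1) / (j_q r - j_q (nome z)))"
  shows "K contour_integrable_on circlepath 0 R"
    and "arc_error \<kappa> m z = arc_factor \<kappa> m z * (\<Phi> (nome z) / (2 * of_real pi * \<i>) * contour_integral (circlepath 0 R) K)
           + (if c then arc_third \<kappa> m z else 0)"
proof -
  note int = basis_form_integral[OF l k ab m z crit R circ]
  show "K contour_integrable_on circlepath 0 R" unfolding K_def by (rule int(1))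
  define S where "S = (\<lambda>r. \<Phi> (nome z) / \<Phi> r * r powi (-m))"
  define I where "I = \<Phi> (nome z) / (2 * of_real pi * \<i>) * contour_integral (circlepath 0 R) K"
  have z0: "z \<noteq> 0" using z by auto
  have \<Phi>0: "\<Phi> (nome z) \<noteq> 0"
    using crit norm_nome_less_1[OF z] by (simp add: \<Phi>_def eis_q_def delta_q_eq_0_iff)
  have inv: "\<Phi> (nome (-1/w)) = w powi (2 * \<kappa>) * \<Phi> (nome w)" if w: "Im w > 0" for w
  proof -
    have w0: "w \<noteq> 0" using w by auto
    have "(w ^ 12 * delta_q (nome w)) powi l = w powi (12 * l) * delta_q (nome w) powi l"
      by (simp only: power_int_mult_distrib power_int_mult power_int_numeral)
    moreover have "w powi (2 * \<kappa>) = w powi (12 * l) * w ^ (4 * a + 6 * b)"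
    proof -
      have "2 * \<kappa> = 12 * l + int (4 * a + 6 * b)" using k by simp
      thus ?thesis using w0 by (metis power_int_add power_int_of_nat)
    qed
    ultimately show ?thesis
      unfolding \<Phi>_def delta_q_inversion[OF w] eis_q_inversion[OF w] by (simp only: mult_ac)
  qed
  have z1: "Im (z + 1) > 0" using z by simp
  have t1: "arc_factor \<kappa> m z * nome z powi (-m) = arc_main \<kappa> m z"
  proof -
    have "exp (of_real pi * \<i> * (z - 1/z)) * exp (- (2 * of_real pi * \<i> * z)) = exp (- (of_real pi * \<i> * (z + 1/z)))"
      unfolding exp_add[symmetric] by (rule arg_cong[of _ _ exp]) (simp add: algebra_simps)
    thus ?thesis unfolding arc_factor_def arc_main_def nome_as_exp_powi
      by (metis mult.assoc power_int_mult_distrib)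
  qed
  have t2: "arc_factor \<kappa> m z * (\<Phi> (nome z) / \<Phi> (nome (-1/z)) * nome (-1/z) powi (-m)) = inverse (arc_main \<kappa> m z)"
  proof -
    have "exp (of_real pi * \<i> * (z - 1/z)) * exp (- (2 * of_real pi * \<i> * (-1/z))) = exp (of_real pi * \<i> * (z + 1/z))"
      unfolding exp_add[symmetric] by (rule arg_cong[of _ _ exp]) (simp add: algebra_simps)
    also have "\<dots> = inverse (exp (- (of_real pi * \<i> * (z + 1/z))))" by (simp add: exp_minus)
    finally have e: "exp (of_real pi * \<i> * (z - 1/z)) powi m * nome (-1/z) powi (-m) = inverse (exp (- (of_real pi * \<i> * (z + 1/z))) powi m)"
      unfolding nome_as_exp_powi by (metis power_int_mult_distrib power_int_inverse)
    have p: "z powi \<kappa> / z powi (2 * \<kappa>) = inverse (z powi \<kappa>)"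
      using z0 by (simp add: power_int_mult field_simps flip: power_int_add power2_eq_square)
    have "arc_factor \<kappa> m z * (\<Phi> (nome z) / \<Phi> (nome (-1/z)) * nome (-1/z) powi (-m))
       = (z powi \<kappa> / z powi (2 * \<kappa>)) * (exp (of_real pi * \<i> * (z - 1/z)) powi m * nome (-1/z) powi (-m))"
      unfolding inv[OF z] arc_factor_def using \<Phi>0 by simp
    also have "\<dots> = inverse (arc_main \<kappa> m z)" unfolding e p arc_main_def by simp
    finally show ?thesis .
  qed
  have t3: "arc_factor \<kappa> m z * (\<Phi> (nome z) / \<Phi> (nome (-1/(z+1))) * nome (-1/(z+1)) powi (-m)) = arc_third \<kappa> m z"
  proof -
    have "exp (of_real pi * \<i> * (z - 1/z)) * exp (- (2 * of_real pi * \<i> * (-1/(z+1))))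
      = exp (of_real pi * \<i> * (z - 1/z) + 2 * of_real pi * \<i> / (z + 1))"
      unfolding exp_add[symmetric] by (rule arg_cong[of _ _ exp]) (simp add: algebra_simps)
    hence e: "exp (of_real pi * \<i> * (z - 1/z)) powi m * nome (-1/(z+1)) powi (-m)
       = exp (of_real pi * \<i> * (z - 1/z) + 2 * of_real pi * \<i> / (z + 1)) powi m"
      unfolding nome_as_exp_powi by (metis power_int_mult_distrib)
    have p: "z powi \<kappa> / (z + 1) powi (2 * \<kappa>) = (z / (z + 1) ^ 2) powi \<kappa>"
      by (simp add: power_int_mult power_int_divide_distrib)
    have "\<Phi> (nome (-1/(z+1))) = (z + 1) powi (2 * \<kappa>) * \<Phi> (nome z)"
      using inv[OF z1] by (simp add: nome_add)
    hence "arc_factor \<kappa> m z * (\<Phi> (nome z) / \<Phi> (nome (-1/(z+1))) * nome (-1/(z+1)) powi (-m))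
       = (z powi \<kappa> / (z + 1) powi (2 * \<kappa>)) * (exp (of_real pi * \<i> * (z - 1/z)) powi m * nome (-1/(z+1)) powi (-m))"
      unfolding arc_factor_def using \<Phi>0 by simp
    thus ?thesis unfolding e p arc_third_def .
  qed
  have sum_eq: "(\<Sum>r | r \<noteq> 0 \<and> norm r < R \<and> j_q r = j_q (nome z). S r)
      = S (nome z) + S (nome (-1/z)) + (if c then S (nome (-1/(z+1))) else 0)"
    unfolding roots using distinct by auto
  have "basis_form (2 * \<kappa>) m z = I + (\<Sum>r | r \<noteq> 0 \<and> norm r < R \<and> j_q r = j_q (nome z). S r)"
    unfolding I_def S_def \<Phi>_def K_def by (rule int(2))
  hence "basis_form (2 * \<kappa>) m z = I + (S (nome z) + S (nome (-1/z)) + (if c then S (nome (-1/(z+1))) else 0))"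
    unfolding sum_eq .
  hence "arc_factor \<kappa> m z * basis_form (2 * \<kappa>) m z = arc_factor \<kappa> m z * I + arc_factor \<kappa> m z * S (nome z)
      + arc_factor \<kappa> m z * S (nome (-1/z)) + (if c then arc_factor \<kappa> m z * S (nome (-1/(z+1))) else 0)"
    by (simp add: algebra_simps)
  also have "S (nome z) = nome z powi (-m)" using \<Phi>0 by (simp add: S_def)
  finally show "arc_error \<kappa> m z = arc_factor \<kappa> m z * I + (if c then arc_third \<kappa> m z else 0)"
    unfolding arc_error_def t1 S_def t2 t3 by simp
qed

text \<open>The exponent may have either sign, so neither endpoint alone bounds the power.\<close>

lemma power_int_between:
  fixes \<alpha> \<beta> x :: real
  assumes "0 < \<alpha>" "\<alpha> \<le> x" "x \<le> \<beta>"
  shows "x powi l \<le> \<alpha> powi l + \<beta> powi l"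
proof (cases "l \<ge> 0")
  case True
  hence "x powi l \<le> \<beta> powi l" using assms by (auto simp: power_int_def intro: power_mono)
  moreover have "\<alpha> powi l > 0" using assms by (intro zero_less_power_int) auto
  ultimately show ?thesis by simp
next
  case False
  have "inverse x ^ nat (-l) \<le> inverse \<alpha> ^ nat (-l)"
    using assms by (intro power_mono le_imp_inverse_le) auto
  hence "x powi l \<le> \<alpha> powi l" using False by (simp add: power_int_def)
  moreover have "\<beta> powi l > 0" using assms by (intro zero_less_power_int) auto
  ultimately show ?thesis by simp
qed

text \<open>Zeros of E4^2 E6 are isolated. Excluding a single point is harmless later, since the
  error bound extends to it by continuity.\<close>

lemma eventually_noncritical:
  assumes "Im z0 > 0"
  shows "\<forall>\<^sub>F z in at z0. E4_q (nome z) \<noteq> 0 \<and> E6_q (nome z) \<noteq> 0"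
proof -
  define h where "h = (\<lambda>z. E4_q (nome z) ^ 2 * E6_q (nome z))"
  define H where "H = {z :: complex. Im z > 0}"
  have h_hol: "h holomorphic_on H"
    unfolding h_def H_def holomorphic_on_open[OF open_Im_pos]
    by (auto intro!: derivative_eq_intros exI DERIV_nome_compose E4_q_holomorphic E6_q_holomorphic)
  obtain e where e: "e > 0" "e < 1" "\<And>r. norm r < e \<Longrightarrow> E4_q r ^ 2 * E6_q r \<noteq> 0"
    using j_injective_near_cusp by metis
  have "norm (of_real (e/2) :: complex) < 1" "of_real (e/2) \<noteq> (0::complex)" using e by auto
  then obtain v where v: "nome v = of_real (e/2)" "Im v > 0" using nome_surj by metis
  have "norm (nome v) = e / 2" unfolding v(1) norm_of_real using e(1) by simp
  hence hv: "h v \<noteq> 0" "v \<in> H" using e v(2) by (auto simp: h_def H_def)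
  have zH: "z0 \<in> H" "open H" "connected H"
    using assms open_Im_pos connected_Im_pos by (auto simp: H_def)
  have "\<forall>\<^sub>F z in at z0. h z \<noteq> 0"
  proof (cases "h z0 = 0")
    case True
    obtain r where r: "0 < r" "\<And>z. z \<in> ball z0 r - {z0} \<Longrightarrow> h z \<noteq> 0"
      by (rule isolated_zeros[OF h_hol zH(2,3,1) True hv(2,1)]) (rule that)
    thus ?thesis unfolding eventually_at by (intro exI[of _ r]) (auto simp: dist_commute)
  next
    case False
    have "isCont h z0" using holomorphic_on_imp_continuous_on[OF h_hol] zH by (simp add: continuous_on_eq_continuous_at)
    hence "(h \<longlongrightarrow> h z0) (at z0)" by (simp add: isCont_def)
    thus ?thesis using False by (rule tendsto_imp_eventually_ne)
  qed
  thus ?thesis by (rule eventually_mono) (auto simp: h_def)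
qed

text \<open>
  The contour of height \<open>y\<close> separates \<open>z\<close> and \<open>-1/z\<close> from the real axis; whether it also encloses the
  image of \<open>-1/(z + 1)\<close>, recorded by \<open>c\<close>, does not change near \<open>cis t\<close>.
\<close>
definition arc_good :: "real \<Rightarrow> real \<Rightarrow> bool \<Rightarrow> complex \<Rightarrow> bool" where
  "arc_good t y c z \<longleftrightarrow> Im z > y \<and> Im (-1/z) > y \<and> norm (z - cis t) < 1/25 \<and> z \<noteq> 0 \<and>
     Im (-1/(z+1)) < Im z \<and> Im (-1/(z+1)) < Im (-1/z) \<and>
     (if c then Im (-1/(z+1)) > y else Im (-1/(z+1)) < y)"

lemma Im_neg_inverse: "Im (-1/w) = Im w / norm w ^ 2"
  by (simp add: Im_divide cmod_power2)

lemma arc_norm_plus_1: "norm (cis t + 1) ^ 2 = 2 + 2 * cos t"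
  using cmod_int_linear_cis[of 1 t 1] by simp

text \<open>At z = \<open>cis t\<close> the point -1/(z + 1) has height sin t / (2 + 2 cos t), which
  is below sin t as cos t > -1/2. All conditions hold strictly at \<open>cis t\<close>, so they
  persist nearby.\<close>

lemma eventually_arc_good:
  assumes t: "pi / 2 \<le> t" "t < 2 * pi / 3"
  obtains y c where "y = 3/5 \<or> y = (7/10::real)" "\<forall>\<^sub>F z in nhds (cis t). arc_good t y c z"
proof -
  define z0 where "z0 = cis t"
  note cs = arc_cos_sin[OF t]
  have "(8/5 :: real) < sqrt 3" by (rule real_less_rsqrt) (simp add: power2_eq_square)
  hence s: "sin t > 7/10" using cs(3) by simp
  \<comment> \<open>The height 7/10 is taken exactly when the third point would lie on the contour
    of height 3/5.\<close>
  define y where "y = (if Im (-1/(z0+1)) = 3/5 then 7/10 else 3/5 :: real)"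
  define c where "c \<longleftrightarrow> Im (-1/(z0+1)) > y"
  have y: "y = 3/5 \<or> y = 7/10" "Im (-1/(z0+1)) \<noteq> y" "y < sin t" using s by (auto simp: y_def)
  have nz: "z0 \<noteq> 0" "z0 + 1 \<noteq> 0" using s by (auto simp: z0_def complex_eq_iff)
  have I0: "Im z0 = sin t" "Im (-1/z0) = sin t" unfolding Im_neg_inverse by (auto simp: z0_def)
  have "Im (-1/(z0+1)) = sin t / (2 + 2 * cos t)"
    unfolding Im_neg_inverse z0_def arc_norm_plus_1 by simp
  also have "\<dots> < sin t / 1" using cs s by (intro divide_strict_left_mono) auto
  finally have I1: "Im (-1/(z0+1)) < sin t" by simp
  have L1: "((\<lambda>z. Im z) \<longlongrightarrow> sin t) (nhds z0)"
    using tendsto_Im[OF filterlim_ident, of z0] I0 by simp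
  have L2: "((\<lambda>z. Im (-1/z)) \<longlongrightarrow> sin t) (nhds z0)"
    using I0(2) nz by (auto intro!: tendsto_eq_intros filterlim_ident)
  have L3: "((\<lambda>z. Im (-1/(z+1))) \<longlongrightarrow> Im (-1/(z0+1))) (nhds z0)"
    using nz by (intro tendsto_intros filterlim_ident) auto
  have L4: "((\<lambda>z. Im z - Im (-1/(z+1))) \<longlongrightarrow> sin t - Im (-1/(z0+1))) (nhds z0)"
    by (intro tendsto_diff L1 L3)
  have L5: "((\<lambda>z. Im (-1/z) - Im (-1/(z+1))) \<longlongrightarrow> sin t - Im (-1/(z0+1))) (nhds z0)"
    by (intro tendsto_diff L2 L3)
  have L6: "((\<lambda>z. norm (z - cis t)) \<longlongrightarrow> norm (z0 - cis t)) (nhds z0)"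
    by (intro tendsto_intros filterlim_ident)
  have pos: "0 < sin t - Im (-1/(z0+1))" using I1 by simp
  have E3: "\<forall>\<^sub>F z in nhds z0. (if c then Im (-1/(z+1)) > y else Im (-1/(z+1)) < y)"
  proof (cases c)
    case True
    thus ?thesis using order_tendstoD(1)[OF L3, of y] by (simp add: c_def)
  next
    case False
    hence "Im (-1/(z0+1)) < y" using y(2) unfolding c_def by linarith
    thus ?thesis using order_tendstoD(2)[OF L3, of y] False by simp
  qed
  have "norm (z0 - cis t) < 1/25" by (simp add: z0_def)
  note E = order_tendstoD(1)[OF L1 y(3)] order_tendstoD(1)[OF L2 y(3)] order_tendstoD(2)[OF L6 this]
    order_tendstoD(1)[OF L4 pos] order_tendstoD(1)[OF L5 pos] E3
    tendsto_imp_eventually_ne[OF filterlim_ident nz(1)]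
  have "\<forall>\<^sub>F z in nhds z0. arc_good t y c z"
    using E by eventually_elim (simp add: arc_good_def)
  with y(1) show ?thesis using that unfolding z0_def by blast
qed

text \<open>Both contour heights are at least 3/5, so \<open>high_translates\<close> leaves three
  candidates; it remains to compare their heights with y and with each other.\<close>

lemma arc_good_roots:
  assumes t: "pi / 2 \<le> t" "t < 2 * pi / 3" and y: "y = 3/5 \<or> y = (7/10::real)" and z: "arc_good t y c z"
  defines "R \<equiv> exp (- 2 * pi * y)"
  shows "norm r = R \<Longrightarrow> j_q r \<noteq> j_q (nome z)"
    and "{r. r \<noteq> 0 \<and> norm r < R \<and> j_q r = j_q (nome z)} =
                  {nome z, nome (-1/z)} \<union> (if c then {nome (-1/(z+1))} else {})"
    and "nome (-1/(z+1)) \<noteq> nome z" "nome (-1/(z+1)) \<noteq> nome (-1/z)"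
proof -
  have y0: "y \<ge> 3/5" using y by auto
  have z': "Im z > 0" using z y0 by (simp add: arc_good_def)
  have z1: "Im (z + 1) > 0" using z' by simp
  have R: "R \<le> exp (- 2 * pi * (3/5))" using y0 by (simp add: R_def)
  have n: "norm (nome w) < R \<longleftrightarrow> Im w > y" "norm (nome w) = R \<longleftrightarrow> Im w = y" for w
    unfolding norm_nome R_def by simp_all
  have opts: "r = nome z \<or> r = nome (-1/z) \<or> r = nome (-1/(z+1))"
    if "r \<noteq> 0" "norm r \<le> R" "j_q r = j_q (nome z)" for r
    by (rule high_translates[OF t _ z']) (use z that R in \<open>auto simp: arc_good_def\<close>)
  show "j_q r \<noteq> j_q (nome z)" if "norm r = R"
  proof
    assume "j_q r = j_q (nome z)"
    moreover have "r \<noteq> 0" using that by (auto simp: R_def)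
    ultimately have "r = nome z \<or> r = nome (-1/z) \<or> r = nome (-1/(z+1))" using opts that by simp
    hence "Im z = y \<or> Im (-1/z) = y \<or> Im (-1/(z+1)) = y" using that n(2) by metis
    thus False using z by (auto simp: arc_good_def split: if_splits)
  qed
  have j3: "j_q (nome (-1/(z+1))) = j_q (nome z)" using j_q_inversion[OF z1] by (simp add: nome_add)
  have j2: "j_q (nome (-1/z)) = j_q (nome z)" by (rule j_q_inversion[OF z'])
  show "{r. r \<noteq> 0 \<and> norm r < R \<and> j_q r = j_q (nome z)} =
                  {nome z, nome (-1/z)} \<union> (if c then {nome (-1/(z+1))} else {})"
  proof (intro equalityI subsetI)
    fix r assume "r \<in> {r. r \<noteq> 0 \<and> norm r < R \<and> j_q r = j_q (nome z)}"
    hence r: "r \<noteq> 0" "norm r < R" "j_q r = j_q (nome z)" by auto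
    from opts[OF r(1) _ r(3)] r(2) have "r = nome z \<or> r = nome (-1/z) \<or> r = nome (-1/(z+1))" by simp
    moreover have "c" if "r = nome (-1/(z+1))"
      using r(2) z unfolding that n(1) by (auto simp: arc_good_def split: if_splits)
    ultimately show "r \<in> {nome z, nome (-1/z)} \<union> (if c then {nome (-1/(z+1))} else {})" by auto
  next
    fix r assume "r \<in> {nome z, nome (-1/z)} \<union> (if c then {nome (-1/(z+1))} else {})"
    hence "r = nome z \<or> r = nome (-1/z) \<or> (c \<and> r = nome (-1/(z+1)))" by (auto split: if_splits)
    thus "r \<in> {r. r \<noteq> 0 \<and> norm r < R \<and> j_q r = j_q (nome z)}"
      using z j2 j3 by (auto simp: n(1) arc_good_def)
  qed
  have ne: "Im u \<noteq> Im v \<Longrightarrow> nome u \<noteq> nome v" for u v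
    using nome_eq_iff[of u v] by auto
  show "nome (-1/(z+1)) \<noteq> nome z" "nome (-1/(z+1)) \<noteq> nome (-1/z)"
    using z unfolding arc_good_def by (auto intro!: ne simp del: Im_divide)
qed

text \<open>Equal nomes mean that z + 1/z is an integer. Near the arc it is close to 2 cos t, of
  modulus less than 1, so it is 0 and z = i.\<close>

lemma eventually_nome_inversion_neq:
  assumes t: "pi / 2 \<le> t" "t < 2 * pi / 3"
  shows "\<forall>\<^sub>F z in at (cis t). nome z \<noteq> nome (-1/z)"
proof -
  note cs = arc_cos_sin[OF t]
  have "cis t + 1 / cis t = of_real (2 * cos t)"
    by (simp add: cis_divide[symmetric] complex_eq_iff flip: cis_inverse inverse_eq_divide)
  hence "norm (cis t + 1 / cis t) < 1" using cs by simp
  moreover have "((\<lambda>z. norm (z + 1/z)) \<longlongrightarrow> norm (cis t + 1 / cis t)) (at (cis t))"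
    by (intro tendsto_intros) auto
  ultimately have "\<forall>\<^sub>F z in at (cis t). norm (z + 1/z) < 1" using order_tendstoD(2) by blast
  moreover have "((\<lambda>z. Im z) \<longlongrightarrow> Im (cis t)) (at (cis t))" by (intro tendsto_intros)
  hence "\<forall>\<^sub>F z in at (cis t). Im z > 0"
    using order_tendstoD(1)[of Im "Im (cis t)" _ 0] cs(3) by (simp add: less_trans[of 0 "sqrt 3 / 2"])
  moreover have "\<forall>\<^sub>F z in at (cis t). z \<noteq> \<i>" by (rule eventually_neq_at_within)
  ultimately show ?thesis
  proof eventually_elim
    case (elim z)
    have z0: "z \<noteq> 0" using elim by auto
    show ?case
    proof
      assume "nome z = nome (-1/z)"
      then obtain n :: int where n: "z = -1/z + of_int n" using nome_eq_iff by blast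
      hence "z + 1/z = of_int n" by (simp add: algebra_simps)
      hence "\<bar>of_int n :: real\<bar> < 1" using elim(1) by simp
      hence "n = 0" by linarith
      hence "z * z = -1" using n z0 by (simp add: field_simps)
      hence "z ^ 2 = \<i> ^ 2" by (simp add: power2_eq_square)
      hence "z = \<i> \<or> z = -\<i>" by (simp only: power2_eq_iff)
      thus False using elim by auto
    qed
  qed
qed

lemma norm_eis_q_le:
  assumes "a \<le> 2" "b \<le> 1"
  shows "norm (eis_q a b r) \<le> (1 + norm (E4_q r)) ^ 2 * (1 + norm (E6_q r))"
proof -
  have "norm (E4_q r) ^ a \<le> (1 + norm (E4_q r)) ^ a" by (intro power_mono) auto
  also have "\<dots> \<le> (1 + norm (E4_q r)) ^ 2" using assms by (intro power_increasing) auto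
  finally have 1: "norm (E4_q r) ^ a \<le> (1 + norm (E4_q r)) ^ 2" .
  have "norm (E6_q r) ^ b \<le> (1 + norm (E6_q r)) ^ b" by (intro power_mono) auto
  also have "\<dots> \<le> (1 + norm (E6_q r)) ^ 1" using assms by (intro power_increasing) auto
  finally have 2: "norm (E6_q r) ^ b \<le> 1 + norm (E6_q r)" by simp
  show ?thesis unfolding eis_q_def norm_mult norm_power using 1 2 by (intro mult_mono) auto
qed

text \<open>The modulus of \<open>arc_factor\<close> times \<Phi> times the kernel, regrouped so
  that l and n occur only as exponents of two bases. In the application e = 2a + 3b \<le> 7, so the
  remaining factor is bounded.\<close>

lemma kernel_algebra:
  fixes Z E D A B D' R J :: real and l :: int and n :: nat
  assumes pos: "Z > 0" "D > 0" "D' > 0" "R > 0" "J > 0" and \<kappa>: "\<kappa> = 6 * l + int e"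
  shows "Z powi \<kappa> * E ^ n * (D powi l * A) * (B * D' powi (- l - 1) * R powi (- int n - 1) / J)
     = (Z ^ e * A * B / (D' * R * J)) * (Z ^ 6 * D / D') powi l * (E / R) ^ n"
proof -
  have 1: "Z powi \<kappa> = (Z ^ 6) powi l * Z ^ e"
    unfolding \<kappa> using pos by (simp add: power_int_add power_int_mult)
  have 2: "D' powi (- l - 1) = inverse (D' powi l) / D'"
    using pos by (simp add: power_int_diff power_int_minus divide_inverse)
  have 3: "R powi (- int n - 1) = inverse (R ^ n) / R"
    using pos by (simp add: power_int_diff power_int_minus divide_inverse)
  show ?thesis unfolding 1 2 3
    by (simp add: power_int_mult_distrib power_int_divide_distrib power_divide divide_inverse
        power_int_inverse power_mult_distrib power_inverse mult_ac)
qed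

lemma Re_real_i_mult: "Re (of_real x * \<i> * w) = - x * Im w"
  by simp

lemma Im_diff_inverse: "Im (w - 1/w) = Im w + Im (-1/w)" for w :: complex
  by (metis diff_conv_add_uminus minus_divide_left plus_complex.sel(2))

lemma norm_powi_mult_powi:
  fixes u v :: complex
  assumes "m \<ge> 0"
  shows "norm (u powi \<kappa> * v powi m) = norm u powi \<kappa> * norm v ^ nat m"
proof -
  have "norm v powi m = norm v ^ nat m" using assms by (simp add: power_int_def)
  thus ?thesis unfolding norm_mult norm_power_int by simp
qed

text \<open>At \<open>cis t\<close> the two bases have modulus 1/(2 + 2 cos t) and exp (2\<pi> (sin
  t / (2 + 2 cos t) - sin t)). Both are below 1 because cos t > -1/2; at 2\<pi>/3 they would reach
  1.\<close>

lemma arc_third_bound: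
  assumes t: "pi / 2 \<le> t" "t < 2 * pi / 3"
  obtains \<alpha> \<beta> \<mu> where "0 < \<alpha>" "\<alpha> < 1" "0 < \<beta>" "\<beta> < 1" "0 < \<mu>" "\<mu> < 1"
    "\<forall>\<^sub>F z in nhds (cis t). \<forall>\<kappa> l e m. \<kappa> = 6 * l + int e \<longrightarrow> m \<ge> 0 \<longrightarrow>
       norm (arc_third \<kappa> m z) \<le> (\<alpha> powi l + \<beta> powi l) * \<mu> ^ nat m"
proof -
  define z0 where "z0 = cis t"
  note cs = arc_cos_sin[OF t]
  have st: "sin t > 0" using cs(3) by (rule less_trans[rotated]) simp
  have nz: "z0 \<noteq> 0" "z0 + 1 \<noteq> 0" using st by (auto simp: z0_def complex_eq_iff)
  define w where "w = (\<lambda>z :: complex. norm (z / (z + 1) ^ 2))"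
  define w0 where "w0 = w z0"
  have w0: "w0 = 1 / (2 + 2 * cos t)"
    unfolding w0_def w_def z0_def norm_divide norm_power arc_norm_plus_1 by simp
  have w01: "0 < w0" "w0 < 1" unfolding w0 using cs by (auto simp: field_simps)
  have "(w \<longlongrightarrow> w0) (nhds z0)" unfolding w_def w0_def using nz
    by (intro tendsto_intros filterlim_ident) auto
  note Ew = order_tendstoD(1)[OF this, of "w0 / 2"] order_tendstoD(2)[OF this, of "(1 + w0) / 2"]
  define Y where "Y = (\<lambda>z :: complex. norm (exp (of_real pi * \<i> * (z - 1/z) + 2 * of_real pi * \<i> / (z + 1))))"
  define Y0 where "Y0 = Y z0"
  have "Y0 = exp (- pi * (Im z0 + Im (-1/z0)) + 2 * pi * Im (-1/(z0 + 1)))"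
  proof -
    have "Re (of_real pi * \<i> * (z0 - 1/z0) + 2 * of_real pi * \<i> / (z0 + 1))
       = - pi * (Im z0 + Im (-1/z0)) + 2 * pi * Im (-1/(z0 + 1))"
    proof -
      have "2 * of_real pi * \<i> / (z0 + 1) = - (of_real (2 * pi) * \<i> * (-1 / (z0 + 1)))" by simp
      thus ?thesis by (simp only: plus_complex.sel(1) uminus_complex.sel(1) Re_real_i_mult Im_diff_inverse)
    qed
    thus ?thesis unfolding Y0_def Y_def norm_exp_eq_Re by simp
  qed
  also have "Im z0 = sin t" by (simp add: z0_def)
  also have "Im (-1/z0) = sin t" unfolding Im_neg_inverse by (simp add: z0_def)
  also have "Im (-1/(z0+1)) = sin t / (2 + 2 * cos t)"
    unfolding Im_neg_inverse z0_def arc_norm_plus_1 by simp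
  finally have Y0: "Y0 = exp (2 * pi * (sin t / (2 + 2 * cos t) - sin t))" by (simp add: algebra_simps)
  have "sin t / (2 + 2 * cos t) < sin t / 1" using cs st by (intro divide_strict_left_mono) auto
  hence "2 * pi * (sin t / (2 + 2 * cos t) - sin t) < 0" by (simp add: mult_less_0_iff)
  hence Y01: "0 < Y0" "Y0 < 1" unfolding Y0 by simp_all
  have "(Y \<longlongrightarrow> Y0) (nhds z0)" unfolding Y_def Y0_def using nz
    by (intro tendsto_intros filterlim_ident) auto
  note EY = order_tendstoD(2)[OF this, of "(1 + Y0) / 2"]
  \<comment> \<open>Sixth powers because \<kappa> = 6l + e, the factor \<open>w z ^ e\<close> being
    at most 1. Midpoints between the value at z0 and 0 or 1 leave room for a neighbourhood.\<close>
  define \<alpha> \<beta> \<mu> where "\<alpha> = (w0 / 2) ^ 6" and "\<beta> = ((1 + w0) / 2) ^ 6" and "\<mu> = (1 + Y0) / 2"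
  have "\<forall>\<^sub>F z in nhds z0. w z > w0 / 2 \<and> w z < (1 + w0) / 2 \<and> Y z < (1 + Y0) / 2"
    using Ew EY w01 Y01 by (intro eventually_conj) auto
  hence "\<forall>\<^sub>F z in nhds z0. \<forall>\<kappa> l e m. \<kappa> = 6 * l + int e \<longrightarrow> m \<ge> 0 \<longrightarrow>
       norm (arc_third \<kappa> m z) \<le> (\<alpha> powi l + \<beta> powi l) * \<mu> ^ nat m"
  proof eventually_elim
    case (elim z)
    show ?case
    proof (intro allI impI)
      fix \<kappa> l m :: int and e :: nat assume \<kappa>: "\<kappa> = 6 * l + int e" and m: "m \<ge> 0"
      have wz: "w z > 0" "w z \<le> 1" using elim w01 by auto
      have eq: "norm (arc_third \<kappa> m z) = w z powi \<kappa> * Y z ^ nat m"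
        unfolding arc_third_def w_def Y_def by (rule norm_powi_mult_powi[OF m])
      have "w z powi \<kappa> = (w z ^ 6) powi l * w z ^ e"
        unfolding \<kappa> using wz by (simp add: power_int_add power_int_mult)
      also have "\<dots> \<le> (w z ^ 6) powi l * 1"
        using wz by (intro mult_left_mono power_le_one) (auto intro: zero_le_power_int)
      also have "\<dots> \<le> \<alpha> powi l + \<beta> powi l"
        unfolding mult_1_right \<alpha>_def \<beta>_def using elim w01
        by (intro power_int_between power_mono zero_less_power) auto
      finally have 1: "w z powi \<kappa> \<le> \<alpha> powi l + \<beta> powi l" .
      have 2: "Y z ^ nat m \<le> \<mu> ^ nat m"
        unfolding \<mu>_def using elim by (intro power_mono) (auto simp only: Y_def norm_ge_zero less_imp_le)
      have 3: "0 \<le> w z powi \<kappa>" using wz by (intro zero_le_power_int) simp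
      have 4: "0 \<le> Y z ^ nat m" unfolding Y_def by (intro zero_le_power norm_ge_zero)
      show "norm (arc_third \<kappa> m z) \<le> (\<alpha> powi l + \<beta> powi l) * \<mu> ^ nat m"
        unfolding eq using 1 2 3 4 by (intro mult_mono) auto
    qed
  qed
  moreover have "0 < \<alpha>" "\<alpha> < 1" "0 < \<beta>" "\<beta> < 1" "0 < \<mu>" "\<mu> < 1"
    using w01 Y01 unfolding \<alpha>_def \<beta>_def \<mu>_def by (auto simp: power_less_one_iff intro!: zero_less_power)
  ultimately show ?thesis using that unfolding z0_def by blast
qed

lemma arc_error_holomorphic:
  assumes "is_basis_form (2 * \<kappa>) m (basis_form (2 * \<kappa>) m)"
  shows "arc_error \<kappa> m holomorphic_on {z. Im z > 0}"
proof -
  have "basis_form (2 * \<kappa>) m holomorphic_on {z. Im z > 0}"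
    using assms unfolding is_basis_form_def weakly_holomorphic_modular_form_def upper_half_plane_def by blast
  thus ?thesis unfolding arc_error_def arc_factor_def arc_main_def
    by (intro holomorphic_intros) auto
qed

lemma eventually_at_imp_nhds:
  assumes "\<forall>\<^sub>F z in at z0. P z" "P z0"
  shows "\<forall>\<^sub>F z in nhds z0. P z"
  using assms by (simp add: eventually_nhds_conv_at)

text \<open>The contour is fixed near \<open>cis t\<close>, so compactness supplies constants for
  the kernel, and the comparison of discriminants and of heights makes the bases smaller than 1. The
  bound is first shown where the two main poles are distinct and z is not critical;
  \<open>cis t\<close> itself follows by continuity of the error.\<close>

theorem local_error_bound:
  assumes t: "pi / 2 \<le> t" "t < 2 * pi / 3"
  obtains C \<alpha> \<beta> \<mu> where "0 < C" "0 < \<alpha>" "\<alpha> < 1" "0 < \<beta>" "\<beta> < 1" "0 < \<mu>" "\<mu> < 1"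
    "\<forall>\<^sub>F z in nhds (cis t). \<forall>\<kappa> l a b m. a \<le> 2 \<longrightarrow> b \<le> 1 \<longrightarrow> 2 * \<kappa> = 12 * l + 4 * int a + 6 * int b \<longrightarrow>
       m \<ge> 0 \<longrightarrow> l + m \<ge> 0 \<longrightarrow> norm (arc_error \<kappa> m z) \<le> C * (\<alpha> powi l + \<beta> powi l) * \<mu> ^ nat m"
proof -
  define z0 where "z0 = cis t"
  note cs = arc_cos_sin[OF t]
  have st: "sin t > 0" using cs(3) by (rule less_trans[rotated]) simp
  have nz0: "z0 \<noteq> 0" and Im0: "Im z0 > 0" "Im z0 = sin t" and norm0: "norm z0 = 1"
    using st by (auto simp: z0_def)
  obtain y c where y: "y = 3/5 \<or> y = (7/10::real)" and good: "\<forall>\<^sub>F z in nhds z0. arc_good t y c z"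
    using eventually_arc_good[OF t] unfolding z0_def by blast
  define R where "R = exp (- 2 * pi * y)"
  have y0: "y > 0" using y by auto
  have R: "0 < R" "R < 1" using y0 by (auto simp: R_def)
  have good0: "arc_good t y c z0" using good by (rule eventually_nhds_x_imp_x)
  define S where "S = {r :: complex. norm r = R}"
  have S_sphere: "S = sphere 0 R" by (auto simp: S_def)
  have compS: "compact S" and neS: "S \<noteq> {}" unfolding S_sphere using R by auto
  have S1: "S \<subseteq> ball 0 1" "S \<subseteq> ball 0 1 - {0}" using R by (auto simp: S_def)
  have contJ: "continuous_on S j_q" and contE4: "continuous_on S E4_q" and contE6: "continuous_on S E6_q"
    and contD: "continuous_on S delta_q"
    using holomorphic_on_imp_continuous_on j_q_holomorphic E4_q_holomorphic E6_q_holomorphic delta_q_holomorphic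
      S1 continuous_on_subset by blast+
  have "continuous_on S (\<lambda>r. norm (j_q r - j_q (nome z0)))"
    by (intro continuous_intros contJ)
  from continuous_attains_inf[OF compS neS this] obtain r1 where
    r1: "r1 \<in> S" "\<And>r. r \<in> S \<Longrightarrow> norm (j_q r1 - j_q (nome z0)) \<le> norm (j_q r - j_q (nome z0))" by blast
  \<comment> \<open>Half the distance of j(z0) from the values on the contour: moving j(z) by less
    than d keeps the denominator of the kernel at least d.\<close>
  define d where "d = norm (j_q r1 - j_q (nome z0)) / 2"
  have d: "d > 0" using arc_good_roots(1)[OF t y good0, of r1] r1(1) by (simp add: d_def S_def R_def)
  have "continuous_on S (\<lambda>r. norm (delta_q r))" by (intro continuous_intros contD)
  from continuous_attains_inf[OF compS neS this] continuous_attains_sup[OF compS neS this]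
  obtain r2 r3 where r2: "r2 \<in> S" "\<And>r. r \<in> S \<Longrightarrow> norm (delta_q r2) \<le> norm (delta_q r)"
    and r3: "r3 \<in> S" "\<And>r. r \<in> S \<Longrightarrow> norm (delta_q r) \<le> norm (delta_q r3)" by blast
  define dmin dmax where "dmin = norm (delta_q r2)" and "dmax = norm (delta_q r3)"
  have dmin: "dmin > 0" using r2(1) S1 by (auto simp: dmin_def delta_q_eq_0_iff)
  have dmax: "dmin \<le> dmax" using r2(2)[OF r3(1)] by (simp add: dmin_def dmax_def)
  define e where "e = (\<lambda>r. (1 + norm (E4_q r)) ^ 2 * (1 + norm (E6_q r)))"
  have epos: "e r > 0" for r unfolding e_def by (intro mult_pos_pos zero_less_power add_pos_nonneg) auto
  have "continuous_on S e" unfolding e_def by (intro continuous_intros contE4 contE6)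
  from continuous_attains_sup[OF compS neS this] obtain r4 where r4: "\<And>r. r \<in> S \<Longrightarrow> e r \<le> e r4" by blast
  define cB where "cB = e r4"
  have cB: "cB > 0" unfolding cB_def by (rule epos)
  define cA where "cA = e (nome z0) + 1"
  have cA: "cA > 0" unfolding cA_def using epos[of "nome z0"] by simp
  have cont_q: "((\<lambda>z. f (nome z)) \<longlongrightarrow> f (nome z0)) (nhds z0)"
    if f: "f holomorphic_on ball 0 1" for f :: "complex \<Rightarrow> complex"
    using DERIV_isCont[OF DERIV_nome_compose[OF f Im0(1)]] by (simp add: continuous_at tendsto_nhds_iff)
  have "((\<lambda>z. e (nome z)) \<longlongrightarrow> e (nome z0)) (nhds z0)" unfolding e_def
    by (intro tendsto_intros cont_q E4_q_holomorphic E6_q_holomorphic)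
  hence F1: "\<forall>\<^sub>F z in nhds z0. e (nome z) < cA"
    by (rule order_tendstoD) (simp add: cA_def)
  define n0 where "n0 = norm (delta_q (nome z0))"
  have n0: "n0 > 0" using norm_nome_less_1[OF Im0(1)] by (simp add: n0_def delta_q_eq_0_iff)
  have n0_less: "n0 < dmin" unfolding n0_def dmin_def
  proof (rule delta_q_comparison[OF _ y])
    show "norm (nome z0) \<le> exp (- pi * sqrt 3)" using cs(3) by (intro norm_nome_le) (simp add: Im0)
    show "norm r2 = exp (- 2 * pi * y)" using r2(1) by (simp add: S_def R_def)
  qed
  \<comment> \<open>The base of the l-th power before division by |\<Delta>(r)|; the exponent 6
    comes from \<kappa> = 6l + 2a + 3b.\<close>
  define num where "num = (\<lambda>z. norm (z ^ 6 * delta_q (nome z)))"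
  have "(num \<longlongrightarrow> num z0) (nhds z0)" unfolding num_def
    by (intro tendsto_intros filterlim_ident cont_q delta_q_holomorphic)
  moreover have "num z0 = n0" by (simp add: num_def n0_def norm_mult norm_power norm0)
  ultimately have numlim: "(num \<longlongrightarrow> n0) (nhds z0)" by simp
  have F2: "\<forall>\<^sub>F z in nhds z0. num z > n0 / 2" by (rule order_tendstoD[OF numlim]) (use n0 in simp)
  have F3: "\<forall>\<^sub>F z in nhds z0. num z < (n0 + dmin) / 2"
    by (rule order_tendstoD[OF numlim]) (use n0_less in simp)
  have "((\<lambda>z :: complex. norm z) \<longlongrightarrow> norm z0) (nhds z0)" by (intro tendsto_intros filterlim_ident)
  hence F4: "\<forall>\<^sub>F z in nhds z0. norm z < 2" by (rule order_tendstoD) (simp add: norm0)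
  have "((\<lambda>z. j_q (nome z)) \<longlongrightarrow> j_q (nome z0)) (nhds z0)"
    using DERIV_isCont[OF has_field_derivative_j[OF Im0(1)]] by (simp add: continuous_at tendsto_nhds_iff)
  hence "((\<lambda>z. norm (j_q (nome z) - j_q (nome z0))) \<longlongrightarrow> norm (j_q (nome z0) - j_q (nome z0))) (nhds z0)"
    by (intro tendsto_intros)
  hence F5: "\<forall>\<^sub>F z in nhds z0. norm (j_q (nome z) - j_q (nome z0)) < d"
    by (rule order_tendstoD) (use d in simp)
  define X where "X = (\<lambda>z :: complex. norm (exp (of_real pi * \<i> * (z - 1/z))))"
  have X0: "X z0 = exp (- 2 * pi * sin t)"
  proof -
    have "Re (of_real pi * \<i> * (z0 - 1/z0)) = - pi * (Im z0 + Im (-1/z0))"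
      unfolding Re_real_i_mult Im_diff_inverse ..
    also have "Im (-1/z0) = sin t" unfolding Im_neg_inverse norm0 Im0(2) by simp
    finally show ?thesis unfolding X_def norm_exp_eq_Re Im0(2) by simp
  qed
  have "y < sin t" using good0 by (simp add: arc_good_def Im0)
  hence X0R: "X z0 < R" unfolding X0 R_def by simp
  have "(X \<longlongrightarrow> X z0) (nhds z0)" unfolding X_def using nz0 by (intro tendsto_intros filterlim_ident)
  hence F6: "\<forall>\<^sub>F z in nhds z0. X z < (X z0 + R) / 2" by (rule order_tendstoD) (use X0R in simp)
  have X0p: "X z0 > 0" by (simp add: X0)
  obtain \<alpha>3 \<beta>3 \<mu>3 where T3: "0 < \<alpha>3" "\<alpha>3 < 1" "0 < \<beta>3" "\<beta>3 < 1" "0 < \<mu>3" "\<mu>3 < 1" and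
    third: "\<forall>\<^sub>F z in nhds z0. \<forall>\<kappa> l e m. \<kappa> = 6 * l + int e \<longrightarrow> m \<ge> 0 \<longrightarrow>
       norm (arc_third \<kappa> m z) \<le> (\<alpha>3 powi l + \<beta>3 powi l) * \<mu>3 ^ nat m"
    using arc_third_bound[OF t, folded z0_def] by blast
  \<comment> \<open>Bounds for \<open>num z\<close> over |\<Delta>(r)| and for
    \<open>X z / R\<close>. That \<beta>1 < 1 is the comparison of discriminants; that \<mu>1 < 1
    says that the contour lies below the arc.\<close>
  define \<alpha>1 \<beta>1 \<mu>1 where "\<alpha>1 = n0 / 2 / dmax" and "\<beta>1 = (n0 + dmin) / 2 / dmin" and "\<mu>1 = (X z0 + R) / 2 / R"
  have T1: "0 < \<alpha>1" "\<alpha>1 < 1" "0 < \<beta>1" "\<beta>1 < 1" "0 < \<mu>1" "\<mu>1 < 1"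
    using n0 n0_less dmin dmax X0R X0p R by (auto simp: \<alpha>1_def \<beta>1_def \<mu>1_def)
  \<comment> \<open>2^7 bounds |z|^(2a + 3b) as |z| < 2. The leading R comes from the length of the
    circle, whose 2\<pi> cancels against 1/(2\<pi>i).\<close>
  define C1 where "C1 = R * (2 ^ 7 * cA * cB / (dmin * R * d))"
  have C1: "C1 > 0" unfolding C1_def using R cA cB dmin d by (intro mult_pos_pos divide_pos_pos) auto
  \<comment> \<open>The factor 2 in C arises because each of the two sums of powers is at most twice
    the sum for the enlarged interval.\<close>
  define \<alpha> \<beta> \<mu> C where "\<alpha> = min (min \<alpha>1 \<beta>1) (min \<alpha>3 \<beta>3)" and "\<beta> = max (max \<alpha>1 \<beta>1) (max \<alpha>3 \<beta>3)" and "\<mu> = max \<mu>1 \<mu>3" and "C = 2 * (C1 + 1)"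
  have fin: "0 < C" "0 < \<alpha>" "\<alpha> < 1" "0 < \<beta>" "\<beta> < 1" "0 < \<mu>" "\<mu> < 1"
    using C1 T1 T3 by (auto simp: \<alpha>_def \<beta>_def \<mu>_def C_def)
  define Q where "Q = (\<lambda>z. \<forall>\<kappa> l a b m. a \<le> 2 \<longrightarrow> b \<le> 1 \<longrightarrow> 2 * \<kappa> = 12 * l + 4 * int a + 6 * int b \<longrightarrow>
       m \<ge> 0 \<longrightarrow> l + m \<ge> 0 \<longrightarrow> norm (arc_error \<kappa> m z) \<le> C * (\<alpha> powi l + \<beta> powi l) * \<mu> ^ nat m)"
  have "\<forall>\<^sub>F z in nhds z0. arc_good t y c z \<and> e (nome z) < cA \<and> num z > n0 / 2 \<and> num z < (n0 + dmin) / 2 \<and>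
     norm z < 2 \<and> norm (j_q (nome z) - j_q (nome z0)) < d \<and> X z < (X z0 + R) / 2 \<and>
     (\<forall>\<kappa> l e m. \<kappa> = 6 * l + int e \<longrightarrow> m \<ge> 0 \<longrightarrow> norm (arc_third \<kappa> m z) \<le> (\<alpha>3 powi l + \<beta>3 powi l) * \<mu>3 ^ nat m)"
    by (intro eventually_conj good F1 F2 F3 F4 F5 F6 third)
  hence "\<forall>\<^sub>F z in at z0. arc_good t y c z \<and> e (nome z) < cA \<and> num z > n0 / 2 \<and> num z < (n0 + dmin) / 2 \<and>
     norm z < 2 \<and> norm (j_q (nome z) - j_q (nome z0)) < d \<and> X z < (X z0 + R) / 2 \<and>
     (\<forall>\<kappa> l e m. \<kappa> = 6 * l + int e \<longrightarrow> m \<ge> 0 \<longrightarrow> norm (arc_third \<kappa> m z) \<le> (\<alpha>3 powi l + \<beta>3 powi l) * \<mu>3 ^ nat m)"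
    unfolding eventually_at_filter by (rule eventually_mono) simp
  moreover have "\<forall>\<^sub>F z in at z0. nome z \<noteq> nome (-1/z)"
    unfolding z0_def by (rule eventually_nome_inversion_neq[OF t])
  moreover note eventually_noncritical[OF Im0(1)]
  ultimately have evQ: "\<forall>\<^sub>F z in at z0. Q z"
  proof eventually_elim
    case (elim z)
    hence g: "arc_good t y c z" and ez: "e (nome z) < cA" and num: "num z > n0 / 2" "num z < (n0 + dmin) / 2"
      and z2: "norm z < 2" and jd: "norm (j_q (nome z) - j_q (nome z0)) < d" and Xz: "X z < (X z0 + R) / 2"
      and thirdz: "\<And>\<kappa> l e m. \<kappa> = 6 * l + int e \<Longrightarrow> m \<ge> 0 \<Longrightarrow> norm (arc_third \<kappa> m z) \<le> (\<alpha>3 powi l + \<beta>3 powi l) * \<mu>3 ^ nat m"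
      and ne: "nome z \<noteq> nome (-1/z)" and crit: "E4_q (nome z) \<noteq> 0" "E6_q (nome z) \<noteq> 0"
      by blast+
    note roots = arc_good_roots[OF t y g, folded R_def]
    have Imz: "Im z > 0" using g y0 by (simp add: arc_good_def)
    hence nz: "z \<noteq> 0" by auto
    have Dz: "delta_q (nome z) \<noteq> 0" using norm_nome_less_1[OF Imz] by (simp add: delta_q_eq_0_iff)
    show "Q z" unfolding Q_def
    proof (intro allI impI)
      fix \<kappa> l m :: int and a b :: nat
      assume ab: "a \<le> 2" "b \<le> 1" and k: "2 * \<kappa> = 12 * l + 4 * int a + 6 * int b"
        and m: "m \<ge> 0" "l + m \<ge> 0"
      have \<kappa>: "\<kappa> = 6 * l + int (2 * a + 3 * b)" using k by simp
      have wl: "weight_ell (2 * \<kappa>) = l"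
      proof (rule weight_ell_unique)
        have "a = 0 \<or> a = 1 \<or> a = 2" "b = 0 \<or> b = 1" using ab by auto
        thus "2 * \<kappa> - 12 * l \<in> {0, 4, 6, 8, 10, 14}" unfolding k by auto
      qed
      define \<Phi> where "\<Phi> = (\<lambda>r. delta_q r powi l * eis_q a b r)"
      define K where "K = (\<lambda>r. eis_q (2 - a) (1 - b) r * delta_q r powi (- l - 1) * r powi (- m - 1) / (j_q r - j_q (nome z)))"
      note formula = arc_error_formula[OF wl k ab m(2) Imz crit R roots(1,2) ne roots(3,4)]
      have Kint: "K contour_integrable_on circlepath 0 R" unfolding K_def by (rule formula(1))
      define I where "I = contour_integral (circlepath 0 R) K"
      have err: "arc_error \<kappa> m z = arc_factor \<kappa> m z * (\<Phi> (nome z) / (2 * of_real pi * \<i>) * I)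
           + (if c then arc_third \<kappa> m z else 0)"
        unfolding I_def K_def \<Phi>_def by (rule formula(2))
      define G where "G = norm (arc_factor \<kappa> m z * \<Phi> (nome z))"
      have "\<Phi> (nome z) \<noteq> 0" using crit Dz by (simp add: \<Phi>_def eis_q_def)
      moreover have "arc_factor \<kappa> m z \<noteq> 0" using nz by (simp add: arc_factor_def)
      ultimately have G: "G > 0" by (simp add: G_def)
      define P where "P = (\<alpha>1 powi l + \<beta>1 powi l) * \<mu>1 ^ nat m"
      have P0: "P \<ge> 0" unfolding P_def using T1 by (intro mult_nonneg_nonneg add_nonneg_nonneg zero_le_power_int zero_le_power) auto
      have GK: "G * norm (K r) \<le> C1 / R * P" if r: "norm r = R" for r
      proof -
        have rS: "r \<in> S" using r by (simp add: S_def)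
        define J where "J = norm (j_q r - j_q (nome z))"
        have "2 * d \<le> norm (j_q r - j_q (nome z0))" using r1(2)[OF rS] by (simp add: d_def)
        also have "\<dots> \<le> J + norm (j_q (nome z) - j_q (nome z0))"
          unfolding J_def using norm_triangle_ineq[of "j_q r - j_q (nome z)" "j_q (nome z) - j_q (nome z0)"] by simp
        finally have Jd: "d \<le> J" using jd by simp
        hence J: "J > 0" using d by simp
        have D': "dmin \<le> norm (delta_q r)" "norm (delta_q r) \<le> dmax" using r2(2)[OF rS] r3(2)[OF rS] by (auto simp: dmin_def dmax_def)
        have "G * norm (K r) = norm z powi \<kappa> * X z ^ nat m * (norm (delta_q (nome z)) powi l * norm (eis_q a b (nome z)))
            * (norm (eis_q (2 - a) (1 - b) r) * norm (delta_q r) powi (- l - 1) * R powi (- int (nat m) - 1) / J)"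
        proof -
          have "norm (arc_factor \<kappa> m z) = norm z powi \<kappa> * X z ^ nat m"
            unfolding arc_factor_def X_def by (rule norm_powi_mult_powi[OF m(1)])
          moreover have "norm (\<Phi> (nome z)) = norm (delta_q (nome z)) powi l * norm (eis_q a b (nome z))"
            unfolding \<Phi>_def norm_mult norm_power_int ..
          ultimately have "G = norm z powi \<kappa> * X z ^ nat m * (norm (delta_q (nome z)) powi l * norm (eis_q a b (nome z)))"
            unfolding G_def norm_mult by simp
          moreover have "norm (K r) = norm (eis_q (2 - a) (1 - b) r) * norm (delta_q r) powi (- l - 1) * R powi (- int (nat m) - 1) / J"
            unfolding K_def J_def norm_divide norm_mult norm_power_int r using m(1) by simp
          ultimately show ?thesis by simp
        qed
        also have "\<dots> = (norm z ^ (2 * a + 3 * b) * norm (eis_q a b (nome z)) * norm (eis_q (2 - a) (1 - b) r) / (norm (delta_q r) * R * J))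
            * (norm z ^ 6 * norm (delta_q (nome z)) / norm (delta_q r)) powi l * (X z / R) ^ nat m"
          by (rule kernel_algebra[OF _ _ _ R(1) J \<kappa>]) (use nz Dz D' dmin in auto)
        also have "\<dots> \<le> (2 ^ 7 * cA * cB / (dmin * R * d)) * (\<alpha>1 powi l + \<beta>1 powi l) * \<mu>1 ^ nat m"
        proof (intro mult_mono)
          have "norm z ^ (2 * a + 3 * b) \<le> 2 ^ (2 * a + 3 * b)" using z2 by (intro power_mono) auto
          also have "\<dots> \<le> 2 ^ 7" using ab by (intro power_increasing) auto
          finally have 1: "norm z ^ (2 * a + 3 * b) \<le> 2 ^ 7" .
          have 2: "norm (eis_q a b (nome z)) \<le> cA"
            using norm_eis_q_le[OF ab, of "nome z"] ez by (simp add: e_def)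
          have 3: "norm (eis_q (2 - a) (1 - b) r) \<le> cB"
            using norm_eis_q_le[of "2 - a" "1 - b" r] r4[OF rS] by (simp add: e_def cB_def)
          have 4: "dmin * R * d \<le> norm (delta_q r) * R * J" "dmin * R * d > 0"
            using D'(1) Jd R dmin d by (auto intro!: mult_mono mult_nonneg_nonneg)
          show "norm z ^ (2 * a + 3 * b) * norm (eis_q a b (nome z)) * norm (eis_q (2 - a) (1 - b) r) / (norm (delta_q r) * R * J)
             \<le> 2 ^ 7 * cA * cB / (dmin * R * d)"
          proof (rule frac_le[OF _ _ 4(2,1)])
            show "norm z ^ (2 * a + 3 * b) * norm (eis_q a b (nome z)) * norm (eis_q (2 - a) (1 - b) r) \<le> 2 ^ 7 * cA * cB"
              using 1 2 3 cA by (intro mult_mono) auto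
          qed (use cA cB in simp)
          have numeq: "norm z ^ 6 * norm (delta_q (nome z)) = num z" by (simp add: num_def norm_mult norm_power)
          have "\<alpha>1 \<le> num z / norm (delta_q r)" unfolding \<alpha>1_def
            using num n0 D' dmin by (intro frac_le) auto
          moreover have "num z / norm (delta_q r) \<le> \<beta>1" unfolding \<beta>1_def
            using num n0 D' dmin by (intro frac_le) auto
          ultimately show "(norm z ^ 6 * norm (delta_q (nome z)) / norm (delta_q r)) powi l \<le> \<alpha>1 powi l + \<beta>1 powi l"
            unfolding numeq using T1(1) by (intro power_int_between) auto
          show "(X z / R) ^ nat m \<le> \<mu>1 ^ nat m"
            unfolding \<mu>1_def using Xz R by (intro power_mono divide_right_mono) (auto simp: X_def)
        qed (use cA cB dmin d R T1 in \<open>auto simp: X_def intro!: mult_nonneg_nonneg add_nonneg_nonneg zero_le_power_int\<close>)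
        also have "\<dots> = C1 / R * P" using R by (simp add: C1_def P_def mult.assoc)
        finally show ?thesis .
      qed
      have "norm I \<le> (C1 / R * P / G) * (2 * pi * R)" unfolding I_def
      proof (rule has_contour_integral_bound_circlepath[OF has_contour_integral_integral[OF Kint] _ R(1)])
        show "0 \<le> C1 / R * P / G" using C1 R P0 G by simp
        show "norm (K r) \<le> C1 / R * P / G" if "norm (r - 0) = R" for r
        proof -
          have "norm r = R" using that by simp
          from GK[OF this] show ?thesis unfolding pos_le_divide_eq[OF G] mult.commute[of "norm (K r)" G] .
        qed
      qed
      hence "G * norm I \<le> C1 * P * (2 * pi)" using G R by (simp add: field_simps)
      moreover have "norm (arc_factor \<kappa> m z * (\<Phi> (nome z) / (2 * of_real pi * \<i>) * I)) = G * norm I / (2 * pi)"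
        by (simp add: G_def norm_mult norm_divide)
      ultimately have b1: "norm (arc_factor \<kappa> m z * (\<Phi> (nome z) / (2 * of_real pi * \<i>) * I)) \<le> C1 * P"
        by (simp add: divide_le_eq)
      define P3 where "P3 = (\<alpha>3 powi l + \<beta>3 powi l) * \<mu>3 ^ nat m"
      have P30: "P3 \<ge> 0" unfolding P3_def using T3 by (intro mult_nonneg_nonneg add_nonneg_nonneg zero_le_power_int zero_le_power) auto
      have b3: "norm (if c then arc_third \<kappa> m z else 0) \<le> P3"
        using thirdz[OF \<kappa> m(1)] P30 by (simp add: P3_def)
      define PP where "PP = (\<alpha> powi l + \<beta> powi l) * \<mu> ^ nat m"
      have btw: "x powi l \<le> \<alpha> powi l + \<beta> powi l" if "\<alpha> \<le> x" "x \<le> \<beta>" for x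
        by (rule power_int_between[OF fin(2) that])
      have rng: "\<alpha> \<le> \<alpha>1" "\<alpha>1 \<le> \<beta>" "\<alpha> \<le> \<beta>1" "\<beta>1 \<le> \<beta>" "\<alpha> \<le> \<alpha>3" "\<alpha>3 \<le> \<beta>" "\<alpha> \<le> \<beta>3" "\<beta>3 \<le> \<beta>"
        unfolding \<alpha>_def \<beta>_def by auto
      have "\<alpha>1 powi l + \<beta>1 powi l \<le> 2 * (\<alpha> powi l + \<beta> powi l)"
        using btw[OF rng(1,2)] btw[OF rng(3,4)] by simp
      hence "P \<le> (2 * (\<alpha> powi l + \<beta> powi l)) * \<mu> ^ nat m"
        unfolding P_def using T1 fin
        by (intro mult_mono power_mono mult_nonneg_nonneg add_nonneg_nonneg zero_le_power_int) (auto simp: \<mu>_def)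
      hence PPP: "P \<le> 2 * PP" unfolding PP_def mult.assoc .
      have "\<alpha>3 powi l + \<beta>3 powi l \<le> 2 * (\<alpha> powi l + \<beta> powi l)"
        using btw[OF rng(5,6)] btw[OF rng(7,8)] by simp
      hence "P3 \<le> (2 * (\<alpha> powi l + \<beta> powi l)) * \<mu> ^ nat m"
        unfolding P3_def using T3 fin
        by (intro mult_mono power_mono mult_nonneg_nonneg add_nonneg_nonneg zero_le_power_int) (auto simp: \<mu>_def)
      hence P3P: "P3 \<le> 2 * PP" unfolding PP_def mult.assoc .
      have "norm (arc_error \<kappa> m z) \<le> C1 * P + P3"
        unfolding err using b1 b3 by (intro norm_triangle_mono)
      also have "\<dots> \<le> C1 * (2 * PP) + 2 * PP"
        using PPP P3P C1 by (intro add_mono mult_left_mono) auto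
      also have "\<dots> = C * PP" by (simp add: C_def algebra_simps)
      finally show "norm (arc_error \<kappa> m z) \<le> C * (\<alpha> powi l + \<beta> powi l) * \<mu> ^ nat m"
        by (simp add: PP_def mult.assoc)
    qed
  qed
  have "Q z0" unfolding Q_def
  proof (intro allI impI)
    fix \<kappa> l m :: int and a b :: nat
    assume ab: "a \<le> 2" "b \<le> 1" and k: "2 * \<kappa> = 12 * l + 4 * int a + 6 * int b"
      and m: "m \<ge> 0" "l + m \<ge> 0"
    have wl: "weight_ell (2 * \<kappa>) = l"
    proof (rule weight_ell_unique)
      have "a = 0 \<or> a = 1 \<or> a = 2" "b = 0 \<or> b = 1" using ab by auto
      thus "2 * \<kappa> - 12 * l \<in> {0, 4, 6, 8, 10, 14}" unfolding k by auto
    qed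
    have "is_basis_form (2 * \<kappa>) m (basis_form (2 * \<kappa>) m)"
      by (rule basis_form_formula[OF wl k m(2)])
    from holomorphic_on_imp_continuous_on[OF arc_error_holomorphic[OF this]]
    have "isCont (arc_error \<kappa> m) z0"
      using Im0(1) open_Im_pos by (simp add: continuous_on_eq_continuous_at)
    hence "(arc_error \<kappa> m \<longlongrightarrow> arc_error \<kappa> m z0) (at z0)" by (simp add: isCont_def)
    hence "((\<lambda>z. norm (arc_error \<kappa> m z)) \<longlongrightarrow> norm (arc_error \<kappa> m z0)) (at z0)" by (rule tendsto_norm)
    moreover have "\<forall>\<^sub>F z in at z0. norm (arc_error \<kappa> m z) \<le> C * (\<alpha> powi l + \<beta> powi l) * \<mu> ^ nat m"
      using evQ by (rule eventually_mono) (use ab k m in \<open>auto simp: Q_def\<close>)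
    ultimately show "norm (arc_error \<kappa> m z0) \<le> C * (\<alpha> powi l + \<beta> powi l) * \<mu> ^ nat m"
      by (rule tendsto_upperbound) simp
  qed
  with evQ have "\<forall>\<^sub>F z in nhds z0. Q z" by (rule eventually_at_imp_nhds)
  thus ?thesis using that[OF fin] unfolding Q_def z0_def by blast
qed

section \<open>Bounds uniform on compact parts of the arc\<close>

lemma compact_eventually_uniform:
  fixes S :: "'a :: topological_space set"
  assumes "compact S"
    and "\<And>x. x \<in> S \<Longrightarrow> \<exists>U. open U \<and> x \<in> U \<and> (\<forall>\<^sub>F i in F. \<forall>y\<in>U. P i y)"
  shows "\<forall>\<^sub>F i in F. \<forall>y\<in>S. P i y"
proof -
  define \<U> where "\<U> = {U. open U \<and> (\<forall>\<^sub>F i in F. \<forall>y\<in>U. P i y)}"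
  have "S \<subseteq> \<Union>\<U>" using assms(2) unfolding \<U>_def by blast
  moreover have "\<And>U. U \<in> \<U> \<Longrightarrow> open U" unfolding \<U>_def by blast
  ultimately obtain \<V> where V: "\<V> \<subseteq> \<U>" "finite \<V>" "S \<subseteq> \<Union>\<V>"
    using compactE[OF assms(1)] by metis
  have "\<forall>\<^sub>F i in F. \<forall>U\<in>\<V>. \<forall>y\<in>U. P i y"
    by (rule eventually_ball_finite[OF V(2)]) (use V(1) in \<open>auto simp: \<U>_def\<close>)
  thus ?thesis by (rule eventually_mono) (use V(3) in blast)
qed

text \<open>Dominates the phase speed up to a constant factor; the summand 1 keeps it at least
  1.\<close>

definition arc_size :: "int \<Rightarrow> int \<Rightarrow> real" where
  "arc_size \<kappa> m = \<bar>of_int \<kappa>\<bar> + \<bar>of_int m\<bar> + 1"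

text \<open>A finite cover by discs with local bounds, and Cauchy's inequality on discs of half the
  radius for the derivative. The filter is arbitrary so that growing weight and growing order are
  both instances; \<alpha> and \<mu> depend on the disc, hence decay is assumed for all of
  them.\<close>

lemma uniform_error:
  fixes \<kappa> m :: "'i \<Rightarrow> int" and T \<eta> :: real
  assumes T: "T < 2 * pi / 3" and \<eta>: "\<eta> > 0"
    and m: "\<forall>\<^sub>F i in F. m i \<ge> 0 \<and> weight_ell (2 * \<kappa> i) + m i \<ge> 0"
    and lim: "\<And>\<alpha> \<mu>. 0 < \<alpha> \<Longrightarrow> \<alpha> < 1 \<Longrightarrow> 0 < \<mu> \<Longrightarrow> \<mu> < 1 \<Longrightarrow>
       ((\<lambda>i. \<alpha> powi weight_ell (2 * \<kappa> i) * \<mu> ^ nat (m i) * arc_size (\<kappa> i) (m i)) \<longlongrightarrow> 0) F"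
  shows "\<forall>\<^sub>F i in F. \<forall>t\<in>{pi/2..T}. norm (arc_error (\<kappa> i) (m i) (cis t)) * arc_size (\<kappa> i) (m i) \<le> \<eta> \<and>
           norm (deriv (arc_error (\<kappa> i) (m i)) (cis t)) \<le> \<eta>"
proof (rule compact_eventually_uniform)
  fix t assume "t \<in> {pi/2..T}"
  hence t: "pi/2 \<le> t" "t < 2 * pi / 3" using T by auto
  obtain C \<alpha> \<beta> \<mu> where C: "0 < C" "0 < \<alpha>" "\<alpha> < 1" "0 < \<beta>" "\<beta> < 1" "0 < \<mu>" "\<mu> < 1" and
    ev: "\<forall>\<^sub>F z in nhds (cis t). \<forall>\<kappa> l a b m. a \<le> 2 \<longrightarrow> b \<le> 1 \<longrightarrow> 2 * \<kappa> = 12 * l + 4 * int a + 6 * int b \<longrightarrow>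
       m \<ge> 0 \<longrightarrow> l + m \<ge> 0 \<longrightarrow> norm (arc_error \<kappa> m z) \<le> C * (\<alpha> powi l + \<beta> powi l) * \<mu> ^ nat m"
    by (rule local_error_bound[OF t]) 
  have "sin t > 0" using arc_cos_sin(3)[OF t] by (rule less_trans[rotated]) simp
  hence "((\<lambda>z. Im z) \<longlongrightarrow> sin t) (nhds (cis t))" using tendsto_Im[OF filterlim_ident, of "cis t"] by simp
  from order_tendstoD(1)[OF this \<open>sin t > 0\<close>] ev
  have "\<forall>\<^sub>F z in nhds (cis t). Im z > 0 \<and> (\<forall>\<kappa> l a b m. a \<le> 2 \<longrightarrow> b \<le> 1 \<longrightarrow> 2 * \<kappa> = 12 * l + 4 * int a + 6 * int b \<longrightarrow>
       m \<ge> 0 \<longrightarrow> l + m \<ge> 0 \<longrightarrow> norm (arc_error \<kappa> m z) \<le> C * (\<alpha> powi l + \<beta> powi l) * \<mu> ^ nat m)"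
    by (rule eventually_conj)
  then obtain d where d: "d > 0" and bd: "\<And>z. dist z (cis t) < d \<Longrightarrow> Im z > 0"
    "\<And>z \<kappa> l a b m. dist z (cis t) < d \<Longrightarrow> a \<le> 2 \<Longrightarrow> b \<le> 1 \<Longrightarrow> 2 * \<kappa> = 12 * l + 4 * int a + 6 * int b \<Longrightarrow>
       m \<ge> 0 \<Longrightarrow> l + m \<ge> 0 \<Longrightarrow> norm (arc_error \<kappa> m z) \<le> C * (\<alpha> powi l + \<beta> powi l) * \<mu> ^ nat m"
    unfolding eventually_nhds_metric by blast
  define B where "B = (\<lambda>i. C * (\<alpha> powi weight_ell (2 * \<kappa> i) + \<beta> powi weight_ell (2 * \<kappa> i)) * \<mu> ^ nat (m i))"
  have "((\<lambda>i. C * (\<alpha> powi weight_ell (2 * \<kappa> i) * \<mu> ^ nat (m i) * arc_size (\<kappa> i) (m i)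
         + \<beta> powi weight_ell (2 * \<kappa> i) * \<mu> ^ nat (m i) * arc_size (\<kappa> i) (m i))) \<longlongrightarrow> C * (0 + 0)) F"
    by (intro tendsto_intros lim C)
  hence Blim: "((\<lambda>i. B i * arc_size (\<kappa> i) (m i)) \<longlongrightarrow> 0) F"
    by (simp add: B_def algebra_simps)
  have "\<forall>\<^sub>F i in F. B i * arc_size (\<kappa> i) (m i) < min \<eta> (\<eta> * (d / 2))"
    by (rule order_tendstoD[OF Blim]) (use \<eta> d in auto)
  with m have "\<forall>\<^sub>F i in F. \<forall>z\<in>ball (cis t) (d/2). norm (arc_error (\<kappa> i) (m i) z) * arc_size (\<kappa> i) (m i) \<le> \<eta> \<and>
           norm (deriv (arc_error (\<kappa> i) (m i)) z) \<le> \<eta>"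
  proof eventually_elim
    case (elim i)
    define l where "l = weight_ell (2 * \<kappa> i)"
    obtain a b where ab: "a \<le> 2" "b \<le> 1" "2 * \<kappa> i = 12 * l + 4 * int a + 6 * int b"
      using even_weight_decomp[of "2 * \<kappa> i"] unfolding l_def by auto
    have m0: "m i \<ge> 0" "l + m i \<ge> 0" using elim by (auto simp: l_def)
    have Bb: "norm (arc_error (\<kappa> i) (m i) z) \<le> B i" if "dist z (cis t) < d" for z
      using bd(2)[OF that ab m0] by (simp add: B_def l_def)
    have size1: "arc_size (\<kappa> i) (m i) \<ge> 1" by (simp add: arc_size_def)
    have B0: "B i \<ge> 0" using order_trans[OF norm_ge_zero Bb[of "cis t"]] d by simp
    have B1: "B i \<le> B i * arc_size (\<kappa> i) (m i)" using mult_left_mono[OF size1 B0] by simp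
    have "is_basis_form (2 * \<kappa> i) (m i) (basis_form (2 * \<kappa> i) (m i))"
      by (rule basis_form_formula[OF l_def[symmetric] ab(3) m0(2)])
    note hol = arc_error_holomorphic[OF this]
    show ?case
    proof
      fix z assume z: "z \<in> ball (cis t) (d/2)"
      have zd: "dist w (cis t) < d" if "w \<in> cball z (d/2)" for w
        using z that dist_triangle[of w "cis t" z] by (simp add: dist_commute)
      have "z \<in> cball z (d/2)" using d by simp
      hence "norm (arc_error (\<kappa> i) (m i) z) \<le> B i" by (intro Bb zd)
      hence 1: "norm (arc_error (\<kappa> i) (m i) z) * arc_size (\<kappa> i) (m i) \<le> B i * arc_size (\<kappa> i) (m i)"
        using size1 by (intro mult_right_mono) auto
      have sub: "cball z (d/2) \<subseteq> {z. Im z > 0}" using zd bd(1) by auto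
      have "norm ((deriv ^^ 1) (arc_error (\<kappa> i) (m i)) z) \<le> fact 1 * B i / (d/2) ^ 1"
      proof (rule Cauchy_inequality)
        show "arc_error (\<kappa> i) (m i) holomorphic_on ball z (d/2)"
          by (rule holomorphic_on_subset[OF hol order_trans[OF ball_subset_cball sub]])
        show "continuous_on (cball z (d/2)) (arc_error (\<kappa> i) (m i))"
          by (rule continuous_on_subset[OF holomorphic_on_imp_continuous_on[OF hol] sub])
        show "norm (arc_error (\<kappa> i) (m i) w) \<le> B i" if "norm (z - w) = d/2" for w
          by (intro Bb zd) (use that in \<open>simp add: dist_norm\<close>)
      qed (use d in auto)
      hence "norm (deriv (arc_error (\<kappa> i) (m i)) z) \<le> B i / (d/2)" by simp
      also have "\<dots> \<le> \<eta>" using elim B1 d by (simp add: divide_le_eq)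
      finally show "norm (arc_error (\<kappa> i) (m i) z) * arc_size (\<kappa> i) (m i) \<le> \<eta> \<and>
           norm (deriv (arc_error (\<kappa> i) (m i)) z) \<le> \<eta>" using 1 elim by auto
    qed
  qed
  hence "\<forall>\<^sub>F i in F. \<forall>s\<in>cis -` ball (cis t) (d/2). norm (arc_error (\<kappa> i) (m i) (cis s)) * arc_size (\<kappa> i) (m i) \<le> \<eta> \<and>
           norm (deriv (arc_error (\<kappa> i) (m i)) (cis s)) \<le> \<eta>"
    by (rule eventually_mono) auto
  moreover have "open (cis -` ball (cis t) (d/2))"
    by (intro open_vimage open_ball continuous_intros)
  moreover have "t \<in> cis -` ball (cis t) (d/2)" using d by simp
  ultimately show "\<exists>U. open U \<and> t \<in> U \<and> (\<forall>\<^sub>F i in F. \<forall>s\<in>U. norm (arc_error (\<kappa> i) (m i) (cis s)) * arc_size (\<kappa> i) (m i) \<le> \<eta> \<and>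
           norm (deriv (arc_error (\<kappa> i) (m i)) (cis s)) \<le> \<eta>)" by blast
qed auto

lemma weight_ell_bounds:
  assumes "even k"
  shows "12 * weight_ell k \<le> k" "k \<le> 12 * weight_ell k + 14"
proof -
  obtain a b where "a \<le> 2" "b \<le> 1" "k = 12 * weight_ell k + 4 * int a + 6 * int b"
    by (rule even_weight_decomp[OF assms])
  thus "12 * weight_ell k \<le> k" "k \<le> 12 * weight_ell k + 14" by auto
qed

lemma linear_times_power_tendsto_0:
  fixes x A B :: real
  assumes "0 < x" "x < 1" and g: "filterlim g at_top F"
  shows "((\<lambda>i. (A * real (g i) + B) * x ^ g i) \<longlongrightarrow> 0) F"
proof -
  have "(\<lambda>n. A * (real n * x ^ n) + B * x ^ n) \<longlonglongrightarrow> A * 0 + B * 0"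
    using assms by (intro tendsto_intros powser_times_n_limit_0 LIMSEQ_realpow_zero) auto
  hence "(\<lambda>n. (A * real n + B) * x ^ n) \<longlonglongrightarrow> 0" by (simp add: algebra_simps)
  thus ?thesis by (rule filterlim_compose[OF _ g])
qed

lemma filterlim_nat_at_top: "filterlim nat at_top at_top"
  unfolding filterlim_at_top
proof
  fix Z show "\<forall>\<^sub>F x in at_top. Z \<le> nat x"
    using eventually_ge_at_top[of "int Z"] by eventually_elim auto
qed

text \<open>Since \<kappa> \<le> 6l + 7, the size is bounded linearly in l and \<alpha>^l outweighs
  it; \<mu>^m is merely bounded by 1.\<close>

lemma uniform_error_weight:
  assumes T: "T < 2 * pi / 3" and \<eta>: "\<eta> > 0" and m: "m \<ge> 0"
  shows "\<forall>\<^sub>F \<kappa> in at_top. \<forall>t\<in>{pi/2..T}. norm (arc_error \<kappa> m (cis t)) * arc_size \<kappa> m \<le> \<eta> \<and>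
           norm (deriv (arc_error \<kappa> m) (cis t)) \<le> \<eta>"
proof (rule uniform_error[OF T \<eta>])
  show "\<forall>\<^sub>F \<kappa> in at_top. m \<ge> 0 \<and> weight_ell (2 * \<kappa>) + m \<ge> 0"
    using eventually_ge_at_top[of 7]
  proof eventually_elim
    case (elim \<kappa>)
    have "12 * weight_ell (2 * \<kappa>) + 14 \<ge> 14" using weight_ell_bounds(2)[of "2 * \<kappa>"] elim by simp
    thus ?case using m by simp
  qed
  fix \<alpha> \<mu> :: real assume \<alpha>: "0 < \<alpha>" "\<alpha> < 1" and \<mu>: "0 < \<mu>" "\<mu> < 1"
  have fl: "filterlim (\<lambda>\<kappa>. nat (weight_ell (2 * \<kappa>))) at_top at_top"
    unfolding filterlim_at_top
  proof
    fix Z :: nat show "\<forall>\<^sub>F \<kappa> in at_top. Z \<le> nat (weight_ell (2 * \<kappa>))"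
      using eventually_ge_at_top[of "6 * int Z + 7"]
    proof eventually_elim
      case (elim \<kappa>)
      thus ?case using weight_ell_bounds(2)[of "2 * \<kappa>"] by simp
    qed
  qed
  have lim: "((\<lambda>\<kappa>. (6 * real (nat (weight_ell (2 * \<kappa>))) + (8 + \<bar>of_int m\<bar>)) * \<alpha> ^ nat (weight_ell (2 * \<kappa>))) \<longlongrightarrow> 0) at_top"
    by (rule linear_times_power_tendsto_0[OF \<alpha> fl])
  show "((\<lambda>\<kappa>. \<alpha> powi weight_ell (2 * \<kappa>) * \<mu> ^ nat m * arc_size \<kappa> m) \<longlongrightarrow> 0) at_top"
  proof (rule tendsto_0_le[OF lim, of _ 1])
    show "\<forall>\<^sub>F \<kappa> in at_top. norm (\<alpha> powi weight_ell (2 * \<kappa>) * \<mu> ^ nat m * arc_size \<kappa> m)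
       \<le> norm ((6 * real (nat (weight_ell (2 * \<kappa>))) + (8 + \<bar>of_int m\<bar>)) * \<alpha> ^ nat (weight_ell (2 * \<kappa>))) * 1"
      using eventually_ge_at_top[of 7]
    proof eventually_elim
      case (elim \<kappa>)
      define l where "l = weight_ell (2 * \<kappa>)"
      have l: "l \<ge> 0" "\<kappa> \<le> 6 * l + 7" using weight_ell_bounds(2)[of "2 * \<kappa>"] elim by (auto simp: l_def)
      have "\<bar>of_int \<kappa> :: real\<bar> \<le> 6 * real (nat l) + 7" using l elim by simp
      hence size: "arc_size \<kappa> m \<le> 6 * real (nat l) + (8 + \<bar>of_int m\<bar>)" by (simp add: arc_size_def)
      have size0: "arc_size \<kappa> m \<ge> 0" by (simp add: arc_size_def)
      have "\<alpha> powi l * \<mu> ^ nat m * arc_size \<kappa> m \<le> \<alpha> powi l * 1 * (6 * real (nat l) + (8 + \<bar>of_int m\<bar>))"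
        using \<alpha> \<mu> size size0 by (intro mult_mono power_le_one) (auto intro!: mult_nonneg_nonneg zero_le_power_int)
      also have "\<dots> = (6 * real (nat l) + (8 + \<bar>of_int m\<bar>)) * \<alpha> ^ nat l"
        using l by (simp add: power_int_def)
      also have "\<dots> \<le> norm ((6 * real (nat l) + (8 + \<bar>of_int m\<bar>)) * \<alpha> ^ nat l) * 1"
        unfolding mult_1_right real_norm_def by (rule abs_ge_self)
      moreover have "\<alpha> powi l * \<mu> ^ nat m * arc_size \<kappa> m \<ge> 0"
        using \<alpha> \<mu> size0 by (intro mult_nonneg_nonneg zero_le_power_int) auto
      ultimately show ?case unfolding l_def[symmetric] by (simp only: real_norm_def abs_of_nonneg)
    qed
  qed
qed

text \<open>The weight is fixed, so \<alpha>^l is a constant, possibly large, and the decay comes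
  from \<mu>^m.\<close>

lemma uniform_error_order:
  assumes T: "T < 2 * pi / 3" and \<eta>: "\<eta> > 0"
  shows "\<forall>\<^sub>F m in at_top. \<forall>t\<in>{pi/2..T}. norm (arc_error \<kappa> m (cis t)) * arc_size \<kappa> m \<le> \<eta> \<and>
           norm (deriv (arc_error \<kappa> m) (cis t)) \<le> \<eta>"
proof (rule uniform_error[OF T \<eta>])
  show "\<forall>\<^sub>F m in at_top. m \<ge> 0 \<and> weight_ell (2 * \<kappa>) + m \<ge> 0"
    using eventually_ge_at_top[of "\<bar>weight_ell (2 * \<kappa>)\<bar>"] by eventually_elim auto
  fix \<alpha> \<mu> :: real assume \<alpha>: "0 < \<alpha>" "\<alpha> < 1" and \<mu>: "0 < \<mu>" "\<mu> < 1"
  have A: "((\<lambda>m. \<alpha> powi weight_ell (2 * \<kappa>) * ((1 * real (nat m) + (\<bar>of_int \<kappa>\<bar> + 1)) * \<mu> ^ nat m)) \<longlongrightarrow>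
     \<alpha> powi weight_ell (2 * \<kappa>) * 0) at_top"
    by (intro tendsto_mult tendsto_const linear_times_power_tendsto_0[OF \<mu> filterlim_nat_at_top])
  have "\<forall>\<^sub>F m in at_top. \<alpha> powi weight_ell (2 * \<kappa>) * ((1 * real (nat m) + (\<bar>of_int \<kappa>\<bar> + 1)) * \<mu> ^ nat m)
     = \<alpha> powi weight_ell (2 * \<kappa>) * \<mu> ^ nat m * arc_size \<kappa> m"
    using eventually_ge_at_top[of 0] by eventually_elim (simp add: arc_size_def algebra_simps)
  from Lim_transform_eventually[OF A this]
  show "((\<lambda>m. \<alpha> powi weight_ell (2 * \<kappa>) * \<mu> ^ nat m * arc_size \<kappa> m) \<longlongrightarrow> 0) at_top"
    by (simp only: mult_zero_right)
qed

section \<open>Wronskians and interlacing zeros\<close>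

lemma wronskian_zero_between:
  fixes F G F' G' :: "real \<Rightarrow> real"
  assumes xy: "x < y" and F0: "F x = 0" "F y = 0"
    and dF: "\<And>t. x \<le> t \<Longrightarrow> t \<le> y \<Longrightarrow> (F has_real_derivative F' t) (at t)"
    and dG: "\<And>t. x \<le> t \<Longrightarrow> t \<le> y \<Longrightarrow> (G has_real_derivative G' t) (at t)"
    and W: "\<And>t. x \<le> t \<Longrightarrow> t \<le> y \<Longrightarrow> F t * G' t - F' t * G t \<noteq> 0"
  obtains c where "x < c" "c < y" "G c = 0"
proof (rule ccontr)
  assume "\<not> thesis"
  hence "G c \<noteq> 0" if "x < c" "c < y" for c using that \<open>\<And>c. x < c \<Longrightarrow> c < y \<Longrightarrow> G c = 0 \<Longrightarrow> thesis\<close> by blast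
  \<comment> \<open>At a zero of F the Wronskian reduces to -F' G, so G cannot vanish there.\<close>
  moreover have "G x \<noteq> 0" "G y \<noteq> 0" using W[of x] W[of y] F0 xy by auto
  ultimately have G: "G t \<noteq> 0" if "x \<le> t" "t \<le> y" for t using that by (cases "t = x \<or> t = y") auto
  have d: "((\<lambda>t. F t / G t) has_real_derivative (F' t * G t - F t * G' t) / (G t * G t)) (at t)" if "x \<le> t" "t \<le> y" for t
    by (rule DERIV_divide[OF dF[OF that] dG[OF that] G[OF that]])
  have "\<exists>t. x < t \<and> t < y \<and> ((\<lambda>t. F t / G t) has_real_derivative 0) (at t)"
  proof (rule Rolle[OF xy])
    show "continuous_on {x..y} (\<lambda>t. F t / G t)"
      by (intro continuous_at_imp_continuous_on ballI DERIV_isCont[OF d]) auto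
    show "\<And>t. x < t \<Longrightarrow> t < y \<Longrightarrow> (\<lambda>t. F t / G t) differentiable at t"
      using d real_differentiable_def by (meson less_imp_le)
  qed (use F0 in simp)
  then obtain t where t: "x < t" "t < y" "((\<lambda>t. F t / G t) has_real_derivative 0) (at t)" by blast
  have "(F' t * G t - F t * G' t) / (G t * G t) = 0"
    using DERIV_unique[OF d t(3)] t(1,2) by simp
  thus False using W[of t] G[of t] t by simp
qed

text \<open>At an accumulation point of zeros both F and F' vanish, and so does the
  Wronskian.\<close>

lemma wronskian_finite_zeros:
  fixes F G F' G' :: "real \<Rightarrow> real"
  assumes dF: "\<And>t. x \<le> t \<Longrightarrow> t \<le> y \<Longrightarrow> (F has_real_derivative F' t) (at t)"
    and W: "\<And>t. x \<le> t \<Longrightarrow> t \<le> y \<Longrightarrow> F t * G' t - F' t * G t \<noteq> 0"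
  shows "finite {t \<in> {x..y}. F t = 0}"
proof (rule ccontr)
  define A where "A = {t \<in> {x..y}. F t = 0}"
  assume "infinite {t \<in> {x..y}. F t = 0}"
  hence "infinite A" "A \<subseteq> {x..y}" by (auto simp: A_def)
  then obtain t where t: "t \<in> {x..y}" "t islimpt A"
    using compact_Icc[of x y] unfolding compact_eq_Bolzano_Weierstrass by blast
  then obtain u where u: "\<And>n. u n \<in> A - {t}" "u \<longlonglongrightarrow> t" unfolding islimpt_sequential by blast
  have Fu: "F (u n) = 0" "u n \<noteq> t" for n using u(1)[of n] by (auto simp: A_def)
  have d: "(F has_real_derivative F' t) (at t)" using dF t(1) by simp
  have "(\<lambda>n. F (u n)) \<longlonglongrightarrow> F t" by (rule isCont_tendsto_compose[OF DERIV_isCont[OF d] u(2)])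
  hence F0: "F t = 0" by (simp add: Fu LIMSEQ_const_iff)
  have "((\<lambda>s. (F s - F t) / (s - t)) \<longlongrightarrow> F' t) (at t)" using d unfolding has_field_derivative_iff .
  moreover have "filterlim u (at t) sequentially" using u(2) Fu(2) by (simp add: filterlim_at)
  ultimately have "(\<lambda>n. (F (u n) - F t) / (u n - t)) \<longlonglongrightarrow> F' t" by (rule filterlim_compose)
  hence "F' t = 0" by (simp add: Fu F0 LIMSEQ_const_iff)
  thus False using W[of t] t(1) F0 by simp
qed

text \<open>All zeros lie at or beyond \<tau>. Uniqueness in a gap comes from the symmetric
  statement: two zeros of G in a gap of F would enclose another zero of F.\<close>

lemma wronskian_interlacing:
  fixes F G F' G' :: "real \<Rightarrow> real" and f g :: "complex \<Rightarrow> complex"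
  assumes ab: "a \<le> \<tau>" "\<tau> \<le> b"
    and dF: "\<And>t. a \<le> t \<Longrightarrow> t \<le> b \<Longrightarrow> (F has_real_derivative F' t) (at t)"
    and dG: "\<And>t. a \<le> t \<Longrightarrow> t \<le> b \<Longrightarrow> (G has_real_derivative G' t) (at t)"
    and near: "\<And>t. a < t \<Longrightarrow> t < \<tau> \<Longrightarrow> F t \<noteq> 0 \<and> G t \<noteq> 0"
    and W: "\<And>t. \<tau> \<le> t \<Longrightarrow> t \<le> b \<Longrightarrow> F t * G' t - F' t * G t \<noteq> 0"
    and f: "\<And>t. a < t \<Longrightarrow> t < b \<Longrightarrow> f (cis t) = 0 \<longleftrightarrow> F t = 0"
    and g: "\<And>t. a < t \<Longrightarrow> t < b \<Longrightarrow> g (cis t) = 0 \<longleftrightarrow> G t = 0"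
  shows "interlacing_zeros_on_arc f g a b"
proof -
  define A where "A = arc_zeros f a b"
  define B where "B = arc_zeros g a b"
  have A: "t \<in> A \<longleftrightarrow> a < t \<and> t < b \<and> F t = 0" for t unfolding A_def arc_zeros_def using f by auto
  have B: "t \<in> B \<longleftrightarrow> a < t \<and> t < b \<and> G t = 0" for t unfolding B_def arc_zeros_def using g by auto
  have A\<tau>: "\<tau> \<le> t" if "t \<in> A" for t using that near[of t] unfolding A by force
  have B\<tau>: "\<tau> \<le> t" if "t \<in> B" for t using that near[of t] unfolding B by force
  have W': "G t * F' t - G' t * F t \<noteq> 0" if "\<tau> \<le> t" "t \<le> b" for t
    using W[OF that] by (simp add: algebra_simps)
  have "finite {t \<in> {\<tau>..b}. F t = 0}" by (rule wronskian_finite_zeros[OF dF W]) (use ab in auto)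
  hence finA: "finite A" by (rule finite_subset[rotated]) (use A A\<tau> in fastforce)
  have "finite {t \<in> {\<tau>..b}. G t = 0}" by (rule wronskian_finite_zeros[OF dG W']) (use ab in auto)
  hence finB: "finite B" by (rule finite_subset[rotated]) (use B B\<tau> in fastforce)
  have disj: "A \<inter> B = {}"
  proof (rule ccontr)
    assume "A \<inter> B \<noteq> {}"
    then obtain t where "t \<in> A" "t \<in> B" by blast
    thus False using W[of t] A\<tau> A B by force
  qed
  have AB: "\<exists>c\<in>B. x < c \<and> c < y" if xy: "x \<in> A" "y \<in> A" "x < y" for x y
  proof -
    have *: "\<tau> \<le> x" "y < b" "F x = 0" "F y = 0" "a < x" using xy A\<tau>[of x] A by auto
    obtain c where "x < c" "c < y" "G c = 0"
      by (rule wronskian_zero_between[OF xy(3) *(3,4), of F' G G']) (use dF dG W * ab in auto)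
    thus ?thesis using * B by (intro bexI[of _ c]) auto
  qed
  have BA: "\<exists>c\<in>A. x < c \<and> c < y" if xy: "x \<in> B" "y \<in> B" "x < y" for x y
  proof -
    have *: "\<tau> \<le> x" "y < b" "G x = 0" "G y = 0" "a < x" using xy B\<tau>[of x] B by auto
    obtain c where "x < c" "c < y" "F c = 0"
      by (rule wronskian_zero_between[OF xy(3) *(3,4), of G' F F']) (use dF dG W' * ab in auto)
    thus ?thesis using * A by (intro bexI[of _ c]) auto
  qed
  have uniq: "\<exists>!c. c \<in> Y \<and> x < c \<and> c < y"
    if XY: "\<And>x y. x \<in> X \<Longrightarrow> y \<in> X \<Longrightarrow> x < y \<Longrightarrow> \<exists>c\<in>Y. x < c \<and> c < y"
      and YX: "\<And>x y. x \<in> Y \<Longrightarrow> y \<in> Y \<Longrightarrow> x < y \<Longrightarrow> \<exists>c\<in>X. x < c \<and> c < y"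
      and con: "consecutive_in X x y" for X Y :: "real set" and x y
  proof -
    have xy: "x \<in> X" "y \<in> X" "x < y" "X \<inter> {x<..<y} = {}" using con by (auto simp: consecutive_in_def)
    obtain c where c: "c \<in> Y" "x < c" "c < y" using XY[OF xy(1-3)] by blast
    have no: False if d: "d \<in> Y" "d' \<in> Y" "d < d'" "x < d" "d' < y" for d d'
    proof -
      obtain e where "e \<in> X" "d < e" "e < d'" using YX[OF d(1-3)] by blast
      hence "e \<in> X \<inter> {x<..<y}" using d by auto
      thus False using xy(4) by blast
    qed
    show ?thesis
    proof (rule ex1I[of _ c])
      fix d assume d: "d \<in> Y \<and> x < d \<and> d < y"
      show "d = c" using no[of c d] no[of d c] c d by (cases d c rule: linorder_cases) auto
    qed (use c in auto)
  qed
  show ?thesis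
    unfolding interlacing_zeros_on_arc_def A_def[symmetric] B_def[symmetric] Let_def
    using finA finB disj uniq[OF AB BA] uniq[OF BA AB] by blast
qed

text \<open>By the product formulas the unperturbed Wronskian is 2 ((q1 - q2) sin (A + B) - (q1 +
  q2) sin (B - A)), at most -2, and the error terms add up to at most 0.82. The offset h is a
  multiple of \<pi>/2, hence |sin (A + B)| is at most |sin (p1 + p2)|.\<close>

lemma wronskian_negative:
  fixes h p1 p2 q1 q2 e1 e2 d1 d2 D :: real
  assumes h: "sin (2 * h) = 0" and D: "\<bar>q1\<bar> \<le> D" "\<bar>q2\<bar> \<le> D" "1 \<le> D"
    and e: "\<bar>e1\<bar> * D \<le> 1/10" "\<bar>e2\<bar> * D \<le> 1/10" "\<bar>d1\<bar> \<le> 1/10" "\<bar>d2\<bar> \<le> 1/10"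
    and q: "q1 \<le> q2" and main: "(q1 + q2) * sin (p2 - p1) - (q2 - q1) * \<bar>sin (p1 + p2)\<bar> \<ge> 1"
  shows "(2 * cos (h + p1) + e1) * (- (2 * q2 * sin (h + p2)) + d2)
       - (- (2 * q1 * sin (h + p1)) + d1) * (2 * cos (h + p2) + e2) < 0"
proof -
  define A B where "A = h + p1" and "B = h + p2"
  have "sin (A + B) = sin (2 * h + (p1 + p2))" by (simp add: A_def B_def algebra_simps)
  also have "\<dots> = cos (2 * h) * sin (p1 + p2)" unfolding sin_add[of "2 * h"] h by simp
  finally have sAB: "\<bar>sin (A + B)\<bar> \<le> \<bar>sin (p1 + p2)\<bar>"
    by (simp add: abs_mult mult_left_le_one_le)
  have "(q1 - q2) * sin (A + B) \<le> (q2 - q1) * \<bar>sin (A + B)\<bar>"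
    using mult_left_mono[OF abs_ge_minus_self[of "sin (A + B)"], of "q2 - q1"] q by (simp add: algebra_simps)
  also have "\<dots> \<le> (q2 - q1) * \<bar>sin (p1 + p2)\<bar>" using q sAB by (intro mult_left_mono) auto
  finally have m1: "(q1 - q2) * sin (A + B) \<le> (q2 - q1) * \<bar>sin (p1 + p2)\<bar>" .
  have "p2 - p1 = B - A" by (simp add: A_def B_def)
  hence m2: "(q1 - q2) * sin (A + B) - (q1 + q2) * sin (B - A) \<le> -1" using main m1 by simp
  have id: "2 * cos A * (- (2 * q2 * sin B)) + 2 * q1 * sin A * (2 * cos B) = 2 * ((q1 - q2) * sin (A + B) - (q1 + q2) * sin (B - A))"
    unfolding sin_add sin_diff by (simp add: algebra_simps)
  have e': "\<bar>e1\<bar> \<le> 1/10" "\<bar>e2\<bar> \<le> 1/10"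
    using mult_left_mono[OF D(3), of "\<bar>e1\<bar>"] mult_left_mono[OF D(3), of "\<bar>e2\<bar>"] e by auto
  have bd: "\<bar>x * y\<bar> \<le> u * v" if "\<bar>x\<bar> \<le> u" "\<bar>y\<bar> \<le> v" for x y u v :: real
    unfolding abs_mult using that by (intro mult_mono) auto
  have r1: "\<bar>cos A * d2\<bar> \<le> 1 * (1/10)" "\<bar>cos B * d1\<bar> \<le> 1 * (1/10)" by (intro bd e abs_cos_le_one)+
  have r2: "\<bar>e1 * d2\<bar> \<le> (1/10) * (1/10)" "\<bar>e2 * d1\<bar> \<le> (1/10) * (1/10)" by (intro bd e e')+
  have r3: "\<bar>(e1 * q2) * sin B\<bar> \<le> (1/10) * 1"
  proof (intro bd abs_sin_le_one)
    have "\<bar>e1 * q2\<bar> \<le> \<bar>e1\<bar> * D" unfolding abs_mult using D by (intro mult_left_mono) auto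
    thus "\<bar>e1 * q2\<bar> \<le> 1/10" using e by simp
  qed
  have r4: "\<bar>(e2 * q1) * sin A\<bar> \<le> (1/10) * 1"
  proof (intro bd abs_sin_le_one)
    have "\<bar>e2 * q1\<bar> \<le> \<bar>e2\<bar> * D" unfolding abs_mult using D by (intro mult_left_mono) auto
    thus "\<bar>e2 * q1\<bar> \<le> 1/10" using e by simp
  qed
  have "(2 * cos A + e1) * (- (2 * q2 * sin B) + d2) - (- (2 * q1 * sin A) + d1) * (2 * cos B + e2)
      = (2 * cos A * (- (2 * q2 * sin B)) + 2 * q1 * sin A * (2 * cos B))
        + 2 * (cos A * d2) - 2 * ((e1 * q2) * sin B) + e1 * d2 + 2 * ((e2 * q1) * sin A) - 2 * (cos B * d1) - e2 * d1"
    by (simp add: algebra_simps)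
  also have "\<dots> < 0"
  proof -
    have "2 * X + 2 * x1 - 2 * x2 + x3 + 2 * x4 - 2 * x5 - x6 < 0"
      if "X \<le> -1" "\<bar>x1\<bar> \<le> 1 * (1/10)" "\<bar>x2\<bar> \<le> (1/10) * 1" "\<bar>x3\<bar> \<le> (1/10) * (1/10)"
        "\<bar>x4\<bar> \<le> (1/10) * 1" "\<bar>x5\<bar> \<le> 1 * (1/10)" "\<bar>x6\<bar> \<le> (1/10) * (1/10)" for X x1 x2 x3 x4 x5 x6 :: real
      using that by linarith
    from this[OF m2 r1(1) r3 r2(1) r4 r1(2) r2(2)] show ?thesis unfolding id .
  qed
  finally show ?thesis unfolding A_def B_def .
qed

section \<open>Elementary bounds for sine and cosine\<close>

lemma cos_ge_quadratic: "cos x \<ge> 1 - x\<^sup>2 / 2" for x :: real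
proof -
  have "(sin (x/2))\<^sup>2 \<le> (x/2)\<^sup>2" using abs_sin_x_le_abs_x[of "x/2"] unfolding abs_le_square_iff .
  moreover have "cos x = 1 - 2 * (sin (x/2))\<^sup>2" using cos_double_sin[of "x/2"] by simp
  ultimately show ?thesis by (simp add: power2_eq_square)
qed

lemma sin_ge_linear:
  fixes x :: real assumes "0 \<le> x" "x \<le> 1"
  shows "sin x \<ge> (5/6) * x"
proof -
  have "\<bar>sin x - (\<Sum>m<3. sin_coeff m * x ^ m)\<bar> \<le> inverse (fact 3) * \<bar>x\<bar> ^ 3"
    by (rule Maclaurin_sin_bound)
  moreover have "(\<Sum>m<3. sin_coeff m * x ^ m) = x" by (simp add: eval_nat_numeral sin_coeff_def)
  ultimately have "\<bar>sin x - x\<bar> \<le> x ^ 3 / 6" using assms by (simp add: fact_numeral)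
  moreover have "x ^ 3 \<le> x" using assms power_decreasing[of 1 3 x] by simp
  ultimately show ?thesis by linarith
qed

text \<open>In the applications x is a phase difference, which stays below \<pi> up to the end of
  the arc; once it exceeds 1, its sine has a positive lower bound independent of the varying
  parameter.\<close>

lemma sin_lower_bound:
  fixes B :: real assumes "B < pi"
  obtains c where "c > 0" "\<And>x. 1 \<le> x \<Longrightarrow> x \<le> B \<Longrightarrow> sin x \<ge> c"
proof (cases "1 \<le> B")
  case True
  have "continuous_on {1..B} (sin :: real \<Rightarrow> real)" by (intro continuous_intros)
  from continuous_attains_inf[OF compact_Icc _ this] True obtain x0 where
    "x0 \<in> {1..B}" "\<And>x. x \<in> {1..B} \<Longrightarrow> sin x0 \<le> sin x" by auto
  moreover from this(1) have "sin x0 > 0" using assms by (intro sin_gt_zero) auto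
  ultimately show ?thesis by (intro that[of "sin x0"]) auto
next
  case False
  thus ?thesis by (intro that[of 1]) auto
qed

section \<open>The phase on the arc\<close>

lemma cis_plus_inverse: "cis \<theta> + 1 / cis \<theta> = of_real (2 * cos \<theta>)"
  by (simp add: complex_eq_iff flip: cis_inverse inverse_eq_divide)

lemma cis_minus_inverse: "cis \<theta> - 1 / cis \<theta> = 2 * \<i> * of_real (sin \<theta>)"
  by (simp add: complex_eq_iff flip: cis_inverse inverse_eq_divide)

lemma arc_main_cis: "arc_main \<kappa> m (cis \<theta>) = cis (of_int \<kappa> * \<theta> - 2 * pi * of_int m * cos \<theta>)"
proof -
  have "exp (- (of_real pi * \<i> * (cis \<theta> + 1 / cis \<theta>))) = cis (- 2 * pi * cos \<theta>)"
    unfolding cis_plus_inverse unfolding cis_conv_exp by (rule arg_cong[of _ _ exp]) simp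
  thus ?thesis unfolding arc_main_def by (simp add: cis_power_int cis_mult algebra_simps)
qed

lemma arc_factor_cis:
  "arc_factor \<kappa> m (cis \<theta>) = cis (of_int \<kappa> * \<theta>) * of_real (exp (- 2 * pi * sin \<theta>) powi m)"
proof -
  have "exp (of_real pi * \<i> * (cis \<theta> - 1 / cis \<theta>)) = of_real (exp (- 2 * pi * sin \<theta>))"
    unfolding cis_minus_inverse exp_of_real[symmetric] by (rule arg_cong[of _ _ exp]) (simp add: algebra_simps)
  thus ?thesis unfolding arc_factor_def by (simp add: cis_power_int)
qed

text \<open>The product is real on the arc, as the proof of \<open>basis_form_zero_iff\<close>
  shows, so the real part loses nothing.\<close>

definition arc_fun :: "int \<Rightarrow> int \<Rightarrow> real \<Rightarrow> real" where
  "arc_fun \<kappa> m \<theta> = Re (arc_factor \<kappa> m (cis \<theta>) * basis_form (2 * \<kappa>) m (cis \<theta>))"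

text \<open>On the unit circle -cnj z = -1/z. Real coefficients and modularity therefore give cnj v
  = z^(2\<kappa>) v, and \<open>arc_factor\<close>, there a positive multiple of z^\<kappa>, makes
  the product real.\<close>

lemma basis_form_zero_iff:
  assumes f: "is_basis_form (2 * \<kappa>) m (basis_form (2 * \<kappa>) m)" and \<theta>: "sin \<theta> > 0"
  shows "basis_form (2 * \<kappa>) m (cis \<theta>) = 0 \<longleftrightarrow> arc_fun \<kappa> m \<theta> = 0"
proof -
  define v where "v = basis_form (2 * \<kappa>) m (cis \<theta>)"
  have "- cnj (cis \<theta>) = -1 / cis \<theta>" by (simp add: cis_cnj flip: cis_inverse inverse_eq_divide)
  hence "cnj v = basis_form (2 * \<kappa>) m (-1 / cis \<theta>)"
    using basis_form_cnj[OF _ f, of "cis \<theta>"] by (simp add: v_def)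
  also have "\<dots> = cis \<theta> powi (2 * \<kappa>) * v"
    unfolding v_def by (rule weakly_holomorphic_S) (use f \<theta> in \<open>auto simp: is_basis_form_def\<close>)
  finally have v: "cnj v = cis (2 * of_int \<kappa> * \<theta>) * v" by (simp add: cis_power_int)
  define w where "w = arc_factor \<kappa> m (cis \<theta>) * v"
  have "cnj w = (cis (- (of_int \<kappa> * \<theta>)) * cis (2 * of_int \<kappa> * \<theta>)) * of_real (exp (- 2 * pi * sin \<theta>) powi m) * v"
    unfolding w_def arc_factor_cis complex_cnj_mult v by (simp add: cis_cnj)
  also have "cis (- (of_int \<kappa> * \<theta>)) * cis (2 * of_int \<kappa> * \<theta>) = cis (of_int \<kappa> * \<theta>)"
    unfolding cis_mult by (rule arg_cong[of _ _ cis]) (simp add: algebra_simps)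
  finally have "cnj w = w" by (simp add: w_def arc_factor_cis)
  hence "Im w = 0" by (metis cnj.sel(2) equation_minus_iff neg_equal_zero minus_equation_iff)
  hence "w = 0 \<longleftrightarrow> Re w = 0" by (simp add: complex_eq_iff)
  moreover have "arc_factor \<kappa> m (cis \<theta>) \<noteq> 0" by (simp add: arc_factor_cis)
  ultimately show ?thesis unfolding arc_fun_def v_def[symmetric] w_def by simp
qed

lemma arc_fun_eq:
  "arc_fun \<kappa> m \<theta> = 2 * cos (of_int \<kappa> * \<theta> - 2 * pi * of_int m * cos \<theta>) + Re (arc_error \<kappa> m (cis \<theta>))"
proof -
  define x where "x = of_int \<kappa> * \<theta> - 2 * pi * of_int m * cos \<theta>"
  have i: "Re (inverse (cis x)) = cos x" by simp
  show ?thesis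
    unfolding arc_fun_def arc_error_def arc_main_cis x_def[symmetric] minus_complex.sel i cis.sel by simp
qed

lemma DERIV_arc_error:
  assumes f: "is_basis_form (2 * \<kappa>) m (basis_form (2 * \<kappa>) m)" and \<theta>: "sin \<theta> > 0"
  shows "((\<lambda>\<theta>. Re (arc_error \<kappa> m (cis \<theta>))) has_real_derivative
           Re (\<i> * cis \<theta> * deriv (arc_error \<kappa> m) (cis \<theta>))) (at \<theta>)"
proof -
  have "(cis has_vector_derivative \<i> * cis \<theta>) (at \<theta>)"
    unfolding has_vector_derivative_complex_iff by (auto intro!: derivative_eq_intros)
  moreover have "(arc_error \<kappa> m has_field_derivative deriv (arc_error \<kappa> m) (cis \<theta>)) (at (cis \<theta>))"
    by (rule holomorphic_derivI[OF arc_error_holomorphic[OF f] open_Im_pos]) (use \<theta> in simp)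
  ultimately have "((arc_error \<kappa> m \<circ> cis) has_vector_derivative \<i> * cis \<theta> * deriv (arc_error \<kappa> m) (cis \<theta>)) (at \<theta>)"
    by (rule field_vector_diff_chain_at)
  from has_field_derivative_Re[OF this] show ?thesis by (simp add: o_def)
qed

text \<open>The inversion fixes i, and for odd \<kappa> its automorphy factor there is -1.\<close>

lemma arc_fun_at_half_pi:
  assumes f: "is_basis_form (2 * \<kappa>) m (basis_form (2 * \<kappa>) m)" and \<kappa>: "odd \<kappa>"
  shows "arc_fun \<kappa> m (pi / 2) = 0"
proof -
  have "basis_form (2 * \<kappa>) m (-1 / \<i>) = \<i> powi (2 * \<kappa>) * basis_form (2 * \<kappa>) m \<i>"
    by (rule weakly_holomorphic_S) (use f in \<open>auto simp: is_basis_form_def\<close>)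
  moreover have "\<i> powi (2 * \<kappa>) = -1" using \<kappa> by (simp add: power_int_mult)
  moreover have "-1 / \<i> = \<i>" by (simp add: field_simps)
  ultimately have "basis_form (2 * \<kappa>) m \<i> = - basis_form (2 * \<kappa>) m \<i>" by simp
  hence "basis_form (2 * \<kappa>) m \<i> = 0" by simp
  moreover have "cis (pi / 2) = \<i>" by (simp add: complex_eq_iff)
  ultimately show ?thesis by (simp add: arc_fun_def)
qed

text \<open>The phase is measured from \<pi>/2, with the offset \<kappa>\<pi>/2 split off. Thus both
  phases of a pair start at 0, and the offsets differ by a multiple of \<pi>.\<close>

definition arc_phase :: "int \<Rightarrow> int \<Rightarrow> real \<Rightarrow> real" where
  "arc_phase \<kappa> m \<theta> = of_int \<kappa> * (\<theta> - pi / 2) - 2 * pi * of_int m * cos \<theta>"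

definition arc_speed :: "int \<Rightarrow> int \<Rightarrow> real \<Rightarrow> real" where
  "arc_speed \<kappa> m \<theta> = of_int \<kappa> + 2 * pi * of_int m * sin \<theta>"

lemma DERIV_arc_phase: "(arc_phase \<kappa> m has_real_derivative arc_speed \<kappa> m \<theta>) (at \<theta>)"
  unfolding arc_phase_def[abs_def] arc_speed_def by (auto intro!: derivative_eq_intros)

lemma arc_fun_phase:
  "arc_fun \<kappa> m \<theta> = 2 * cos (of_int \<kappa> * (pi / 2) + arc_phase \<kappa> m \<theta>) + Re (arc_error \<kappa> m (cis \<theta>))"
  unfolding arc_fun_eq arc_phase_def by (simp add: algebra_simps)

definition arc_deriv :: "int \<Rightarrow> int \<Rightarrow> real \<Rightarrow> real" where
  "arc_deriv \<kappa> m \<theta> = - (2 * arc_speed \<kappa> m \<theta> * sin (of_int \<kappa> * (pi / 2) + arc_phase \<kappa> m \<theta>))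
     + Re (\<i> * cis \<theta> * deriv (arc_error \<kappa> m) (cis \<theta>))"

lemma DERIV_arc_fun:
  assumes "is_basis_form (2 * \<kappa>) m (basis_form (2 * \<kappa>) m)" "sin \<theta> > 0"
  shows "(arc_fun \<kappa> m has_real_derivative arc_deriv \<kappa> m \<theta>) (at \<theta>)"
proof -
  have "((\<lambda>\<theta>. 2 * cos (of_int \<kappa> * (pi / 2) + arc_phase \<kappa> m \<theta>)) has_real_derivative
     - (2 * arc_speed \<kappa> m \<theta> * sin (of_int \<kappa> * (pi / 2) + arc_phase \<kappa> m \<theta>))) (at \<theta>)"
    by (auto intro!: derivative_eq_intros DERIV_arc_phase)
  from DERIV_add[OF this DERIV_arc_error[OF assms]] show ?thesis
    unfolding arc_fun_phase[abs_def] arc_deriv_def .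
qed

lemma abs_Re_rotated_le: "\<bar>Re (\<i> * cis \<theta> * w)\<bar> \<le> norm w"
  using abs_Re_le_cmod[of "\<i> * cis \<theta> * w"] by (simp add: norm_mult)

text \<open>
  For odd \<open>\<kappa>\<close> the function vanishes at \<open>\<pi>/2\<close> by modularity, so that Rolle's theorem excludes a second
  zero nearby.
\<close>
lemma arc_fun_nonzero_near:
  assumes f: "is_basis_form (2 * \<kappa>) m (basis_form (2 * \<kappa>) m)"
    and t: "pi / 2 < t" "t \<le> b" "b < 2 * pi / 3"
    and err: "\<And>\<theta>. pi / 2 \<le> \<theta> \<Longrightarrow> \<theta> \<le> b \<Longrightarrow> norm (arc_error \<kappa> m (cis \<theta>)) \<le> 1/10 \<and> norm (deriv (arc_error \<kappa> m) (cis \<theta>)) \<le> 1/10"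
    and speed: "\<And>\<theta>. pi / 2 \<le> \<theta> \<Longrightarrow> \<theta> \<le> b \<Longrightarrow> 1 \<le> arc_speed \<kappa> m \<theta>"
    and phase: "\<And>\<theta>. pi / 2 \<le> \<theta> \<Longrightarrow> \<theta> \<le> t \<Longrightarrow> 0 \<le> arc_phase \<kappa> m \<theta> \<and> arc_phase \<kappa> m \<theta> \<le> 6/5"
  shows "arc_fun \<kappa> m t \<noteq> 0"
proof -
  define h where "h = of_int \<kappa> * (pi / 2)"
  have cosp: "cos (arc_phase \<kappa> m \<theta>) \<ge> 7/25" if "pi / 2 \<le> \<theta>" "\<theta> \<le> t" for \<theta>
  proof -
    \<comment> \<open>7/25 = 1 - (6/5)^2 / 2.\<close>
    have "(arc_phase \<kappa> m \<theta>)\<^sup>2 \<le> (6/5)\<^sup>2" using phase[OF that] by (intro power_mono) auto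
    thus ?thesis using cos_ge_quadratic[of "arc_phase \<kappa> m \<theta>"] by (simp add: power_divide)
  qed
  have sn: "sin \<theta> > 0" if "pi / 2 \<le> \<theta>" "\<theta> \<le> b" for \<theta>
  proof (rule sin_gt_zero)
    show "0 < \<theta>" using that pi_gt_zero by linarith
    show "\<theta> < pi" using that t pi_gt_zero by linarith
  qed
  show ?thesis
  proof (cases "even \<kappa>")
    case True
    then obtain j where j: "\<kappa> = 2 * j" by (elim evenE)
    have h: "h = of_int j * pi" by (simp add: h_def j)
    have "cos h ^ 2 = 1" "sin h = 0" unfolding h by (simp_all add: cos_squared_eq sin_int_times_real mult.commute)
    hence "cos h = 1 \<or> cos h = -1" by (simp add: power2_eq_1_iff)
    hence "\<bar>cos h\<bar> = 1" by auto
    hence "\<bar>cos (h + arc_phase \<kappa> m t)\<bar> = \<bar>cos (arc_phase \<kappa> m t)\<bar>"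
      using \<open>sin h = 0\<close> by (simp add: cos_add abs_mult)
    hence "\<bar>cos (h + arc_phase \<kappa> m t)\<bar> \<ge> 7/25" using cosp[of t] t by simp
    moreover have "\<bar>Re (arc_error \<kappa> m (cis t))\<bar> \<le> 1/10"
      using err[of t] t abs_Re_le_cmod[of "arc_error \<kappa> m (cis t)"] by simp
    ultimately show ?thesis unfolding arc_fun_phase h_def[symmetric] by linarith
  next
    case False
    then obtain j where j: "\<kappa> = 2 * j + 1" by (elim oddE)
    have h: "h = of_int j * pi + pi / 2" by (simp add: h_def j algebra_simps)
    have "cos h = 0" unfolding h by (simp add: cos_add sin_int_times_real mult.commute)
    hence "sin h ^ 2 = 1" by (simp add: sin_squared_eq)
    hence "sin h = 1 \<or> sin h = -1" by (simp add: power2_eq_1_iff)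
    hence sh: "\<bar>sin h\<bar> = 1" by auto
    show ?thesis
    proof
      assume "arc_fun \<kappa> m t = 0"
      hence eq: "arc_fun \<kappa> m (pi / 2) = arc_fun \<kappa> m t" using arc_fun_at_half_pi[OF f False] by simp
      have d: "(arc_fun \<kappa> m has_real_derivative arc_deriv \<kappa> m \<theta>) (at \<theta>)" if "pi / 2 \<le> \<theta>" "\<theta> \<le> t" for \<theta>
        by (rule DERIV_arc_fun[OF f sn]) (use that t in auto)
      have "\<exists>z. pi / 2 < z \<and> z < t \<and> (arc_fun \<kappa> m has_real_derivative 0) (at z)"
      proof (rule Rolle[OF t(1) eq])
        show "continuous_on {pi / 2..t} (arc_fun \<kappa> m)"
          by (intro continuous_at_imp_continuous_on ballI DERIV_isCont[OF d]) auto
        show "\<And>x. pi / 2 < x \<Longrightarrow> x < t \<Longrightarrow> arc_fun \<kappa> m differentiable at x"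
          using d real_differentiable_def by (meson less_imp_le)
      qed
      then obtain z where z: "pi / 2 < z" "z < t" "(arc_fun \<kappa> m has_real_derivative 0) (at z)" by blast
      have "arc_deriv \<kappa> m z = 0" using DERIV_unique[OF d z(3)] z by simp
      moreover have "\<bar>sin (h + arc_phase \<kappa> m z)\<bar> = \<bar>cos (arc_phase \<kappa> m z)\<bar>"
        using \<open>cos h = 0\<close> sh by (simp add: sin_add abs_mult)
      hence "\<bar>sin (h + arc_phase \<kappa> m z)\<bar> \<ge> 7/25" using cosp[of z] z by simp
      hence "1 * (7/25) \<le> arc_speed \<kappa> m z * \<bar>sin (h + arc_phase \<kappa> m z)\<bar>"
        using speed[of z] z t by (intro mult_mono) auto
      hence "\<bar>2 * arc_speed \<kappa> m z * sin (h + arc_phase \<kappa> m z)\<bar> \<ge> 14/25"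
        using speed[of z] z t by (simp add: abs_mult)
      moreover have "\<bar>Re (\<i> * cis z * deriv (arc_error \<kappa> m) (cis z))\<bar> \<le> 1/10"
        using err[of z] z t abs_Re_rotated_le[of z "deriv (arc_error \<kappa> m) (cis z)"] by simp
      ultimately show False unfolding arc_deriv_def h_def[symmetric] by linarith
    qed
  qed
qed

text \<open>The sum of the two phases increases from 0 to at least 2, and the arc is cut at the
  point \<tau> where it equals 2. Before \<tau> the phase bounds in \<open>near\<close> exclude
  zeros of both functions, after it \<open>far\<close> makes the Wronskian negative. The sign
  \<sigma> aligns the two offsets, so that both cosines are taken with the same h.\<close>

lemma interlacing_pair:
  fixes \<kappa>1 \<kappa>2 m1 m2 :: int and \<sigma> D b :: real
  assumes f1: "is_basis_form (2 * \<kappa>1) m1 (basis_form (2 * \<kappa>1) m1)"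
    and f2: "is_basis_form (2 * \<kappa>2) m2 (basis_form (2 * \<kappa>2) m2)"
    and b: "pi / 2 < b" "b < 2 * pi / 3" and D: "1 \<le> D"
    and \<sigma>: "\<sigma> \<noteq> 0" "\<sigma> * \<sigma> = 1" "\<And>x. cos (of_int \<kappa>2 * (pi / 2) + x) = \<sigma> * cos (of_int \<kappa>1 * (pi / 2) + x)"
      "\<And>x. sin (of_int \<kappa>2 * (pi / 2) + x) = \<sigma> * sin (of_int \<kappa>1 * (pi / 2) + x)"
    and err1: "\<And>\<theta>. pi / 2 \<le> \<theta> \<Longrightarrow> \<theta> \<le> b \<Longrightarrow> norm (arc_error \<kappa>1 m1 (cis \<theta>)) * D \<le> 1/10 \<and> norm (deriv (arc_error \<kappa>1 m1) (cis \<theta>)) \<le> 1/10"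
    and err2: "\<And>\<theta>. pi / 2 \<le> \<theta> \<Longrightarrow> \<theta> \<le> b \<Longrightarrow> norm (arc_error \<kappa>2 m2 (cis \<theta>)) * D \<le> 1/10 \<and> norm (deriv (arc_error \<kappa>2 m2) (cis \<theta>)) \<le> 1/10"
    and speed: "\<And>\<theta>. pi / 2 \<le> \<theta> \<Longrightarrow> \<theta> \<le> b \<Longrightarrow>
      1 \<le> arc_speed \<kappa>1 m1 \<theta> \<and> arc_speed \<kappa>1 m1 \<theta> \<le> arc_speed \<kappa>2 m2 \<theta> \<and> arc_speed \<kappa>2 m2 \<theta> \<le> D"
    and near: "\<And>\<theta>. pi / 2 \<le> \<theta> \<Longrightarrow> \<theta> \<le> b \<Longrightarrow> arc_phase \<kappa>1 m1 \<theta> + arc_phase \<kappa>2 m2 \<theta> \<le> 2 \<Longrightarrow>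
      0 \<le> arc_phase \<kappa>1 m1 \<theta> \<and> arc_phase \<kappa>1 m1 \<theta> \<le> arc_phase \<kappa>2 m2 \<theta> \<and> arc_phase \<kappa>2 m2 \<theta> \<le> 6/5"
    and far: "\<And>\<theta>. pi / 2 \<le> \<theta> \<Longrightarrow> \<theta> \<le> b \<Longrightarrow> arc_phase \<kappa>1 m1 \<theta> + arc_phase \<kappa>2 m2 \<theta> \<ge> 2 \<Longrightarrow>
      (arc_speed \<kappa>1 m1 \<theta> + arc_speed \<kappa>2 m2 \<theta>) * sin (arc_phase \<kappa>2 m2 \<theta> - arc_phase \<kappa>1 m1 \<theta>)
        - (arc_speed \<kappa>2 m2 \<theta> - arc_speed \<kappa>1 m1 \<theta>) \<ge> 1"
    and last: "arc_phase \<kappa>1 m1 b + arc_phase \<kappa>2 m2 b \<ge> 2"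
  shows "interlacing_zeros_on_arc (basis_form (2 * \<kappa>1) m1) (basis_form (2 * \<kappa>2) m2) (pi / 2) b"
proof -
  define s where "s = (\<lambda>\<theta>. arc_phase \<kappa>1 m1 \<theta> + arc_phase \<kappa>2 m2 \<theta>)"
  have ds: "(s has_real_derivative arc_speed \<kappa>1 m1 \<theta> + arc_speed \<kappa>2 m2 \<theta>) (at \<theta>)" for \<theta>
    unfolding s_def by (intro DERIV_add DERIV_arc_phase)
  have s_mono: "s x < s y" if "pi / 2 \<le> x" "x < y" "y \<le> b" for x y
  proof (rule DERIV_pos_imp_increasing[OF that(2)])
    fix \<theta> assume "x \<le> \<theta>" "\<theta> \<le> y"
    thus "\<exists>d. (s has_real_derivative d) (at \<theta>) \<and> d > 0"
      using ds[of \<theta>] speed[of \<theta>] that by (intro exI[of _ "arc_speed \<kappa>1 m1 \<theta> + arc_speed \<kappa>2 m2 \<theta>"]) auto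
  qed
  have "s (pi / 2) = 0" by (simp add: s_def arc_phase_def)
  moreover have "s b \<ge> 2" using last by (simp add: s_def)
  ultimately have "\<exists>\<tau>\<ge>pi / 2. \<tau> \<le> b \<and> s \<tau> = 2"
    using b by (intro IVT') (auto intro!: continuous_at_imp_continuous_on DERIV_isCont[OF ds])
  then obtain \<tau> where \<tau>: "pi / 2 \<le> \<tau>" "\<tau> \<le> b" "s \<tau> = 2" by blast
  have sn: "sin \<theta> > 0" if "pi / 2 \<le> \<theta>" "\<theta> \<le> b" for \<theta>
  proof (rule sin_gt_zero)
    show "0 < \<theta>" using that pi_gt_zero by linarith
    show "\<theta> < pi" using that b pi_gt_zero by linarith
  qed
  have e_small: "norm (e :: complex) \<le> 1/10" if "norm e * D \<le> 1/10" for e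
    using mult_left_mono[OF D, of "norm e"] that by simp
  have near': "0 \<le> arc_phase \<kappa>1 m1 \<theta> \<and> arc_phase \<kappa>1 m1 \<theta> \<le> arc_phase \<kappa>2 m2 \<theta> \<and> arc_phase \<kappa>2 m2 \<theta> \<le> 6/5"
    if "pi / 2 \<le> \<theta>" "\<theta> < \<tau>" for \<theta>
    using near[of \<theta>] s_mono[OF that \<tau>(2)] that \<tau> by (simp add: s_def)
  show ?thesis
  proof (rule wronskian_interlacing[OF \<tau>(1,2), where F = "arc_fun \<kappa>1 m1" and F' = "arc_deriv \<kappa>1 m1" and
        G = "\<lambda>\<theta>. \<sigma> * arc_fun \<kappa>2 m2 \<theta>" and G' = "\<lambda>\<theta>. \<sigma> * arc_deriv \<kappa>2 m2 \<theta>"])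
    fix t assume t: "pi / 2 \<le> t" "t \<le> b"
    show "(arc_fun \<kappa>1 m1 has_real_derivative arc_deriv \<kappa>1 m1 t) (at t)"
      by (rule DERIV_arc_fun[OF f1 sn[OF t]])
    show "((\<lambda>\<theta>. \<sigma> * arc_fun \<kappa>2 m2 \<theta>) has_real_derivative \<sigma> * arc_deriv \<kappa>2 m2 t) (at t)"
      by (rule DERIV_cmult[OF DERIV_arc_fun[OF f2 sn[OF t]]])
  next
    fix t assume t: "pi / 2 < t" "t < \<tau>"
    have "arc_fun \<kappa>1 m1 t \<noteq> 0"
    proof (rule arc_fun_nonzero_near[OF f1 t(1) _ b(2)])
      show "t \<le> b" using t \<tau> by simp
      show "norm (arc_error \<kappa>1 m1 (cis \<theta>)) \<le> 1/10 \<and> norm (deriv (arc_error \<kappa>1 m1) (cis \<theta>)) \<le> 1/10"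
        if "pi / 2 \<le> \<theta>" "\<theta> \<le> b" for \<theta> using err1[OF that] e_small by blast
      show "1 \<le> arc_speed \<kappa>1 m1 \<theta>" if "pi / 2 \<le> \<theta>" "\<theta> \<le> b" for \<theta> using speed[OF that] by simp
      show "0 \<le> arc_phase \<kappa>1 m1 \<theta> \<and> arc_phase \<kappa>1 m1 \<theta> \<le> 6/5" if "pi / 2 \<le> \<theta>" "\<theta> \<le> t" for \<theta>
        using near'[of \<theta>] that t by simp
    qed
    moreover have "arc_fun \<kappa>2 m2 t \<noteq> 0"
    proof (rule arc_fun_nonzero_near[OF f2 t(1) _ b(2)])
      show "t \<le> b" using t \<tau> by simp
      show "norm (arc_error \<kappa>2 m2 (cis \<theta>)) \<le> 1/10 \<and> norm (deriv (arc_error \<kappa>2 m2) (cis \<theta>)) \<le> 1/10"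
        if "pi / 2 \<le> \<theta>" "\<theta> \<le> b" for \<theta> using err2[OF that] e_small by blast
      show "1 \<le> arc_speed \<kappa>2 m2 \<theta>" if "pi / 2 \<le> \<theta>" "\<theta> \<le> b" for \<theta> using speed[OF that] by simp
      show "0 \<le> arc_phase \<kappa>2 m2 \<theta> \<and> arc_phase \<kappa>2 m2 \<theta> \<le> 6/5" if "pi / 2 \<le> \<theta>" "\<theta> \<le> t" for \<theta>
        using near'[of \<theta>] that t by simp
    qed
    ultimately show "arc_fun \<kappa>1 m1 t \<noteq> 0 \<and> \<sigma> * arc_fun \<kappa>2 m2 t \<noteq> 0" using \<sigma>(1) by simp
  next
    fix t assume t: "\<tau> \<le> t" "t \<le> b"
    have t': "pi / 2 \<le> t" using t \<tau> by simp
    have s2: "s t \<ge> 2" using s_mono[OF \<tau>(1) _ t(2)] t \<tau>(3) by (cases "\<tau> = t") auto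
    define h where "h = of_int \<kappa>1 * (pi / 2)"
    have sin2h: "sin (2 * h) = 0" by (simp add: h_def sin_int_times_real mult.commute)
    define e1 where "e1 = Re (arc_error \<kappa>1 m1 (cis t))"
    define e2 where "e2 = \<sigma> * Re (arc_error \<kappa>2 m2 (cis t))"
    define d1 where "d1 = Re (\<i> * cis t * deriv (arc_error \<kappa>1 m1) (cis t))"
    define d2 where "d2 = \<sigma> * Re (\<i> * cis t * deriv (arc_error \<kappa>2 m2) (cis t))"
    have "\<bar>\<sigma>\<bar> * \<bar>\<sigma>\<bar> = 1" using \<sigma>(2) by simp
    hence as: "\<bar>\<sigma>\<bar> = 1" by (metis abs_ge_zero abs_mult_self_eq abs_1 power2_eq_square power2_eq_iff_nonneg zero_le_one mult_1)
    have D0: "0 \<le> D" using D by simp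
    have b1: "\<bar>e1\<bar> * D \<le> 1/10"
      unfolding e1_def by (rule order_trans[OF mult_right_mono[OF abs_Re_le_cmod D0]]) (use err1[OF t' t(2)] in simp)
    have b2: "\<bar>e2\<bar> * D \<le> 1/10"
      unfolding e2_def abs_mult as mult_1
      by (rule order_trans[OF mult_right_mono[OF abs_Re_le_cmod D0]]) (use err2[OF t' t(2)] in simp)
    have b3: "\<bar>d1\<bar> \<le> 1/10" using abs_Re_rotated_le[of t "deriv (arc_error \<kappa>1 m1) (cis t)"] err1[OF t' t(2)] by (simp only: d1_def) linarith
    have b4: "\<bar>d2\<bar> \<le> 1/10" using abs_Re_rotated_le[of t "deriv (arc_error \<kappa>2 m2) (cis t)"] err2[OF t' t(2)]
      by (simp only: d2_def abs_mult as) linarith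
    define p1 p2 q1 q2 where "p1 = arc_phase \<kappa>1 m1 t" and "p2 = arc_phase \<kappa>2 m2 t"
      and "q1 = arc_speed \<kappa>1 m1 t" and "q2 = arc_speed \<kappa>2 m2 t"
    have q: "1 \<le> q1" "q1 \<le> q2" "q2 \<le> D" using speed[OF t' t(2)] by (auto simp: q1_def q2_def)
    \<comment> \<open>\<open>far\<close> already charges the full difference of the speeds, so |sin
      (p1 + p2)| is bounded by 1 here.\<close>
    have "(q2 - q1) * \<bar>sin (p1 + p2)\<bar> \<le> (q2 - q1) * 1" using q by (intro mult_left_mono) auto
    have main: "(q1 + q2) * sin (p2 - p1) - (q2 - q1) * \<bar>sin (p1 + p2)\<bar> \<ge> 1"
    proof -
      have "(q1 + q2) * sin (p2 - p1) - (q2 - q1) \<ge> 1"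
        using far[OF t' t(2)] s2 unfolding p1_def p2_def q1_def q2_def s_def by blast
      with \<open>(q2 - q1) * \<bar>sin (p1 + p2)\<bar> \<le> (q2 - q1) * 1\<close> show ?thesis unfolding mult_1_right by linarith
    qed
    have F: "arc_fun \<kappa>1 m1 t = 2 * cos (h + p1) + e1" by (simp add: arc_fun_phase h_def p1_def e1_def)
    have F': "arc_deriv \<kappa>1 m1 t = - (2 * q1 * sin (h + p1)) + d1" by (simp add: arc_deriv_def h_def p1_def q1_def d1_def)
    have G: "\<sigma> * arc_fun \<kappa>2 m2 t = 2 * cos (h + p2) + e2"
    proof -
      have "\<sigma> * arc_fun \<kappa>2 m2 t = (\<sigma> * \<sigma>) * (2 * cos (h + p2)) + e2"
        unfolding arc_fun_phase \<sigma>(3) h_def p2_def e2_def by (simp add: algebra_simps)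
      thus ?thesis by (simp add: \<sigma>(2))
    qed
    have G': "\<sigma> * arc_deriv \<kappa>2 m2 t = - (2 * q2 * sin (h + p2)) + d2"
    proof -
      have "\<sigma> * arc_deriv \<kappa>2 m2 t = (\<sigma> * \<sigma>) * (- (2 * q2 * sin (h + p2))) + d2"
        unfolding arc_deriv_def \<sigma>(4) h_def p2_def q2_def d2_def by (simp add: algebra_simps)
      thus ?thesis by (simp add: \<sigma>(2))
    qed
    show "arc_fun \<kappa>1 m1 t * (\<sigma> * arc_deriv \<kappa>2 m2 t) - arc_deriv \<kappa>1 m1 t * (\<sigma> * arc_fun \<kappa>2 m2 t) \<noteq> 0"
      unfolding F F' G G' using wronskian_negative[OF sin2h _ _ D b1 b2 b3 b4 q(2) main] q by simp
  next
    fix t assume t: "pi / 2 < t" "t < b"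
    have st: "sin t > 0" using sn t by simp
    show "basis_form (2 * \<kappa>1) m1 (cis t) = 0 \<longleftrightarrow> arc_fun \<kappa>1 m1 t = 0" by (rule basis_form_zero_iff[OF f1 st])
    show "basis_form (2 * \<kappa>2) m2 (cis t) = 0 \<longleftrightarrow> \<sigma> * arc_fun \<kappa>2 m2 t = 0"
      using basis_form_zero_iff[OF f2 st] \<sigma>(1) by simp
  qed
qed

section \<open>The two families of neighbouring forms\<close>

lemma arc_shift:
  fixes b \<theta> :: real
  assumes "pi / 2 \<le> \<theta>" "\<theta> \<le> b" "b < 2 * pi / 3"
  defines "x \<equiv> \<theta> - pi / 2"
  shows "0 \<le> x" "x < pi / 6" "x \<le> 1" "cos \<theta> = - sin x" "sin \<theta> = cos x" "(5/6) * x \<le> sin x" "sin x \<le> x"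
    "1/2 \<le> cos x" "cos x \<le> 1"
proof -
  have \<theta>: "\<theta> = x + pi / 2" by (simp add: x_def)
  show 1: "0 \<le> x" "x < pi / 6" using assms by (auto simp: x_def)
  show 2: "x \<le> 1" using 1 pi_less_4 by linarith
  show "cos \<theta> = - sin x" "sin \<theta> = cos x" unfolding \<theta> by (simp_all add: cos_add sin_add)
  show "(5/6) * x \<le> sin x" by (rule sin_ge_linear[OF 1(1) 2])
  show "sin x \<le> x" by (rule sin_x_le_x[OF 1(1)])
  have "x\<^sup>2 \<le> 1" using 1 2 by (simp add: power_le_one)
  thus "1/2 \<le> cos x" using cos_ge_quadratic[of x] by simp
qed simp

lemma interlacing_empty: "b \<le> a \<Longrightarrow> interlacing_zeros_on_arc f g a b"
proof -
  assume "b \<le> a"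
  hence "arc_zeros f a b = {}" for f by (auto simp: arc_zeros_def)
  thus ?thesis unfolding interlacing_zeros_on_arc_def by (simp add: Let_def consecutive_in_def)
qed

lemma is_basis_form_basis_form:
  assumes "weight_ell (2 * \<kappa>) + m \<ge> 0"
  shows "is_basis_form (2 * \<kappa>) m (basis_form (2 * \<kappa>) m)"
proof -
  obtain a b where "2 * \<kappa> = 12 * weight_ell (2 * \<kappa>) + 4 * int a + 6 * int b"
    using even_weight_decomp[of "2 * \<kappa>"] by (metis dvd_triv_left)
  from basis_form_formula[OF refl this assms] show ?thesis by metis
qed

lemma weight_ell_nonneg: "\<kappa> \<ge> 7 \<Longrightarrow> weight_ell (2 * \<kappa>) \<ge> 0"
  using weight_ell_bounds(2)[of "2 * \<kappa>"] by simp

text \<open>With x = \<theta> - \<pi>/2 the phases differ by 6x and the speeds by 6. As b <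
  2\<pi>/3, the phase difference stays below \<pi> up to the end of the arc, and its sine stays away
  from 0 once 6x exceeds 1.\<close>

lemma interlacing_weight:
  fixes m :: int and b :: real
  assumes m: "m \<ge> 0" and b: "pi / 2 < b" "b < 2 * pi / 3"
  shows "\<forall>\<^sub>F \<kappa> in at_top. interlacing_zeros_on_arc (basis_form (2 * \<kappa>) m) (basis_form (2 * (\<kappa> + 6)) m) (pi / 2) b"
proof -
  have "6 * (b - pi / 2) < pi" using b by simp
  then obtain c where c: "c > 0" "\<And>x. 1 \<le> x \<Longrightarrow> x \<le> 6 * (b - pi / 2) \<Longrightarrow> sin x \<ge> c"
    using sin_lower_bound by blast
  have shift: "filterlim (\<lambda>\<kappa>::int. \<kappa> + 6) at_top at_top"
    unfolding filterlim_at_top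
  proof
    fix Z :: int show "\<forall>\<^sub>F \<kappa> in at_top. Z \<le> \<kappa> + 6"
      using eventually_ge_at_top[of Z] by eventually_elim simp
  qed
  note ev = uniform_error_weight[OF b(2) _ m, of "1/100"]
  have ev1: "\<forall>\<^sub>F \<kappa> in at_top. \<forall>t\<in>{pi/2..b}. norm (arc_error \<kappa> m (cis t)) * arc_size \<kappa> m \<le> 1/100 \<and>
           norm (deriv (arc_error \<kappa> m) (cis t)) \<le> 1/100" using ev by simp
  have ev2: "\<forall>\<^sub>F \<kappa> in at_top. \<forall>t\<in>{pi/2..b}. norm (arc_error (\<kappa> + 6) m (cis t)) * arc_size (\<kappa> + 6) m \<le> 1/100 \<and>
           norm (deriv (arc_error (\<kappa> + 6) m) (cis t)) \<le> 1/100"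
    using filterlim_iff[THEN iffD1, OF shift] ev1 by blast
  \<comment> \<open>7/c serves the far part of the arc, 2/(b - \<pi>/2) makes the phase reach 2 at
    b, 20m keeps 2\<pi>m below 7/20 of k, and 12 controls the part next to \<pi>/2.\<close>
  define K where "K = \<lceil>7 / c\<rceil> + \<lceil>2 / (b - pi / 2)\<rceil> + 20 * m + 12"
  show ?thesis
    using ev1 ev2 eventually_ge_at_top[of K]
  proof eventually_elim
    case (elim \<kappa>)
    define k where "k = (of_int \<kappa> :: real)"
    define M where "M = (of_int m :: real)"
    have c7: "7 / c > 0" and xb: "2 / (b - pi / 2) > 0" using c b by auto
    have K1: "k \<ge> 7 / c + 2 / (b - pi / 2) + 20 * M + 12"
    proof -
      have "of_int K \<le> k" using elim(3) by (simp add: k_def)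
      moreover have "of_int K = of_int \<lceil>7 / c\<rceil> + of_int \<lceil>2 / (b - pi / 2)\<rceil> + 20 * M + 12" by (simp add: K_def M_def)
      ultimately show ?thesis using le_of_int_ceiling[of "7 / c"] le_of_int_ceiling[of "2 / (b - pi / 2)"] by linarith
    qed
    have M0: "M \<ge> 0" using m by (simp add: M_def)
    have k12: "k \<ge> 12" "k \<ge> 20 * M" "k \<ge> 7 / c" "k \<ge> 2 / (b - pi / 2)" using K1 M0 c7 xb by linarith+
    have \<kappa>12: "\<kappa> \<ge> 12" using k12(1) by (simp add: k_def)
    have w: "weight_ell (2 * \<kappa>) + m \<ge> 0" "weight_ell (2 * (\<kappa> + 6)) + m \<ge> 0"
      using weight_ell_nonneg[of \<kappa>] weight_ell_nonneg[of "\<kappa> + 6"] \<kappa>12 m by auto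
    have size: "arc_size \<kappa> m = k + M + 1" "arc_size (\<kappa> + 6) m = k + 6 + M + 1"
      using \<kappa>12 m by (auto simp: arc_size_def k_def M_def)
    have phase: "arc_phase \<kappa> m \<theta> = k * (\<theta> - pi/2) + 2 * pi * M * sin (\<theta> - pi/2)"
      "arc_phase (\<kappa> + 6) m \<theta> = k * (\<theta> - pi/2) + 6 * (\<theta> - pi/2) + 2 * pi * M * sin (\<theta> - pi/2)"
      if "pi / 2 \<le> \<theta>" "\<theta> \<le> b" for \<theta>
      unfolding arc_phase_def arc_shift(4)[OF that b(2)] by (simp_all add: k_def M_def algebra_simps)
    have speed: "arc_speed \<kappa> m \<theta> = k + 2 * pi * M * cos (\<theta> - pi/2)"
      "arc_speed (\<kappa> + 6) m \<theta> = k + 6 + 2 * pi * M * cos (\<theta> - pi/2)"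
      if "pi / 2 \<le> \<theta>" "\<theta> \<le> b" for \<theta>
      unfolding arc_speed_def arc_shift(5)[OF that b(2)] by (simp_all add: k_def M_def)
    define P where "P = 2 * pi * M"
    have P: "0 \<le> P" "P \<le> 7 * M"
      using M0 pi_approx mult_right_mono[of "2 * pi" 7 M] by (auto simp: P_def)
    have Dn: "norm e * (k + 6 + 7 * M) \<le> 1/10" if "norm e * (k + M + 1) \<le> 1/100" for e :: complex
    proof -
      \<comment> \<open>The bound for the speeds is at most ten times the size, hence the passage
        from 1/100 to 1/10.\<close>
      have "norm e * (k + 6 + 7 * M) \<le> norm e * (10 * (k + M + 1))"
        using k12 M0 by (intro mult_left_mono) auto
      also have "\<dots> = 10 * (norm e * (k + M + 1))" by (rule mult.left_commute)
      finally show ?thesis using that by linarith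
    qed
    have "interlacing_zeros_on_arc (basis_form (2 * \<kappa>) m) (basis_form (2 * (\<kappa> + 6)) m) (pi / 2) b"
    proof (rule interlacing_pair[OF is_basis_form_basis_form[OF w(1)] is_basis_form_basis_form[OF w(2)] b,
            where \<sigma> = "-1" and D = "k + 6 + 7 * M"])
      \<comment> \<open>Raising \<kappa> by 6 shifts the offset by 3\<pi>, so \<sigma> = -1.\<close>
      have "of_int (\<kappa> + 6) * (pi / 2) + x = (of_int \<kappa> * (pi / 2) + x + pi) + 2 * pi" for x
        by (simp add: algebra_simps)
      thus "cos (of_int (\<kappa> + 6) * (pi / 2) + x) = -1 * cos (of_int \<kappa> * (pi / 2) + x)"
        "sin (of_int (\<kappa> + 6) * (pi / 2) + x) = -1 * sin (of_int \<kappa> * (pi / 2) + x)" for x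
        by (simp_all only: cos_periodic sin_periodic cos_periodic_pi sin_periodic_pi mult_minus1)
    next
      fix \<theta> assume \<theta>: "pi / 2 \<le> \<theta>" "\<theta> \<le> b"
      define x where "x = \<theta> - pi / 2"
      note x = arc_shift[OF \<theta> b(2), folded x_def]
      have Pc: "0 \<le> P * cos x" "P * cos x \<le> P" using P x by (auto intro: mult_left_le)
      have Ps: "0 \<le> P * sin x" "P * sin x \<le> P * x" using P x by (auto intro: mult_left_mono)
      have ph: "arc_phase \<kappa> m \<theta> = k * x + P * sin x" "arc_phase (\<kappa> + 6) m \<theta> = k * x + 6 * x + P * sin x"
        unfolding phase[OF \<theta>] by (simp_all add: x_def P_def)
      have sp: "arc_speed \<kappa> m \<theta> = k + P * cos x" "arc_speed (\<kappa> + 6) m \<theta> = k + 6 + P * cos x"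
        unfolding speed[OF \<theta>] by (simp_all add: x_def P_def)
      have kx: "12 * x \<le> k * x" using k12 x by (intro mult_right_mono) auto
      show "norm (arc_error \<kappa> m (cis \<theta>)) * (k + 6 + 7 * M) \<le> 1/10 \<and> norm (deriv (arc_error \<kappa> m) (cis \<theta>)) \<le> 1/10"
        using elim(1) \<theta> Dn[of "arc_error \<kappa> m (cis \<theta>)"] unfolding size by force
      have "norm (arc_error (\<kappa> + 6) m (cis \<theta>)) * (k + M + 1) \<le> norm (arc_error (\<kappa> + 6) m (cis \<theta>)) * (k + 6 + M + 1)"
        by (intro mult_left_mono) auto
      thus "norm (arc_error (\<kappa> + 6) m (cis \<theta>)) * (k + 6 + 7 * M) \<le> 1/10 \<and> norm (deriv (arc_error (\<kappa> + 6) m) (cis \<theta>)) \<le> 1/10"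
        using elim(2) \<theta> Dn[of "arc_error (\<kappa> + 6) m (cis \<theta>)"] unfolding size by force
      show "1 \<le> arc_speed \<kappa> m \<theta> \<and> arc_speed \<kappa> m \<theta> \<le> arc_speed (\<kappa> + 6) m \<theta> \<and> arc_speed (\<kappa> + 6) m \<theta> \<le> k + 6 + 7 * M"
        unfolding sp using Pc P k12 by simp
      show "0 \<le> arc_phase \<kappa> m \<theta> \<and> arc_phase \<kappa> m \<theta> \<le> arc_phase (\<kappa> + 6) m \<theta> \<and> arc_phase (\<kappa> + 6) m \<theta> \<le> 6/5"
        if "arc_phase \<kappa> m \<theta> + arc_phase (\<kappa> + 6) m \<theta> \<le> 2"
      proof -
        have le: "2 * (k * x) + 6 * x + 2 * (P * sin x) \<le> 2" using that unfolding ph by linarith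
        \<comment> \<open>30 = 2 * 12 + 6. The second phase is half the sum plus 3x, hence at most 1
          + 3/15 = 6/5.\<close>
        have "30 * x \<le> 2" using le kx Ps by linarith
        thus ?thesis unfolding ph using le kx Ps x by (intro conjI) linarith+
      qed
      show "1 \<le> (arc_speed \<kappa> m \<theta> + arc_speed (\<kappa> + 6) m \<theta>) * sin (arc_phase (\<kappa> + 6) m \<theta> - arc_phase \<kappa> m \<theta>)
          - (arc_speed (\<kappa> + 6) m \<theta> - arc_speed \<kappa> m \<theta>)"
        if "2 \<le> arc_phase \<kappa> m \<theta> + arc_phase (\<kappa> + 6) m \<theta>"
      proof -
        \<comment> \<open>7 is the speed difference 6 plus the required margin 1.\<close>
        have s6: "7 \<le> (2 * k + 6) * sin (6 * x) \<and> 0 \<le> sin (6 * x)"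
        proof (cases "6 * x \<le> 1")
          case True
          have sx: "5 * x \<le> sin (6 * x)" using sin_ge_linear[of "6 * x"] True x by simp
          have "2 \<le> 2 * (k * x) + 6 * x + 2 * (P * x)" using that Ps unfolding ph by linarith
          moreover have "P * x \<le> (7/20 * k) * x" using P k12 x by (intro mult_right_mono) auto
          ultimately have "2 \<le> (27/10) * (k * x) + 6 * x" by linarith
          \<comment> \<open>The preceding inequality times 7/2: (7/2) * (27/10) < 10 and (7/2) * 6 <
            30.\<close>
          hence "7 \<le> (2 * k + 6) * (5 * x)" using kx x by (simp add: algebra_simps)
          also have "\<dots> \<le> (2 * k + 6) * sin (6 * x)" using sx k12 by (intro mult_left_mono) auto
          finally show ?thesis using sx x by simp
        next
          case False
          have "6 * x \<le> 6 * (b - pi / 2)" using \<theta> by (simp add: x_def)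
          hence cs: "c \<le> sin (6 * x)" using c(2)[of "6 * x"] False by simp
          have "7 \<le> k * c" using k12(3) c(1) by (simp add: divide_le_eq)
          also have "\<dots> \<le> (2 * k + 6) * sin (6 * x)" using cs c k12 by (intro mult_mono) auto
          finally show ?thesis using cs c by simp
        qed
        have "(2 * k + 6) * sin (6 * x) \<le> (2 * k + 6 + 2 * (P * cos x)) * sin (6 * x)"
          using s6 Pc by (intro mult_right_mono) auto
        moreover have "arc_speed \<kappa> m \<theta> + arc_speed (\<kappa> + 6) m \<theta> = 2 * k + 6 + 2 * (P * cos x)" unfolding sp by simp
        moreover have "arc_phase (\<kappa> + 6) m \<theta> - arc_phase \<kappa> m \<theta> = 6 * x" unfolding ph by simp
        moreover have "arc_speed (\<kappa> + 6) m \<theta> - arc_speed \<kappa> m \<theta> = 6" unfolding sp by simp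
        ultimately show ?thesis using s6 by simp
      qed
    next
      have bb: "pi / 2 \<le> b" "b \<le> b" using b by auto
      define x where "x = b - pi / 2"
      note x = arc_shift[OF bb b(2), folded x_def]
      have "2 \<le> k * x" using k12(4) b(1) by (simp add: divide_le_eq x_def)
      moreover have "0 \<le> P * sin x" using P x by auto
      ultimately show "2 \<le> arc_phase \<kappa> m b + arc_phase (\<kappa> + 6) m b"
        unfolding phase[OF bb] P_def[symmetric] x_def[symmetric] using x(1) by linarith
    qed (use k12 M0 in auto)
    thus ?case .
  qed
qed

text \<open>The phases differ by 2\<pi> sin x, which is less than \<pi> since sin (\<pi>/6) = 1/2.
  The fixed weight enters through |k|, which m eventually dominates.\<close>

lemma interlacing_order:
  fixes \<kappa> :: int and b :: real
  assumes b: "pi / 2 < b" "b < 2 * pi / 3"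
  shows "\<forall>\<^sub>F m in at_top. interlacing_zeros_on_arc (basis_form (2 * \<kappa>) m) (basis_form (2 * \<kappa>) (m + 1)) (pi / 2) b"
proof -
  have xb: "0 < b - pi / 2" "b - pi / 2 < pi / 6" using b by auto
  have ub: "sin (b - pi / 2) > 0" using xb pi_gt_zero by (intro sin_gt_zero) linarith+
  have "sin (b - pi / 2) < sin (pi / 6)" using xb by (intro sin_monotone_2pi) auto
  hence "2 * pi * sin (b - pi / 2) < 2 * pi * (1/2)" unfolding sin_30 by (intro mult_strict_left_mono) auto
  hence "2 * pi * sin (b - pi / 2) < pi" by simp
  then obtain c where c: "c > 0" "\<And>x. 1 \<le> x \<Longrightarrow> x \<le> 2 * pi * sin (b - pi / 2) \<Longrightarrow> sin x \<ge> c"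
    using sin_lower_bound by blast
  have shift: "filterlim (\<lambda>m::int. m + 1) at_top at_top"
    unfolding filterlim_at_top
  proof
    fix Z :: int show "\<forall>\<^sub>F m in at_top. Z \<le> m + 1"
      using eventually_ge_at_top[of Z] by eventually_elim simp
  qed
  have ev1: "\<forall>\<^sub>F m in at_top. \<forall>t\<in>{pi/2..b}. norm (arc_error \<kappa> m (cis t)) * arc_size \<kappa> m \<le> 1/100 \<and>
           norm (deriv (arc_error \<kappa> m) (cis t)) \<le> 1/100" by (rule uniform_error_order[OF b(2)]) simp
  have ev2: "\<forall>\<^sub>F m in at_top. \<forall>t\<in>{pi/2..b}. norm (arc_error \<kappa> (m + 1) (cis t)) * arc_size \<kappa> (m + 1) \<le> 1/100 \<and>
           norm (deriv (arc_error \<kappa> (m + 1)) (cis t)) \<le> 1/100"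
    using filterlim_iff[THEN iffD1, OF shift] ev1 by blast
  \<comment> \<open>1/c serves the far part, 1/sin (b - \<pi>/2) makes the phases reach 2 at b,
    40|\<kappa>| lets m dominate the weight, |\<ell>| ensures that both forms exist, and 100 absorbs
    bounded terms.\<close>
  define K where "K = \<lceil>1 / c\<rceil> + \<lceil>1 / sin (b - pi / 2)\<rceil> + 40 * \<bar>\<kappa>\<bar> + \<bar>weight_ell (2 * \<kappa>)\<bar> + 100"
  show ?thesis
    using ev1 ev2 eventually_ge_at_top[of K]
  proof eventually_elim
    case (elim m)
    define k where "k = (of_int \<kappa> :: real)"
    define A where "A = \<bar>k\<bar>"
    define M where "M = (of_int m :: real)"
    have c1: "1 / c > 0" and s1: "1 / sin (b - pi / 2) > 0" using c ub by auto
    have K1: "M \<ge> 1 / c + 1 / sin (b - pi / 2) + 40 * A + \<bar>of_int (weight_ell (2 * \<kappa>))\<bar> + 100"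
    proof -
      have "of_int K \<le> M" using elim(3) by (simp add: M_def)
      moreover have "of_int K = of_int \<lceil>1 / c\<rceil> + of_int \<lceil>1 / sin (b - pi / 2)\<rceil> + 40 * A + \<bar>of_int (weight_ell (2 * \<kappa>))\<bar> + 100"
        by (simp add: K_def A_def k_def)
      ultimately show ?thesis using le_of_int_ceiling[of "1 / c"] le_of_int_ceiling[of "1 / sin (b - pi / 2)"] by linarith
    qed
    have A0: "A \<ge> 0" by (simp add: A_def)
    have M10: "M \<ge> 40 * A + 100" "M \<ge> 1 / c" "M \<ge> 1 / sin (b - pi / 2)" "M \<ge> 10" using K1 A0 c1 s1 by linarith+
    have "\<bar>of_int (weight_ell (2 * \<kappa>)) :: real\<bar> \<le> M" using K1 A0 c1 s1 by linarith
    hence w: "weight_ell (2 * \<kappa>) + m \<ge> 0" "weight_ell (2 * \<kappa>) + (m + 1) \<ge> 0" unfolding M_def by linarith+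
    have m0: "m \<ge> 0" using M10(4) by (simp add: M_def)
    have size: "arc_size \<kappa> m = A + M + 1" "arc_size \<kappa> (m + 1) = A + (M + 1) + 1"
      using m0 by (auto simp: arc_size_def k_def M_def A_def)
    define P where "P = 2 * pi * M"
    define Q where "Q = 2 * pi"
    have Q: "6 \<le> Q" "Q \<le> 63/10" using pi_approx by (auto simp: Q_def)
    have PQ: "P = Q * M" by (simp add: P_def Q_def)
    have P: "6 * M \<le> P" "P \<le> (63/10) * M" unfolding PQ using Q M10(4) by (auto intro!: mult_right_mono)
    have phase: "arc_phase \<kappa> m \<theta> = k * (\<theta> - pi/2) + P * sin (\<theta> - pi/2)"
      "arc_phase \<kappa> (m + 1) \<theta> = k * (\<theta> - pi/2) + P * sin (\<theta> - pi/2) + Q * sin (\<theta> - pi/2)"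
      if "pi / 2 \<le> \<theta>" "\<theta> \<le> b" for \<theta>
      unfolding arc_phase_def arc_shift(4)[OF that b(2)] P_def Q_def by (simp_all add: k_def M_def algebra_simps)
    have speed: "arc_speed \<kappa> m \<theta> = k + P * cos (\<theta> - pi/2)"
      "arc_speed \<kappa> (m + 1) \<theta> = k + P * cos (\<theta> - pi/2) + Q * cos (\<theta> - pi/2)"
      if "pi / 2 \<le> \<theta>" "\<theta> \<le> b" for \<theta>
      unfolding arc_speed_def arc_shift(5)[OF that b(2)] P_def Q_def by (simp_all add: k_def M_def algebra_simps)
    have Dn: "norm e * (A + 7 * M + 7) \<le> 1/10" if "norm e * (A + M + 1) \<le> 1/100" for e :: complex
    proof -
      have "norm e * (A + 7 * M + 7) \<le> norm e * (10 * (A + M + 1))"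
        using A0 M10 by (intro mult_left_mono) auto
      also have "\<dots> = 10 * (norm e * (A + M + 1))" by (rule mult.left_commute)
      finally show ?thesis using that by linarith
    qed
    have "interlacing_zeros_on_arc (basis_form (2 * \<kappa>) m) (basis_form (2 * \<kappa>) (m + 1)) (pi / 2) b"
    proof (rule interlacing_pair[OF is_basis_form_basis_form[OF w(1)] is_basis_form_basis_form[OF w(2)] b,
            where \<sigma> = 1 and D = "A + 7 * M + 7"])
      fix \<theta> assume \<theta>: "pi / 2 \<le> \<theta>" "\<theta> \<le> b"
      define x where "x = \<theta> - pi / 2"
      define u where "u = sin x"
      define v where "v = cos x"
      note x = arc_shift[OF \<theta> b(2), folded x_def, folded u_def v_def]
      have u0: "u \<ge> 0" using x by linarith
      have v: "1/2 \<le> v" "v \<le> 1" using x by auto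
      have ph: "arc_phase \<kappa> m \<theta> = k * x + P * u" "arc_phase \<kappa> (m + 1) \<theta> = k * x + P * u + Q * u"
        unfolding phase[OF \<theta>] by (simp_all add: x_def u_def)
      have sp: "arc_speed \<kappa> m \<theta> = k + P * v" "arc_speed \<kappa> (m + 1) \<theta> = k + P * v + Q * v"
        unfolding speed[OF \<theta>] by (simp_all add: x_def v_def)
      have kx: "\<bar>k * x\<bar> \<le> 2 * (A * u)"
      proof -
        have "\<bar>k * x\<bar> = A * x" using x by (simp add: A_def abs_mult)
        also have "\<dots> \<le> A * (2 * u)" using x A0 by (intro mult_left_mono) linarith+
        finally show ?thesis by simp
      qed
      have Mu: "40 * (A * u) + 100 * u \<le> M * u" using mult_right_mono[OF M10(1) u0] by (simp add: algebra_simps)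
      have Pu: "6 * (M * u) \<le> P * u" "P * u \<le> (63/10) * (M * u)"
        using mult_right_mono[OF P(1) u0] mult_right_mono[OF P(2) u0] by (simp_all add: mult.assoc)
      have Qu: "6 * u \<le> Q * u" "Q * u \<le> (63/10) * u" using mult_right_mono[OF Q(1) u0] mult_right_mono[OF Q(2) u0] by simp_all
      have Au: "0 \<le> A * u" using A0 u0 by simp
      have Av: "A \<le> 2 * (A * v)" using mult_left_mono[OF v(1) A0] by simp
      have Mv: "40 * (A * v) + 100 * v \<le> M * v" using mult_right_mono[OF M10(1), of v] v by (simp add: algebra_simps)
      have Pv: "6 * (M * v) \<le> P * v" "P * v \<le> 7 * M"
      proof -
        show "6 * (M * v) \<le> P * v" using mult_right_mono[OF P(1), of v] v by (simp add: mult.assoc)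
        have "0 \<le> P" using P(1) M10(4) by linarith
        hence "P * v \<le> P" using v(2) by (rule mult_left_le[rotated])
        thus "P * v \<le> 7 * M" using P(2) M10(4) by linarith
      qed
      have Qv: "6 * v \<le> Q * v" "Q * v \<le> (63/10) * v" using mult_right_mono[OF Q(1), of v] mult_right_mono[OF Q(2), of v] v by simp_all
      have kA: "\<bar>k\<bar> = A" by (simp add: A_def)
      show "norm (arc_error \<kappa> m (cis \<theta>)) * (A + 7 * M + 7) \<le> 1/10 \<and> norm (deriv (arc_error \<kappa> m) (cis \<theta>)) \<le> 1/10"
        using elim(1) \<theta> Dn[of "arc_error \<kappa> m (cis \<theta>)"] unfolding size by force
      have "norm (arc_error \<kappa> (m + 1) (cis \<theta>)) * (A + M + 1) \<le> norm (arc_error \<kappa> (m + 1) (cis \<theta>)) * (A + (M + 1) + 1)"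
        by (intro mult_left_mono) auto
      thus "norm (arc_error \<kappa> (m + 1) (cis \<theta>)) * (A + 7 * M + 7) \<le> 1/10 \<and> norm (deriv (arc_error \<kappa> (m + 1)) (cis \<theta>)) \<le> 1/10"
        using elim(2) \<theta> Dn[of "arc_error \<kappa> (m + 1) (cis \<theta>)"] unfolding size by force
      show "1 \<le> arc_speed \<kappa> m \<theta> \<and> arc_speed \<kappa> m \<theta> \<le> arc_speed \<kappa> (m + 1) \<theta> \<and> arc_speed \<kappa> (m + 1) \<theta> \<le> A + 7 * M + 7"
        unfolding sp using Pv Qv Mv Av v kA A0 by (intro conjI) linarith+
      show "0 \<le> arc_phase \<kappa> m \<theta> \<and> arc_phase \<kappa> m \<theta> \<le> arc_phase \<kappa> (m + 1) \<theta> \<and> arc_phase \<kappa> (m + 1) \<theta> \<le> 6/5"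
        if "arc_phase \<kappa> m \<theta> + arc_phase \<kappa> (m + 1) \<theta> \<le> 2"
      proof -
        have le: "2 * (k * x) + 2 * (P * u) + Q * u \<le> 2" using that unfolding ph by linarith
        \<comment> \<open>The second phase is half the sum plus Qu/2, and Mu \<ge> 100u makes Qu
          small.\<close>
        show ?thesis unfolding ph using le kx Mu Pu Qu Au u0 by (intro conjI) linarith+
      qed
      show "1 \<le> (arc_speed \<kappa> m \<theta> + arc_speed \<kappa> (m + 1) \<theta>) * sin (arc_phase \<kappa> (m + 1) \<theta> - arc_phase \<kappa> m \<theta>)
          - (arc_speed \<kappa> (m + 1) \<theta> - arc_speed \<kappa> m \<theta>)"
        if "2 \<le> arc_phase \<kappa> m \<theta> + arc_phase \<kappa> (m + 1) \<theta>"
      proof -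
        have ge: "2 \<le> 2 * (k * x) + 2 * (P * u) + Q * u" using that unfolding ph by linarith
        \<comment> \<open>83/10 is chosen so that v times it exceeds Qv \<le> (63/10) v by at least
          2v \<ge> 1.\<close>
        have s: "83/10 \<le> (11 * M) * sin (Q * u) \<and> 0 \<le> sin (Q * u)"
        proof (cases "Q * u \<le> 1")
          case True
          have sQ: "5 * u \<le> sin (Q * u)" using sin_ge_linear[of "Q * u"] True Qu u0 by simp
          \<comment> \<open>The terms in Au and Qu are absorbed by a tenth of Mu, and 55 * 20/127 >
            83/10.\<close>
          have "2 \<le> (127/10) * (M * u)" using ge kx Pu Qu Mu Au by linarith
          hence "83/10 \<le> (11 * M) * (5 * u)" by (simp add: algebra_simps)
          also have "\<dots> \<le> (11 * M) * sin (Q * u)" using sQ M10(4) by (intro mult_left_mono) auto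
          finally show ?thesis using sQ u0 by simp
        next
          case False
          have "u \<le> sin (b - pi / 2)"
            unfolding u_def using \<theta> x xb by (intro sin_monotone_2pi_le) (auto simp: x_def)
          hence "Q * u \<le> 2 * pi * sin (b - pi / 2)" unfolding Q_def by (intro mult_left_mono) auto
          hence cs: "c \<le> sin (Q * u)" using c(2)[of "Q * u"] False by simp
          have "1 \<le> M * c" using M10(2) c(1) by (simp add: divide_le_eq)
          also have "\<dots> \<le> M * sin (Q * u)" using cs M10(4) by (intro mult_left_mono) auto
          finally have "1 \<le> M * sin (Q * u)" .
          moreover have "(11 * M) * sin (Q * u) = 11 * (M * sin (Q * u))" by simp
          ultimately show ?thesis using cs c by linarith
        qed
        \<comment> \<open>2Pv is at least 12Mv, while 2|k| \<le> 4Av is at most a tenth of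
          Mv.\<close>
        have "2 * k + 2 * (P * v) + Q * v \<ge> (11 * M) * v"
          using Pv Mv Av Qv v kA A0 by (simp only: mult.assoc)
        hence "((11 * M) * v) * sin (Q * u) \<le> (2 * k + 2 * (P * v) + Q * v) * sin (Q * u)"
          using s by (intro mult_right_mono) auto
        moreover have "((11 * M) * v) * sin (Q * u) \<ge> v * (83/10)"
          using mult_left_mono[of "83/10" "(11 * M) * sin (Q * u)" v] s v by (simp add: mult_ac)
        moreover have "v * (83/10) - Q * v \<ge> 1" using Qv v by linarith
        ultimately have final: "1 \<le> (2 * k + 2 * (P * v) + Q * v) * sin (Q * u) - Q * v" by linarith
        have "arc_speed \<kappa> m \<theta> + arc_speed \<kappa> (m + 1) \<theta> = 2 * k + 2 * (P * v) + Q * v" unfolding sp by simp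
        moreover have "arc_phase \<kappa> (m + 1) \<theta> - arc_phase \<kappa> m \<theta> = Q * u" unfolding ph by simp
        moreover have "arc_speed \<kappa> (m + 1) \<theta> - arc_speed \<kappa> m \<theta> = Q * v" unfolding sp by simp
        ultimately show ?thesis using final by simp
      qed
    next
      have bb: "pi / 2 \<le> b" "b \<le> b" using b by auto
      define x where "x = b - pi / 2"
      define u where "u = sin x"
      note x = arc_shift[OF bb b(2), folded x_def, folded u_def]
      have u: "u > 0" using ub by (simp add: u_def x_def)
      have "1 \<le> M * u" using M10(3) u unfolding u_def x_def by (simp add: divide_le_eq)
      moreover have "\<bar>k * x\<bar> \<le> 2 * (A * u)"
      proof -
        have "\<bar>k * x\<bar> = A * x" using x by (simp add: A_def abs_mult)
        also have "\<dots> \<le> A * (2 * u)" using x A0 by (intro mult_left_mono) linarith+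
        finally show ?thesis by simp
      qed
      moreover have "40 * (A * u) + 100 * u \<le> M * u" using mult_right_mono[OF M10(1), of u] u by (simp add: algebra_simps)
      moreover have "6 * (M * u) \<le> P * u" using mult_right_mono[OF P(1), of u] u by (simp add: mult.assoc)
      moreover have "0 \<le> Q * u" "0 \<le> A * u" using Q A0 u by auto
      ultimately show "2 \<le> arc_phase \<kappa> m b + arc_phase \<kappa> (m + 1) b"
        unfolding phase[OF bb] x_def[symmetric] u_def[symmetric] using u by linarith
    qed (use M10 A0 in auto)
    thus ?case .
  qed
qed

theorem theorem1p3:
  fixes \<epsilon> :: real
  assumes "\<epsilon> > 0"
  shows "(\<forall>m::int. m \<ge> 0 \<longrightarrow> (\<exists>K::int. \<forall>k\<ge>K. even k \<longrightarrow>
            interlacing_zeros_on_arc (basis_form k m) (basis_form (k + 12) m)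
              (pi / 2) (2 * pi / 3 - \<epsilon>))) \<and>
         (\<forall>k::int. even k \<longrightarrow> (\<exists>M::int. \<forall>m\<ge>M.
            interlacing_zeros_on_arc (basis_form k m) (basis_form k (m + 1))
              (pi / 2) (2 * pi / 3 - \<epsilon>)))"
proof (cases "pi / 2 < 2 * pi / 3 - \<epsilon>")
  case False
  \<comment> \<open>For large \<epsilon> the arc is empty.\<close>
  hence "interlacing_zeros_on_arc f g (pi / 2) (2 * pi / 3 - \<epsilon>)" for f g
    by (intro interlacing_empty) simp
  thus ?thesis by blast
next
  case True
  have b: "2 * pi / 3 - \<epsilon> < 2 * pi / 3" using assms by simp
  show ?thesis
  proof (intro conjI allI impI)
    fix m :: int assume "m \<ge> 0"
    from interlacing_weight[OF this True b] obtain K where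
      K: "\<And>\<kappa>. \<kappa> \<ge> K \<Longrightarrow> interlacing_zeros_on_arc (basis_form (2 * \<kappa>) m) (basis_form (2 * (\<kappa> + 6)) m) (pi / 2) (2 * pi / 3 - \<epsilon>)"
      unfolding eventually_at_top_linorder by blast
    show "\<exists>K. \<forall>k\<ge>K. even k \<longrightarrow> interlacing_zeros_on_arc (basis_form k m) (basis_form (k + 12) m) (pi / 2) (2 * pi / 3 - \<epsilon>)"
    proof (intro exI[of _ "2 * K"] allI impI)
      fix k :: int assume "2 * K \<le> k" "even k"
      moreover from this(2) obtain \<kappa> where "k = 2 * \<kappa>" by (elim evenE)
      ultimately show "interlacing_zeros_on_arc (basis_form k m) (basis_form (k + 12) m) (pi / 2) (2 * pi / 3 - \<epsilon>)"
        using K[of \<kappa>] by (simp add: algebra_simps)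
    qed
  next
    fix k :: int assume "even k"
    then obtain \<kappa> where "k = 2 * \<kappa>" by (elim evenE)
    thus "\<exists>M. \<forall>m\<ge>M. interlacing_zeros_on_arc (basis_form k m) (basis_form k (m + 1)) (pi / 2) (2 * pi / 3 - \<epsilon>)"
      using interlacing_order[OF True b, of \<kappa>] unfolding eventually_at_top_linorder by simp
  qed
qed

end
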